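(* Let $H$ be a pointed Hopf algebra over $\mathbb{K}$ of discrete corepresentation type and let $B$ be the link-indecomposable component of $H$ containing $1$. Then the ${\rm Ext}$-quiver $Q$ of the comodule category $\mathcal{M}^B$ is one of the following: $(1)$ The single vertex $1$, and $G(B)=\{1\}$. $(2)$ A complete oriented cycle, and $G(B)=\langle a \mid a^n=1\rangle$; $(3)$ the doubly infinite linear quiver $\cdots\rightarrow\cdot\rightarrow\cdot\rightarrow\cdot\rightarrow\cdots$, and $G(B)=\langle a \rangle$ (infinite cyclic); $(4)$ $Q^{m,n}$, and $G(B)=\langle a,b \mid ab=ba,\ a^m=b^n\rangle$ for some integers $(m,n)\neq\pm(1,1)$. The ${\rm Ext}$-quiver of $\mathcal{M}^H$ is a disjoint union of (possibly infinitely many) copies of one of the quivers in $(1)$–$(4)$.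
   Context: $\mathbb{K}$ is an algebraically closed field. A pointed coalgebra $C$ is of discrete corepresentation type if for any finite dimension vector $\underline{d}$ there are only finitely many indecomposable $C$-comodules of dimension vector $\underline{d}$. $\mathcal{M}^C$ denotes the category of right $C$-comodules and $G(C)$ the group(-like set) of grouplike elements. For grouplikes $g,h$, $P(g,h)=\{x\in C \mid \Delta(x)=g\otimes x+x\otimes h\}$. The ${\rm Ext}$-quiver of $\mathcal{M}^C$ has the grouplikes of $C$ as vertices, and the number of arrows from $g$ to $h$ is $\dim P(g,h)-1$. The link-indecomposable component containing $1$ is the subcoalgebra containing $1$ that is maximal with respect to its ${\rm Ext}$-quiver being connected (as an undirected graph); it is a Hopf subalgebra. For integers $(m,n)\neq\pm(1,1)$, $Q^{m,n}$ is the quiver whose vertex set is the group $\langle a,b\mid ab=ba,\ a^m=b^n\rangle$ and which has, for each vertex $a^ib^j$, exactly one arrow $a^ib^j\to a^{i+1}b^j$ and exactly one arrow $a^ib^j\to a^ib^{j+1}$.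
   Formalization: The number of loops at a grouplike g is taken to be dim P(g,g), not dim P(g,g)−1, since g−h vanishes for g=h and the literal formula would give −1 loops when P(g,g)=0; for distinct g, h it is dim P(g,h)−1 as stated. *)

theory Defs
  imports Main "HOL-Library.Groups_Big_Fun" "HOL-Library.Extended_Nat"
    "HOL-Library.Multiset" "HOL-Computational_Algebra.Polynomial"
begin

section \<open>Algebraically closed fields\<close>

definition alg_closed_field :: "'k::field itself \<Rightarrow> bool" where
  "alg_closed_field _ \<longleftrightarrow> (\<forall>p :: 'k poly. degree p > 0 \<longrightarrow> (\<exists>x. poly p x = 0))"

section \<open>Vectors over a basis: finitely supported functions\<close>

text \<open>A K-vector space is modelled with a chosen basis indexed by the type 'b;
  vectors are finitely supported functions 'b => 'k. Tensor products of such
  spaces are finitely supported functions on pairs of basis indices.\<close>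

definition fin :: "('c \<Rightarrow> 'k::zero) \<Rightarrow> bool" where
  "fin x \<longleftrightarrow> finite {b. x b \<noteq> 0}"

definition dlt :: "'b \<Rightarrow> 'b \<Rightarrow> 'k::{zero,one}" where
  "dlt b = (\<lambda>i. if i = b then 1 else 0)"

definition lspan :: "('c \<Rightarrow> 'k::field) set \<Rightarrow> ('c \<Rightarrow> 'k) set" where
  "lspan A = {(\<lambda>z. \<Sum>i<n. c i * v i z) | (n::nat) c v. \<forall>i<n. v i \<in> A}"

definition fin_dim :: "('c \<Rightarrow> 'k::field) set \<Rightarrow> bool" where
  "fin_dim S \<longleftrightarrow> (\<exists>(n::nat) v. (\<forall>i<n. v i \<in> S) \<and> lspan (v ` {..<n}) = S)"

definition fdim :: "('c \<Rightarrow> 'k::field) set \<Rightarrow> nat" where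
  "fdim S = (LEAST n::nat. \<exists>v. (\<forall>i<n. v i \<in> S) \<and> lspan (v ` {..<n}) = S)"

definition subspace :: "('c \<Rightarrow> 'k::field) set \<Rightarrow> bool" where
  "subspace S \<longleftrightarrow> (\<forall>x\<in>S. fin x) \<and> (\<lambda>_. 0) \<in> S \<and>
     (\<forall>x\<in>S. \<forall>y\<in>S. (\<lambda>z. x z + y z) \<in> S) \<and> (\<forall>c. \<forall>x\<in>S. (\<lambda>z. c * x z) \<in> S)"

definition tens :: "('b \<Rightarrow> 'k::field) \<Rightarrow> ('b \<Rightarrow> 'k) \<Rightarrow> ('b \<times> 'b \<Rightarrow> 'k)" where
  "tens x y = (\<lambda>(i, j). x i * y j)"

definition tensor_sp :: "('b \<Rightarrow> 'k::field) set \<Rightarrow> ('b \<Rightarrow> 'k) set \<Rightarrow> ('b \<times> 'b \<Rightarrow> 'k) set" where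
  "tensor_sp S T = lspan {tens x y | x y. x \<in> S \<and> y \<in> T}"

section \<open>Hopf algebras given by structure constants on a basis\<close>

record ('b, 'k) hopf =
  hmult :: "'b \<Rightarrow> 'b \<Rightarrow> 'b \<Rightarrow> 'k"        \<comment> \<open>product of two basis elements\<close>
  hunit :: "'b \<Rightarrow> 'k"                    \<comment> \<open>the unit element 1\<close>
  hcomult :: "'b \<Rightarrow> 'b \<times> 'b \<Rightarrow> 'k"     \<comment> \<open>comultiplication of a basis element\<close>
  hcounit :: "'b \<Rightarrow> 'k"                  \<comment> \<open>counit on basis elements\<close>
  hantipode :: "'b \<Rightarrow> 'b \<Rightarrow> 'k"         \<comment> \<open>antipode of a basis element\<close>

definition lin :: "('b \<Rightarrow> 'c \<Rightarrow> 'k::field) \<Rightarrow> ('b \<Rightarrow> 'k) \<Rightarrow> 'c \<Rightarrow> 'k" where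
  "lin F x = (\<lambda>c. Sum_any (\<lambda>b. x b * F b c))"

definition hmul :: "('b, 'k::field) hopf \<Rightarrow> ('b \<Rightarrow> 'k) \<Rightarrow> ('b \<Rightarrow> 'k) \<Rightarrow> 'b \<Rightarrow> 'k" where
  "hmul H x y = (\<lambda>c. Sum_any (\<lambda>a. Sum_any (\<lambda>b. x a * y b * hmult H a b c)))"

definition hDelta :: "('b, 'k::field) hopf \<Rightarrow> ('b \<Rightarrow> 'k) \<Rightarrow> 'b \<times> 'b \<Rightarrow> 'k" where
  "hDelta H x = lin (hcomult H) x"

definition heps :: "('b, 'k::field) hopf \<Rightarrow> ('b \<Rightarrow> 'k) \<Rightarrow> 'k" where
  "heps H x = Sum_any (\<lambda>b. x b * hcounit H b)"

definition hS :: "('b, 'k::field) hopf \<Rightarrow> ('b \<Rightarrow> 'k) \<Rightarrow> 'b \<Rightarrow> 'k" where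
  "hS H x = lin (hantipode H) x"

text \<open>multiplication in H (x) H\<close>
definition tmul :: "('b, 'k::field) hopf \<Rightarrow> ('b \<times> 'b \<Rightarrow> 'k) \<Rightarrow> ('b \<times> 'b \<Rightarrow> 'k) \<Rightarrow> 'b \<times> 'b \<Rightarrow> 'k" where
  "tmul H t s = (\<lambda>(i, j). Sum_any (\<lambda>(p, q). Sum_any (\<lambda>(p', q').
      t (p, q) * s (p', q') * hmult H p p' i * hmult H q q' j)))"

definition is_hopf :: "('b, 'k::field) hopf \<Rightarrow> bool" where
  "is_hopf H \<longleftrightarrow>
    (\<forall>a b. fin (hmult H a b)) \<and> fin (hunit H) \<and> (\<forall>b. fin (hcomult H b)) \<and>
    (\<forall>b. fin (hantipode H b)) \<and>
    \<comment> \<open>associative unital algebra\<close>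
    (\<forall>a b c. hmul H (hmul H (dlt a) (dlt b)) (dlt c) = hmul H (dlt a) (hmul H (dlt b) (dlt c))) \<and>
    (\<forall>b. hmul H (hunit H) (dlt b) = dlt b \<and> hmul H (dlt b) (hunit H) = dlt b) \<and>
    \<comment> \<open>coassociative counital coalgebra\<close>
    (\<forall>b. (\<lambda>(i, j, k). Sum_any (\<lambda>p. hcomult H b (p, k) * hcomult H p (i, j))) =
         (\<lambda>(i, j, k). Sum_any (\<lambda>p. hcomult H b (i, p) * hcomult H p (j, k)))) \<and>
    (\<forall>b. (\<lambda>i. Sum_any (\<lambda>p. hcounit H p * hcomult H b (p, i))) = dlt b \<and>
         (\<lambda>i. Sum_any (\<lambda>q. hcomult H b (i, q) * hcounit H q)) = dlt b) \<and>
    \<comment> \<open>bialgebra compatibility\<close>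
    (\<forall>a b. hDelta H (hmul H (dlt a) (dlt b)) = tmul H (hcomult H a) (hcomult H b)) \<and>
    hDelta H (hunit H) = tens (hunit H) (hunit H) \<and>
    (\<forall>a b. heps H (hmul H (dlt a) (dlt b)) = hcounit H a * hcounit H b) \<and>
    heps H (hunit H) = 1 \<and>
    \<comment> \<open>antipode\<close>
    (\<forall>b. (\<lambda>c. Sum_any (\<lambda>(p, q). hcomult H b (p, q) * hmul H (hantipode H p) (dlt q) c))
          = (\<lambda>c. hcounit H b * hunit H c) \<and>
         (\<lambda>c. Sum_any (\<lambda>(p, q). hcomult H b (p, q) * hmul H (dlt p) (hantipode H q) c))
          = (\<lambda>c. hcounit H b * hunit H c))"

section \<open>Coalgebra notions\<close>

definition Hsp :: "('b \<Rightarrow> 'k::field) set" where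
  "Hsp = {x. fin x}"

definition grouplike :: "('b, 'k::field) hopf \<Rightarrow> ('b \<Rightarrow> 'k) \<Rightarrow> bool" where
  "grouplike H g \<longleftrightarrow> fin g \<and> g \<noteq> (\<lambda>_. 0) \<and> hDelta H g = tens g g"

definition Prim :: "('b, 'k::field) hopf \<Rightarrow> ('b \<Rightarrow> 'k) \<Rightarrow> ('b \<Rightarrow> 'k) \<Rightarrow> ('b \<Rightarrow> 'k) set" where
  "Prim H g h = {x. fin x \<and> hDelta H x = (\<lambda>z. tens g x z + tens x h z)}"

definition subcoalgebra :: "('b, 'k::field) hopf \<Rightarrow> ('b \<Rightarrow> 'k) set \<Rightarrow> bool" where
  "subcoalgebra H C \<longleftrightarrow> subspace C \<and> (\<forall>x\<in>C. hDelta H x \<in> tensor_sp C C)"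

definition simple_subcoalgebra :: "('b, 'k::field) hopf \<Rightarrow> ('b \<Rightarrow> 'k) set \<Rightarrow> bool" where
  "simple_subcoalgebra H C \<longleftrightarrow> subcoalgebra H C \<and> C \<noteq> {\<lambda>_. 0} \<and>
     (\<forall>D. subcoalgebra H D \<and> D \<subseteq> C \<and> D \<noteq> {\<lambda>_. 0} \<longrightarrow> D = C)"

definition pointed :: "('b, 'k::field) hopf \<Rightarrow> bool" where
  "pointed H \<longleftrightarrow> (\<forall>C. simple_subcoalgebra H C \<longrightarrow> fin_dim C \<and> fdim C = 1)"

text \<open>grouplikes of a subcoalgebra C\<close>
definition GL :: "('b, 'k::field) hopf \<Rightarrow> ('b \<Rightarrow> 'k) set \<Rightarrow> ('b \<Rightarrow> 'k) set" where
  "GL H C = {g. grouplike H g \<and> g \<in> C}"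

text \<open>Number of arrows g -> h of the Ext-quiver of M^C: dimension of P(g,h) computed
  inside C, modulo the trivial skew-primitive g - h (which is zero when g = h).\<close>
definition ext_arrows :: "('b, 'k::field) hopf \<Rightarrow> ('b \<Rightarrow> 'k) set \<Rightarrow> ('b \<Rightarrow> 'k) \<Rightarrow> ('b \<Rightarrow> 'k) \<Rightarrow> enat" where
  "ext_arrows H C g h =
     (if fin_dim (Prim H g h \<inter> C)
      then enat (fdim (Prim H g h \<inter> C) - (if g = h then 0 else 1)) else \<infinity>)"

definition ext_edge :: "('b, 'k::field) hopf \<Rightarrow> ('b \<Rightarrow> 'k) set \<Rightarrow> (('b \<Rightarrow> 'k) \<times> ('b \<Rightarrow> 'k)) set" where
  "ext_edge H C = {(g, h). g \<in> GL H C \<and> h \<in> GL H C \<and>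
                      (ext_arrows H C g h \<noteq> 0 \<or> ext_arrows H C h g \<noteq> 0)}"

definition ext_connected :: "('b, 'k::field) hopf \<Rightarrow> ('b \<Rightarrow> 'k) set \<Rightarrow> bool" where
  "ext_connected H C \<longleftrightarrow> (\<forall>g\<in>GL H C. \<forall>h\<in>GL H C. (g, h) \<in> (ext_edge H C)\<^sup>*)"

text \<open>connected component of the vertex g in the Ext-quiver of M^C\<close>
definition ext_component :: "('b, 'k::field) hopf \<Rightarrow> ('b \<Rightarrow> 'k) set \<Rightarrow> ('b \<Rightarrow> 'k) \<Rightarrow> ('b \<Rightarrow> 'k) set" where
  "ext_component H C g = {h. (g, h) \<in> (ext_edge H C)\<^sup>*}"

definition link_component_one :: "('b, 'k::field) hopf \<Rightarrow> ('b \<Rightarrow> 'k) set \<Rightarrow> bool" where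
  "link_component_one H B \<longleftrightarrow> subcoalgebra H B \<and> hunit H \<in> B \<and> ext_connected H B \<and>
     (\<forall>D. subcoalgebra H D \<and> B \<subseteq> D \<and> ext_connected H D \<longrightarrow> D = B)"

section \<open>Finite-dimensional right comodules\<close>

text \<open>A d-dimensional right H-comodule, written in a basis v_0..v_{d-1} as
  rho(v_j) = sum_i v_i (x) X i j; the comodule axioms say
  Delta(X i j) = sum_k X i k (x) X k j and eps(X i j) = delta_ij.\<close>
definition comodule :: "('b, 'k::field) hopf \<Rightarrow> nat \<Rightarrow> (nat \<Rightarrow> nat \<Rightarrow> 'b \<Rightarrow> 'k) \<Rightarrow> bool" where
  "comodule H d X \<longleftrightarrow> (\<forall>i<d. \<forall>j<d. fin (X i j) \<and>
      hDelta H (X i j) = (\<lambda>z. \<Sum>k<d. tens (X i k) (X k j) z) \<and>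
      heps H (X i j) = (if i = j then 1 else 0))"

text \<open>comodule isomorphism: an invertible scalar matrix P with P X = Y P\<close>
definition comod_iso :: "nat \<Rightarrow> (nat \<Rightarrow> nat \<Rightarrow> 'b \<Rightarrow> 'k::field) \<Rightarrow> (nat \<Rightarrow> nat \<Rightarrow> 'b \<Rightarrow> 'k) \<Rightarrow> bool" where
  "comod_iso d X Y \<longleftrightarrow> (\<exists>P Q :: nat \<Rightarrow> nat \<Rightarrow> 'k.
      (\<forall>i<d. \<forall>j<d. (\<Sum>k<d. P i k * Q k j) = (if i = j then 1 else 0)) \<and>
      (\<forall>i<d. \<forall>j<d. (\<Sum>k<d. Q i k * P k j) = (if i = j then 1 else 0)) \<and>
      (\<forall>i<d. \<forall>j<d. (\<lambda>z. \<Sum>k<d. P i k * X k j z) = (\<lambda>z. \<Sum>k<d. Y i k z * P k j)))"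

definition dsum :: "nat \<Rightarrow> (nat \<Rightarrow> nat \<Rightarrow> 'b \<Rightarrow> 'k::zero) \<Rightarrow> (nat \<Rightarrow> nat \<Rightarrow> 'b \<Rightarrow> 'k) \<Rightarrow> nat \<Rightarrow> nat \<Rightarrow> 'b \<Rightarrow> 'k" where
  "dsum d1 X Y = (\<lambda>i j. if i < d1 \<and> j < d1 then X i j
                       else if d1 \<le> i \<and> d1 \<le> j then Y (i - d1) (j - d1) else (\<lambda>_. 0))"

definition indecomposable :: "('b, 'k::field) hopf \<Rightarrow> nat \<Rightarrow> (nat \<Rightarrow> nat \<Rightarrow> 'b \<Rightarrow> 'k) \<Rightarrow> bool" where
  "indecomposable H d X \<longleftrightarrow> comodule H d X \<and> d > 0 \<and>
     \<not> (\<exists>d1 d2 X1 X2. d1 > 0 \<and> d2 > 0 \<and> d1 + d2 = d \<and> comodule H d1 X1 \<and> comodule H d2 X2 \<and>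
          comod_iso d X (dsum d1 X1 X2))"

text \<open>Dimension vector (multiplicities of the simple comodules K g, g grouplike, in a
  composition series). For a pointed coalgebra a composition series is a full flag of
  subcomodules, i.e. a basis in which the coaction matrix is upper triangular; the
  composition factors are then given by the diagonal entries (which are grouplike).\<close>
definition has_dimvec :: "('b, 'k::field) hopf \<Rightarrow> nat \<Rightarrow> (nat \<Rightarrow> nat \<Rightarrow> 'b \<Rightarrow> 'k) \<Rightarrow> ('b \<Rightarrow> 'k) multiset \<Rightarrow> bool" where
  "has_dimvec H d X v \<longleftrightarrow> comodule H d X \<and> (\<exists>Y. comod_iso d X Y \<and>
      (\<forall>i<d. \<forall>j<d. j < i \<longrightarrow> Y i j = (\<lambda>_. 0)) \<and> v = mset (map (\<lambda>i. Y i i) [0..<d]))"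

definition discrete_corep_type :: "('b, 'k::field) hopf \<Rightarrow> bool" where
  "discrete_corep_type H \<longleftrightarrow> (\<forall>v. \<exists>S. finite S \<and>
      (\<forall>d X. indecomposable H d X \<and> has_dimvec H d X v \<longrightarrow> (\<exists>Y\<in>S. comod_iso d X Y)))"

section \<open>Integer powers of grouplikes\<close>

definition gpow :: "('b, 'k::field) hopf \<Rightarrow> ('b \<Rightarrow> 'k) \<Rightarrow> int \<Rightarrow> 'b \<Rightarrow> 'k" where
  "gpow H g i = (if 0 \<le> i then ((\<lambda>y. hmul H y g) ^^ nat i) (hunit H)
                 else ((\<lambda>y. hmul H y (hS H g)) ^^ nat (- i)) (hunit H))"

end

(*
Given x in P(g_i, h_j), block matrices [[diag g, M], [0, diag h]] with M_ij in P(g_i, h_j) are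
comodules, and up to trivial skew-primitives a morphism between two of them is a morphism of
representations of the separated Ext-quiver.  Over an infinite field the one-parameter families of
Kronecker, cyclic and D5~ representations therefore contradict discreteness.  Multiplication by
grouplikes makes the Ext-quiver a Cayley graph with labels {a. 1 -> a}: the Kronecker family excludes
double arrows, and the D5~ family excludes three labels.  Conjugation by a permutes the labels and
fixes a, so two labels a, b commute, and the cyclic family shows that b a^-1 has infinite order.
Hence the relation lattice {(i, j). a^i b^j = 1} meets the antidiagonal trivially, so it is cyclic.
By maximality the component of 1 contains everything linked to it, which makes G(B) the group
generated by the labels, and left translation by g identifies it with the component of g.
*)
theory Submission
  imports Defs "HOL-Library.Function_Algebras" "HOL-Algebra.Multiplicative_Group"
begin

section \<open>Linear algebra of finitely supported functions\<close>

text \<open>A grouplike element may occur both among the \<open>g i\<close> and among the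
  \<open>h j\<close>, for instance when 1 is itself a label. A morphism of block comodules can then
  have a nonzero lower left block, which no morphism of representations of the separated quiver
  sees. This obstacle shapes the families: their matrices are injective outside at most one
  parameter value, and injectivity kills the extra block. What remains is rigid, so each comodule
  has only trivial idempotents and different parameters give different comodules. Type D5~ arises
  because three labels give every vertex of the separated quiver valency three: no vertex has four
  neighbours, but an edge has two further neighbours at each end. The cycle arises from the zigzag
  c^i -> c^i a, c^i -> c^i b = c^(i+1) a with c = b a^-1, which closes when c has finite order. The
  excluded pairs (1, 1) and (-1, -1) are those for which the relation a^m = b^n would read a =
  b.\<close>

definition smul :: "'k::field \<Rightarrow> ('c \<Rightarrow> 'k) \<Rightarrow> 'c \<Rightarrow> 'k" (infixr \<open>\<cdot>\<close> 75) where
  "c \<cdot> x = (\<lambda>z. c * x z)"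

lemma smul_apply [simp]: "(c \<cdot> x) z = c * x z"
  by (simp add: smul_def)

lemma sum_fun_apply [simp]: "(\<Sum>i\<in>I. f i) z = (\<Sum>i\<in>I. f i z)"
  for f :: "'i \<Rightarrow> 'c \<Rightarrow> 'k::field"
  by (induction I rule: infinite_finite_induct) auto

text \<open>All functions form the vector space, not only those of finite support: the library
  theory of span and independence then applies to a whole type, and \<open>fin\<close> is carried
  along as a side condition.\<close>

interpretation fs: vector_space "smul :: 'k::field \<Rightarrow> ('c \<Rightarrow> 'k) \<Rightarrow> 'c \<Rightarrow> 'k"
  by unfold_locales (auto simp: fun_eq_iff algebra_simps)

interpretation fsd: vector_space_pair "smul :: 'k::field \<Rightarrow> ('c \<Rightarrow> 'k) \<Rightarrow> 'c \<Rightarrow> 'k" "(*) :: 'k \<Rightarrow> 'k \<Rightarrow> 'k"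
  by unfold_locales (auto simp: algebra_simps)

lemma fin_0 [simp]: "fin 0" "fin (\<lambda>_. 0)"
  by (simp_all add: fin_def)

lemma fin_add [simp]: "fin x \<Longrightarrow> fin y \<Longrightarrow> fin (x + y)" for x y :: "'c \<Rightarrow> 'k::field"
  unfolding fin_def by (rule finite_subset[of _ "{b. x b \<noteq> 0} \<union> {b. y b \<noteq> 0}"]) auto

lemma fin_smul [simp]: "fin x \<Longrightarrow> fin (c \<cdot> x)"
  unfolding fin_def by (rule finite_subset[of _ "{b. x b \<noteq> 0}"]) auto

lemma fin_diff [simp]: "fin x \<Longrightarrow> fin y \<Longrightarrow> fin (x - y)" for x y :: "'c \<Rightarrow> 'k::field"
  unfolding fin_def by (rule finite_subset[of _ "{b. x b \<noteq> 0} \<union> {b. y b \<noteq> 0}"]) auto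

lemma fin_dlt [simp]: "fin (dlt b :: 'c \<Rightarrow> 'k::field)"
  unfolding fin_def dlt_def by (rule finite_subset[of _ "{b}"]) (auto split: if_splits)

lemma fin_sum [simp]: "(\<And>i. i \<in> I \<Longrightarrow> fin (f i)) \<Longrightarrow> fin (\<Sum>i\<in>I. f i)"
  for f :: "'i \<Rightarrow> 'c \<Rightarrow> 'k::field"
  by (induction I rule: infinite_finite_induct) auto

lemma fin_tens [simp]: "fin x \<Longrightarrow> fin y \<Longrightarrow> fin (tens x y)"
  unfolding fin_def tens_def
  by (rule finite_subset[of _ "{b. x b \<noteq> 0} \<times> {b. y b \<noteq> 0}"]) auto

lemma tens_apply: "tens x y z = x (fst z) * y (snd z)"
  by (simp add: tens_def case_prod_beta)
lemma tens_add_left: "tens (x + y) z = tens x z + tens y z"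
  by (rule ext) (simp only: tens_apply plus_fun_apply distrib_right)
lemma tens_add_right: "tens z (x + y) = tens z x + tens z y"
  by (rule ext) (simp only: tens_apply plus_fun_apply distrib_left)
lemma tens_diff_left: "tens (x - y) z = tens x z - tens y z"
  by (rule ext) (simp only: tens_apply fun_diff_def left_diff_distrib)
lemma tens_diff_right: "tens z (x - y) = tens z x - tens z y"
  by (rule ext) (simp only: tens_apply fun_diff_def right_diff_distrib)
lemma tens_smul_left: "tens (c \<cdot> x) z = c \<cdot> tens x z"
  by (rule ext) (simp only: tens_apply smul_apply mult.assoc)
lemma tens_smul_right: "tens z (c \<cdot> x) = c \<cdot> tens z x"
  by (rule ext) (simp only: tens_apply smul_apply mult.left_commute)

lemmas tens_simps = tens_add_left tens_add_right tens_diff_left tens_diff_right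
  tens_smul_left tens_smul_right

lemma tens_dlt: "tens (dlt p) (dlt q) = dlt (p, q)"
  by (auto simp: tens_def dlt_def fun_eq_iff)

text \<open>A vector of finite support is the finite sum of its coordinates times basis vectors.
  Linear identities thus reduce to basis vectors, where \<open>is_hopf\<close> states its
  axioms.\<close>

lemma fin_induct [consumes 1, case_names zero dlt add smul]:
  fixes x :: "'c \<Rightarrow> 'k::field"
  assumes "fin x" "P 0" "\<And>b. P (dlt b)"
    "\<And>x y. fin x \<Longrightarrow> fin y \<Longrightarrow> P x \<Longrightarrow> P y \<Longrightarrow> P (x + y)"
    "\<And>c x. fin x \<Longrightarrow> P x \<Longrightarrow> P (c \<cdot> x)"
  shows "P x"
proof -
  have "P (\<Sum>b\<in>S. x b \<cdot> dlt b)" if "finite S" for S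
    using that
  proof (induction S)
    case (insert b S)
    have "P (x b \<cdot> dlt b + (\<Sum>b\<in>S. x b \<cdot> dlt b))"
      by (intro assms(3-5) insert fin_sum fin_smul fin_dlt)
    moreover have "(\<Sum>b\<in>insert b S. x b \<cdot> dlt b) = x b \<cdot> dlt b + (\<Sum>b\<in>S. x b \<cdot> dlt b)"
      using insert by (intro sum.insert)
    ultimately show ?case by metis
  next
    case empty
    show "P (\<Sum>b\<in>{}. x b \<cdot> dlt b)" using assms(2) by simp
  qed
  moreover have "(\<Sum>b | x b \<noteq> 0. x b \<cdot> dlt b) z = x z" for z
  proof -
    have "(\<Sum>b | x b \<noteq> 0. x b \<cdot> dlt b) z = (\<Sum>b | x b \<noteq> 0. if z = b then x b else 0)"
      unfolding sum_fun_apply by (rule sum.cong) (auto simp: dlt_def)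
    also have "\<dots> = x z" using \<open>fin x\<close> unfolding fin_def by (simp only: sum.delta') auto
    finally show ?thesis .
  qed
  then have "(\<Sum>b | x b \<noteq> 0. x b \<cdot> dlt b) = x" by (rule ext)
  ultimately show ?thesis using \<open>fin x\<close> unfolding fin_def by metis
qed

text \<open>Linearity is demanded on \<open>fin\<close> vectors only: \<open>Sum_any\<close> returns
  0 on infinite supports, so \<open>lin\<close> need not be additive beyond them.\<close>

definition flinear :: "(('c \<Rightarrow> 'k::field) \<Rightarrow> 'd \<Rightarrow> 'k) \<Rightarrow> bool" where
  "flinear f \<longleftrightarrow> (\<forall>x y. fin x \<longrightarrow> fin y \<longrightarrow> f (x + y) = f x + f y) \<and>
     (\<forall>c x. fin x \<longrightarrow> f (c \<cdot> x) = c \<cdot> f x)"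

lemma flinearI:
  assumes "\<And>x y. fin x \<Longrightarrow> fin y \<Longrightarrow> f (x + y) = f x + f y"
    "\<And>c x. fin x \<Longrightarrow> f (c \<cdot> x) = c \<cdot> f x"
  shows "flinear f"
  using assms unfolding flinear_def by blast

lemma flinear_add: "flinear f \<Longrightarrow> fin x \<Longrightarrow> fin y \<Longrightarrow> f (x + y) = f x + f y"
  and flinear_smul: "flinear f \<Longrightarrow> fin x \<Longrightarrow> f (c \<cdot> x) = c \<cdot> f x"
  unfolding flinear_def by blast+

lemma flinear_0: "flinear f \<Longrightarrow> f 0 = 0"
  using flinear_smul[of f 0 0] by (simp add: zero_fun_def smul_def)

lemma flinear_diff: "flinear f \<Longrightarrow> fin x \<Longrightarrow> fin y \<Longrightarrow> f (x - y) = f x - f y"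
  using flinear_add[of f "x - y" y] by (simp add: algebra_simps)

lemma flinear_ext:
  assumes "flinear f" "flinear g" "fin x" "\<And>b. f (dlt b) = g (dlt b)"
  shows "f x = g x"
  by (rule fin_induct[OF assms(3), of "\<lambda>x. f x = g x"])
    (simp_all add: assms(4) flinear_0[OF assms(1)] flinear_0[OF assms(2)] flinear_add[OF assms(1)]
      flinear_add[OF assms(2)] flinear_smul[OF assms(1)] flinear_smul[OF assms(2)])

lemma flinear_comp:
  assumes "flinear f" "flinear g" "\<And>x. fin x \<Longrightarrow> fin (g x)"
  shows "flinear (\<lambda>x. f (g x))"
  by (intro flinearI)
    (simp_all add: flinear_add[OF assms(1)] flinear_smul[OF assms(1)] flinear_add[OF assms(2)]
      flinear_smul[OF assms(2)] assms(3))

lemma lin_expand: "fin x \<Longrightarrow> finite S \<Longrightarrow> {b. x b \<noteq> 0} \<subseteq> S \<Longrightarrow> lin F x c = (\<Sum>b\<in>S. x b * F b c)"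
  unfolding lin_def by (rule Sum_any.expand_superset) auto

lemma flinear_lin: "flinear (lin F)" for F :: "'b \<Rightarrow> 'c \<Rightarrow> 'k::field"
proof (rule flinearI)
  fix x y :: "'b \<Rightarrow> 'k" assume "fin x" "fin y"
  let ?S = "{b. x b \<noteq> 0} \<union> {b. y b \<noteq> 0}"
  have S: "finite ?S" using \<open>fin x\<close> \<open>fin y\<close> by (simp add: fin_def)
  have "{b. (x + y) b \<noteq> 0} \<subseteq> ?S" by auto
  then show "lin F (x + y) = lin F x + lin F y"
    using \<open>fin x\<close> \<open>fin y\<close> S
    by (simp add: fun_eq_iff lin_expand[where S = ?S] sum.distrib algebra_simps)
next
  fix c and x :: "'b \<Rightarrow> 'k" assume "fin x"
  let ?S = "{b. x b \<noteq> 0}"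
  have S: "finite ?S" using \<open>fin x\<close> by (simp add: fin_def)
  have "{b. (c \<cdot> x) b \<noteq> 0} \<subseteq> ?S" by auto
  then have *: "lin F (c \<cdot> x) z = (\<Sum>b\<in>?S. (c \<cdot> x) b * F b z)" for z
    by (intro lin_expand fin_smul \<open>fin x\<close> S)
  have **: "lin F x z = (\<Sum>b\<in>?S. x b * F b z)" for z
    by (intro lin_expand \<open>fin x\<close> S order.refl)
  show "lin F (c \<cdot> x) = c \<cdot> lin F x"
    by (rule ext) (simp only: * ** smul_apply sum_distrib_left mult.assoc)
qed

lemma lin_dlt [simp]: "lin F (dlt b) = F b"
proof -
  have "(\<lambda>a. dlt b a * F a c) = (\<lambda>a. if a = b then F a c else 0)" for c
    by (auto simp: dlt_def fun_eq_iff)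
  then show ?thesis unfolding lin_def by (simp only: Sum_any.delta)
qed

lemma fin_lin:
  assumes "\<And>b. fin (F b)" "fin x"
  shows "fin (lin F x)"
  by (rule fin_induct[OF assms(2), of "\<lambda>x. fin (lin F x)"])
    (simp_all add: flinear_0[OF flinear_lin] flinear_add[OF flinear_lin] flinear_smul[OF flinear_lin] assms(1))

text \<open>The nested sum of \<open>hmul\<close> is awkward to vary in one argument; on
  \<open>fin\<close> vectors it agrees with this composition of two \<open>lin\<close>, whose
  linearity is known.\<close>

definition bilin_ext :: "('b \<Rightarrow> 'b \<Rightarrow> 'c \<Rightarrow> 'k::field) \<Rightarrow> ('b \<Rightarrow> 'k) \<Rightarrow> ('b \<Rightarrow> 'k) \<Rightarrow> 'c \<Rightarrow> 'k" where
  "bilin_ext F x y = lin (\<lambda>a. lin (F a) y) x"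

lemma flinear_bilin_ext_left: "flinear (\<lambda>x. bilin_ext F x y)"
  unfolding bilin_ext_def by (rule flinear_lin)

lemma flinear_bilin_ext_right:
  assumes "fin x" shows "flinear (bilin_ext F x)"
proof -
  have "finite {b. x b \<noteq> 0}" using assms by (simp add: fin_def)
  then have *: "bilin_ext F x y = (\<Sum>a | x a \<noteq> 0. x a \<cdot> lin (F a) y)" for y
    using assms unfolding bilin_ext_def by (simp add: fun_eq_iff lin_expand)
  show ?thesis
    by (rule flinearI)
      (simp_all add: * flinear_add[OF flinear_lin] flinear_smul[OF flinear_lin]
         fs.scale_right_distrib fs.scale_sum_right sum.distrib mult.commute)
qed

lemma bilin_ext_dlt [simp]: "bilin_ext F (dlt a) (dlt b) = F a b"
  by (simp add: bilin_ext_def)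

lemma fin_bilin_ext: "(\<And>a b. fin (F a b)) \<Longrightarrow> fin x \<Longrightarrow> fin y \<Longrightarrow> fin (bilin_ext F x y)"
  unfolding bilin_ext_def by (intro fin_lin)

lemma bilin_ext_Sum_any:
  assumes "fin x" "fin y"
  shows "bilin_ext F x y c = Sum_any (\<lambda>a. Sum_any (\<lambda>b. x a * y b * F a b c))"
proof -
  have "finite {b. y b * F a b c \<noteq> 0}" for a
    using assms(2) unfolding fin_def by (rule rev_finite_subset) auto
  then have "x a * Sum_any (\<lambda>b. y b * F a b c) = Sum_any (\<lambda>b. x a * y b * F a b c)" for a
    by (simp only: Sum_any_right_distrib mult.assoc)
  then show ?thesis
    unfolding bilin_ext_def lin_def by (simp only:)
qed

section \<open>Grouplike and skew-primitive elements\<close>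

lemma flinear_cong:
  assumes "flinear g" "\<And>x. fin x \<Longrightarrow> f x = g x"
  shows "flinear f"
  by (rule flinearI)
    (simp_all only: assms(2) fin_add fin_smul flinear_add[OF assms(1)] flinear_smul[OF assms(1)])

lemma flinear_tens_left: "flinear (\<lambda>x. tens x y)"
  by (rule flinearI) (simp_all only: tens_simps)

lemma flinear_tens_right: "flinear (tens x)"
  by (rule flinearI) (simp_all only: tens_simps)

lemma fin_slice: "fin t \<Longrightarrow> fin (\<lambda>p. t (p, i))"
proof -
  assume "fin t"
  then have "finite (fst ` {z. t z \<noteq> 0})" by (simp add: fin_def)
  then show ?thesis unfolding fin_def by (rule rev_finite_subset) (auto simp: image_iff)
qed

section \<open>Operations of the Hopf algebra as linear maps\<close>

locale hopf_algebra =
  fixes H :: "('b, 'k::field) hopf"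
  assumes is_hopf: "is_hopf H"
begin

lemma fin_hmult [simp]: "fin (hmult H a b)" and fin_hunit [simp]: "fin (hunit H)"
  and fin_hcomult [simp]: "fin (hcomult H b)" and fin_hantipode [simp]: "fin (hantipode H b)"
  using is_hopf unfolding is_hopf_def by blast+

lemma hmul_bilin_ext: "fin x \<Longrightarrow> fin y \<Longrightarrow> hmul H x y = bilin_ext (hmult H) x y"
  by (rule ext) (simp only: bilin_ext_Sum_any hmul_def)

lemma fin_hmul [simp]: "fin x \<Longrightarrow> fin y \<Longrightarrow> fin (hmul H x y)"
  by (simp only: hmul_bilin_ext fin_bilin_ext fin_hmult)

lemma flinear_hmul_left: "fin y \<Longrightarrow> flinear (\<lambda>x. hmul H x y)"
  by (rule flinear_cong[OF flinear_bilin_ext_left]) (simp only: hmul_bilin_ext)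

lemma flinear_hmul_right: "fin x \<Longrightarrow> flinear (hmul H x)"
  by (rule flinear_cong[OF flinear_bilin_ext_right]) (simp_all only: hmul_bilin_ext)

text \<open>The axiom is given for basis vectors; the arguments are released one at a time, from the
  last to the first, each time by \<open>flinear_ext\<close>. The identities for \<open>tmul\<close>
  follow the same pattern.\<close>

lemma hmul_assoc:
  assumes "fin x" "fin y" "fin z"
  shows "hmul H (hmul H x y) z = hmul H x (hmul H y z)"
proof -
  have 1: "hmul H (hmul H (dlt a) (dlt b)) z = hmul H (dlt a) (hmul H (dlt b) z)" for a b
    by (rule flinear_ext[of "hmul H (hmul H (dlt a) (dlt b))" "\<lambda>z. hmul H (dlt a) (hmul H (dlt b) z)"])
      (use is_hopf assms in \<open>auto simp: is_hopf_def intro!: flinear_hmul_right flinear_comp[of "hmul H _"]\<close>)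
  have 2: "hmul H (hmul H (dlt a) y) z = hmul H (dlt a) (hmul H y z)" for a
    by (rule flinear_ext[of "\<lambda>y. hmul H (hmul H (dlt a) y) z" "\<lambda>y. hmul H (dlt a) (hmul H y z)"])
      (use 1 assms in \<open>auto intro!: flinear_hmul_right flinear_hmul_left
        flinear_comp[of "\<lambda>x. hmul H x z"] flinear_comp[of "hmul H _"]\<close>)
  show ?thesis
    by (rule flinear_ext[of "\<lambda>x. hmul H (hmul H x y) z" "\<lambda>x. hmul H x (hmul H y z)"])
      (use 2 assms in \<open>auto intro!: flinear_hmul_right flinear_hmul_left
        flinear_comp[of "\<lambda>x. hmul H x z"]\<close>)
qed

lemma hmul_unit_left: "fin x \<Longrightarrow> hmul H (hunit H) x = x"
  by (rule flinear_ext[of "hmul H (hunit H)" "\<lambda>x. x"])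
    (use is_hopf in \<open>auto simp: is_hopf_def intro: flinear_hmul_right flinearI\<close>)

lemma hmul_unit_right: "fin x \<Longrightarrow> hmul H x (hunit H) = x"
  by (rule flinear_ext[of "\<lambda>x. hmul H x (hunit H)" "\<lambda>x. x"])
    (use is_hopf in \<open>auto simp: is_hopf_def intro: flinear_hmul_left flinearI\<close>)

text \<open>Structure constants of the tensor product algebra on the basis of pairs, which make
  \<open>tmul\<close> another \<open>bilin_ext\<close>.\<close>

definition tens_hmult :: "'b \<times> 'b \<Rightarrow> 'b \<times> 'b \<Rightarrow> 'b \<times> 'b \<Rightarrow> 'k" where
  "tens_hmult s t = tens (hmult H (fst s) (fst t)) (hmult H (snd s) (snd t))"

lemma fin_tens_hmult [simp]: "fin (tens_hmult s t)" by (simp add: tens_hmult_def)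

lemma tmul_bilin_ext: "fin s \<Longrightarrow> fin t \<Longrightarrow> tmul H s t = bilin_ext tens_hmult s t"
proof (rule ext)
  fix z assume "fin s" "fin t"
  then show "tmul H s t z = bilin_ext tens_hmult s t z"
    by (cases z) (simp only: bilin_ext_Sum_any tmul_def tens_hmult_def tens_apply case_prod_unfold mult.assoc
        prod.case fst_conv snd_conv prod.collapse)
qed

lemma fin_tmul [simp]: "fin s \<Longrightarrow> fin t \<Longrightarrow> fin (tmul H s t)"
  by (simp only: tmul_bilin_ext fin_bilin_ext fin_tens_hmult)

lemma flinear_tmul_left: "fin t \<Longrightarrow> flinear (\<lambda>s. tmul H s t)"
  by (rule flinear_cong[OF flinear_bilin_ext_left]) (simp only: tmul_bilin_ext)

lemma flinear_tmul_right: "fin s \<Longrightarrow> flinear (tmul H s)"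
  by (rule flinear_cong[OF flinear_bilin_ext_right]) (simp_all only: tmul_bilin_ext)

lemma tmul_tens:
  assumes "fin x" "fin y" "fin u" "fin v"
  shows "tmul H (tens x y) (tens u v) = tens (hmul H x u) (hmul H y v)"
proof -
  have 1: "tmul H (tens (dlt a) (dlt b)) (tens (dlt c) (dlt d))
      = tens (hmul H (dlt a) (dlt c)) (hmul H (dlt b) (dlt d))" for a b c d
    by (simp add: tens_dlt tmul_bilin_ext hmul_bilin_ext tens_hmult_def)
  have 2: "tmul H (tens (dlt a) (dlt b)) (tens (dlt c) v)
      = tens (hmul H (dlt a) (dlt c)) (hmul H (dlt b) v)" for a b c
    by (rule flinear_ext[OF _ _ \<open>fin v\<close>, of "\<lambda>v. tmul H (tens (dlt a) (dlt b)) (tens (dlt c) v)"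
          "\<lambda>v. tens (hmul H (dlt a) (dlt c)) (hmul H (dlt b) v)"])
      ((intro flinear_comp[OF flinear_tmul_right flinear_tens_right]
        flinear_comp[OF flinear_tens_right flinear_hmul_right] fin_tens fin_hmul fin_dlt 1 | assumption)+)
  have 3: "tmul H (tens (dlt a) (dlt b)) (tens u v)
      = tens (hmul H (dlt a) u) (hmul H (dlt b) v)" for a b
    by (rule flinear_ext[OF _ _ \<open>fin u\<close>, of "\<lambda>u. tmul H (tens (dlt a) (dlt b)) (tens u v)"
          "\<lambda>u. tens (hmul H (dlt a) u) (hmul H (dlt b) v)"])
      ((intro flinear_comp[OF flinear_tmul_right flinear_tens_left]
        flinear_comp[OF flinear_tens_left flinear_hmul_right] fin_tens fin_hmul fin_dlt assms 2 | assumption)+)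
  have 4: "tmul H (tens (dlt a) y) (tens u v)
      = tens (hmul H (dlt a) u) (hmul H y v)" for a
    by (rule flinear_ext[OF _ _ \<open>fin y\<close>, of "\<lambda>y. tmul H (tens (dlt a) y) (tens u v)"
          "\<lambda>y. tens (hmul H (dlt a) u) (hmul H y v)"])
      ((intro flinear_comp[OF flinear_tmul_left flinear_tens_right]
        flinear_comp[OF flinear_tens_right flinear_hmul_left] fin_tens fin_hmul fin_dlt assms 3 | assumption)+)
  show ?thesis
    by (rule flinear_ext[OF _ _ \<open>fin x\<close>, of "\<lambda>x. tmul H (tens x y) (tens u v)"
          "\<lambda>x. tens (hmul H x u) (hmul H y v)"])
      ((intro flinear_comp[OF flinear_tmul_left flinear_tens_left]
        flinear_comp[OF flinear_tens_left flinear_hmul_left] fin_tens fin_hmul fin_dlt assms 4 | assumption)+)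
qed

lemma tmul_assoc:
  assumes "fin r" "fin s" "fin t"
  shows "tmul H (tmul H r s) t = tmul H r (tmul H s t)"
proof -
  have 1: "tmul H (tmul H (dlt a) (dlt b)) (dlt c) = tmul H (dlt a) (tmul H (dlt b) (dlt c))" for a b c
    by (cases a, cases b, cases c) (simp flip: tens_dlt add: tmul_tens hmul_assoc)
  have 2: "tmul H (tmul H (dlt a) (dlt b)) t = tmul H (dlt a) (tmul H (dlt b) t)" for a b
    by (rule flinear_ext[OF _ _ \<open>fin t\<close>, of "tmul H (tmul H (dlt a) (dlt b))"
          "\<lambda>t. tmul H (dlt a) (tmul H (dlt b) t)"])
      ((intro flinear_comp[OF flinear_tmul_right flinear_tmul_right]
        flinear_tmul_right fin_tmul fin_dlt assms 1 | assumption)+)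
  have 3: "tmul H (tmul H (dlt a) s) t = tmul H (dlt a) (tmul H s t)" for a
    by (rule flinear_ext[OF _ _ \<open>fin s\<close>, of "\<lambda>s. tmul H (tmul H (dlt a) s) t"
          "\<lambda>s. tmul H (dlt a) (tmul H s t)"])
      ((intro flinear_comp[OF flinear_tmul_left flinear_tmul_right]
        flinear_comp[OF flinear_tmul_right flinear_tmul_left] fin_tmul fin_dlt assms 2 | assumption)+)
  show ?thesis
    by (rule flinear_ext[OF _ _ \<open>fin r\<close>, of "\<lambda>r. tmul H (tmul H r s) t"
          "\<lambda>r. tmul H r (tmul H s t)"])
      ((intro flinear_comp[OF flinear_tmul_left flinear_tmul_left]
        flinear_tmul_left fin_tmul fin_dlt assms 3 | assumption)+)
qed

lemma tmul_unit_right: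
  assumes "fin t"
  shows "tmul H t (tens (hunit H) (hunit H)) = t"
proof -
  have "tmul H (dlt a) (tens (hunit H) (hunit H)) = dlt a" for a
    by (cases a) (simp flip: tens_dlt add: tmul_tens hmul_unit_right)
  then show ?thesis
    by (intro flinear_ext[OF _ _ \<open>fin t\<close>, of "\<lambda>t. tmul H t (tens (hunit H) (hunit H))" "\<lambda>t. t"]
        flinear_tmul_left fin_tens fin_hunit flinearI refl)
qed

lemma flinear_hDelta: "flinear (hDelta H)"
  unfolding hDelta_def by (rule flinear_lin)

lemma fin_hDelta [simp]: "fin x \<Longrightarrow> fin (hDelta H x)"
  unfolding hDelta_def by (intro fin_lin fin_hcomult)

lemma hDelta_dlt: "hDelta H (dlt b) = hcomult H b"
  by (simp add: hDelta_def)

lemma hDelta_hmul: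
  assumes "fin x" "fin y"
  shows "hDelta H (hmul H x y) = tmul H (hDelta H x) (hDelta H y)"
proof -
  have 1: "hDelta H (hmul H (dlt a) (dlt b)) = tmul H (hDelta H (dlt a)) (hDelta H (dlt b))" for a b
    using is_hopf by (simp add: hDelta_dlt is_hopf_def)
  have 2: "hDelta H (hmul H (dlt a) y) = tmul H (hDelta H (dlt a)) (hDelta H y)" for a
    by (rule flinear_ext[OF _ _ \<open>fin y\<close>, of "\<lambda>y. hDelta H (hmul H (dlt a) y)"
          "\<lambda>y. tmul H (hDelta H (dlt a)) (hDelta H y)"])
      ((intro flinear_comp[OF flinear_hDelta flinear_hmul_right]
        flinear_comp[OF flinear_tmul_right flinear_hDelta] fin_hDelta fin_hmul fin_dlt 1 | assumption)+)
  show ?thesis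
    by (rule flinear_ext[OF _ _ \<open>fin x\<close>, of "\<lambda>x. hDelta H (hmul H x y)"
          "\<lambda>x. tmul H (hDelta H x) (hDelta H y)"])
      ((intro flinear_comp[OF flinear_hDelta flinear_hmul_left]
        flinear_comp[OF flinear_tmul_left flinear_hDelta] fin_hDelta fin_hmul fin_dlt assms 2 | assumption)+)
qed

text \<open>A scalar is a function on the one-point type, so the counit is an instance of
  \<open>lin\<close> and inherits its linearity.\<close>

lemma heps_lin: "heps H x = lin (\<lambda>b (_::unit). hcounit H b) x ()"
  by (simp add: heps_def lin_def)

lemma heps_add: "fin x \<Longrightarrow> fin y \<Longrightarrow> heps H (x + y) = heps H x + heps H y"
  by (simp only: heps_lin flinear_add[OF flinear_lin] plus_fun_apply)

lemma heps_smul: "fin x \<Longrightarrow> heps H (c \<cdot> x) = c * heps H x"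
  by (simp only: heps_lin flinear_smul[OF flinear_lin] smul_apply)

lemma heps_0: "heps H 0 = 0" "heps H (\<lambda>_. 0) = 0"
  by (simp_all add: heps_def)

lemma counit_left:
  assumes "fin x"
  shows "(\<lambda>i. heps H (\<lambda>p. hDelta H x (p, i))) = x"
proof (rule flinear_ext[OF _ _ assms, of "\<lambda>x i. heps H (\<lambda>p. hDelta H x (p, i))" "\<lambda>x. x"])
  have slice: "fin (\<lambda>p. hDelta H x (p, i))" if "fin x" for x :: "'b \<Rightarrow> 'k" and i
    using that by (intro fin_slice fin_hDelta)
  show "flinear (\<lambda>x i. heps H (\<lambda>p. hDelta H x (p, i)))"
  proof (rule flinearI; rule ext)
    fix x y :: "'b \<Rightarrow> 'k" and i assume "fin x" "fin y"
    have "(\<lambda>p. hDelta H (x + y) (p, i)) = (\<lambda>p. hDelta H x (p, i)) + (\<lambda>p. hDelta H y (p, i))"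
      using \<open>fin x\<close> \<open>fin y\<close> by (simp add: fun_eq_iff flinear_add[OF flinear_hDelta])
    then show "heps H (\<lambda>p. hDelta H (x + y) (p, i))
       = ((\<lambda>i. heps H (\<lambda>p. hDelta H x (p, i))) + (\<lambda>i. heps H (\<lambda>p. hDelta H y (p, i)))) i"
      by (simp only: heps_add slice \<open>fin x\<close> \<open>fin y\<close> plus_fun_apply)
  next
    fix c i and x :: "'b \<Rightarrow> 'k" assume "fin x"
    have "(\<lambda>p. hDelta H (c \<cdot> x) (p, i)) = c \<cdot> (\<lambda>p. hDelta H x (p, i))"
      using \<open>fin x\<close> by (simp add: fun_eq_iff flinear_smul[OF flinear_hDelta])
    then show "heps H (\<lambda>p. hDelta H (c \<cdot> x) (p, i)) = (c \<cdot> (\<lambda>i. heps H (\<lambda>p. hDelta H x (p, i)))) i"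
      by (simp only: heps_smul slice \<open>fin x\<close> smul_apply)
  qed
  show "(\<lambda>i. heps H (\<lambda>p. hDelta H (dlt b) (p, i))) = dlt b" for b
    using is_hopf by (simp add: hDelta_dlt is_hopf_def heps_def mult.commute)
qed (intro flinearI refl)

lemma counit_tens:
  assumes "fin x"
  shows "(\<lambda>i. heps H (\<lambda>p. tens x y (p, i))) = heps H x \<cdot> y"
proof
  fix i
  have "(\<lambda>p. tens x y (p, i)) = y i \<cdot> x"
    by (simp add: tens_apply smul_def mult.commute)
  then show "heps H (\<lambda>p. tens x y (p, i)) = (heps H x \<cdot> y) i"
    by (simp only: heps_smul assms smul_apply mult.commute)
qed

text \<open>Both sides are linear in \<open>x\<close>: the left one is multiplication after S tensor
  id or id tensor S, given by its values on pairs of basis vectors. For a basis vector it is the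
  antipode axiom.\<close>

lemma antipode_fold:
  assumes "fin x"
  shows "lin (\<lambda>(p, q). hmul H (hantipode H p) (dlt q)) (hDelta H x) = heps H x \<cdot> hunit H"
    and "lin (\<lambda>(p, q). hmul H (dlt p) (hantipode H q)) (hDelta H x) = heps H x \<cdot> hunit H"
proof -
  have *: "flinear (\<lambda>x. heps H x \<cdot> hunit H)"
    by (rule flinearI) (simp_all only: heps_add heps_smul fs.scale_left_distrib fs.scale_scale)
  have b: "heps H (dlt b) = hcounit H b" for b by (simp add: heps_lin)
  show "lin (\<lambda>(p, q). hmul H (hantipode H p) (dlt q)) (hDelta H x) = heps H x \<cdot> hunit H"
  proof (rule flinear_ext[OF flinear_comp[OF flinear_lin flinear_hDelta] * assms])
    show "lin (\<lambda>(p, q). hmul H (hantipode H p) (dlt q)) (hDelta H (dlt b)) = heps H (dlt b) \<cdot> hunit H" for b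
      using is_hopf by (simp add: hDelta_dlt b smul_def lin_def is_hopf_def case_prod_unfold)
  qed simp
  show "lin (\<lambda>(p, q). hmul H (dlt p) (hantipode H q)) (hDelta H x) = heps H x \<cdot> hunit H"
  proof (rule flinear_ext[OF flinear_comp[OF flinear_lin flinear_hDelta] * assms])
    show "lin (\<lambda>(p, q). hmul H (dlt p) (hantipode H q)) (hDelta H (dlt b)) = heps H (dlt b) \<cdot> hunit H" for b
      using is_hopf by (simp add: hDelta_dlt b smul_def lin_def is_hopf_def case_prod_unfold)
  qed simp
qed

lemma flinear_hS: "flinear (hS H)"
  unfolding hS_def by (rule flinear_lin)

lemma fin_hS [simp]: "fin x \<Longrightarrow> fin (hS H x)"
  unfolding hS_def by (intro fin_lin fin_hantipode)

lemma hS_dlt: "hS H (dlt b) = hantipode H b"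
  by (simp add: hS_def)

lemma antipode_tens:
  assumes "fin x" "fin y"
  shows "lin (\<lambda>(p, q). hmul H (hantipode H p) (dlt q)) (tens x y) = hmul H (hS H x) y" (is "?L x y = _")
    and "lin (\<lambda>(p, q). hmul H (dlt p) (hantipode H q)) (tens x y) = hmul H x (hS H y)" (is "?R x y = _")
proof -
  have 1: "?L (dlt a) (dlt b) = hmul H (hS H (dlt a)) (dlt b)"
          "?R (dlt a) (dlt b) = hmul H (dlt a) (hS H (dlt b))" for a b
    by (simp_all add: tens_dlt hS_dlt)
  have 2: "?L (dlt a) y = hmul H (hS H (dlt a)) y" for a
    by (rule flinear_ext[OF _ _ \<open>fin y\<close>, of "?L (dlt a)" "hmul H (hS H (dlt a))"])
      ((intro flinear_comp[OF flinear_lin flinear_tens_right] flinear_hmul_right fin_hS fin_dlt fin_tens 1 | assumption)+)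
  show "?L x y = hmul H (hS H x) y"
    by (rule flinear_ext[OF _ _ \<open>fin x\<close>, of "\<lambda>x. ?L x y" "\<lambda>x. hmul H (hS H x) y"])
      ((intro flinear_comp[OF flinear_lin flinear_tens_left] flinear_comp[OF flinear_hmul_left flinear_hS]
        fin_hS fin_dlt fin_tens assms 2 | assumption)+)
  have 3: "?R (dlt a) y = hmul H (dlt a) (hS H y)" for a
    by (rule flinear_ext[OF _ _ \<open>fin y\<close>, of "?R (dlt a)" "\<lambda>y. hmul H (dlt a) (hS H y)"])
      ((intro flinear_comp[OF flinear_lin flinear_tens_right] flinear_comp[OF flinear_hmul_right flinear_hS]
         fin_hS fin_dlt fin_tens 1 | assumption)+)
  show "?R x y = hmul H x (hS H y)"
    by (rule flinear_ext[OF _ _ \<open>fin x\<close>, of "\<lambda>x. ?R x y" "\<lambda>x. hmul H x (hS H y)"])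
      ((intro flinear_comp[OF flinear_lin flinear_tens_left] flinear_hmul_left
        fin_hS fin_dlt fin_tens assms 3 | assumption)+)
qed

section \<open>Grouplike elements and their group\<close>

lemma grouplikeD:
  assumes "grouplike H g"
  shows "fin g" "hDelta H g = tens g g" "heps H g = 1" "g \<noteq> 0"
proof -
  show g: "fin g" "hDelta H g = tens g g" "g \<noteq> 0"
    using assms by (auto simp: grouplike_def zero_fun_def)
  \<comment> \<open>The counit axiom applied to g tensor g; cancelling the nonzero vector
    \<open>g\<close> then gives counit 1.\<close>
  have "heps H g \<cdot> g = g"
    using counit_left[OF g(1)] counit_tens[OF g(1)] by (simp only: g(2))
  then have "heps H g \<cdot> g = 1 \<cdot> g" by simp
  then show "heps H g = 1"
    using g(3) fs.scale_cancel_right by blast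
qed

lemma grouplikeI: "fin g \<Longrightarrow> g \<noteq> 0 \<Longrightarrow> hDelta H g = tens g g \<Longrightarrow> grouplike H g"
  by (simp add: grouplike_def zero_fun_def)

lemma grouplike_antipode:
  assumes "grouplike H g"
  shows "hmul H (hS H g) g = hunit H" "hmul H g (hS H g) = hunit H"
proof -
  note g = grouplikeD[OF assms]
  show "hmul H (hS H g) g = hunit H" "hmul H g (hS H g) = hunit H"
    using antipode_fold[OF g(1)] antipode_tens[OF g(1) g(1)] by (simp_all only: g fs.scale_one)
qed

lemma hunit_grouplike: "grouplike H (hunit H)"
proof (rule grouplikeI)
  show "hunit H \<noteq> 0"
    using is_hopf heps_0 by (auto simp: is_hopf_def)
qed (use is_hopf in \<open>auto simp: is_hopf_def\<close>)

lemma hmul_0_right: "fin x \<Longrightarrow> hmul H x 0 = 0"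
  by (rule flinear_0[OF flinear_hmul_right])

lemma hmul_0_left: "fin x \<Longrightarrow> hmul H 0 x = 0"
  by (rule flinear_0[OF flinear_hmul_left])

lemma hmul_grouplike:
  assumes "grouplike H g" "grouplike H h"
  shows "grouplike H (hmul H g h)"
proof (rule grouplikeI)
  note g = grouplikeD[OF assms(1)] and h = grouplikeD[OF assms(2)]
  show "fin (hmul H g h)" by (simp add: g h)
  show "hDelta H (hmul H g h) = tens (hmul H g h) (hmul H g h)"
    by (simp only: hDelta_hmul g h tmul_tens)
  \<comment> \<open>Multiplication by S(g) recovers \<open>h\<close>, so the product g h cannot
    vanish.\<close>
  have "hmul H (hS H g) (hmul H g h) = h"
    using grouplike_antipode(1)[OF assms(1)] hmul_assoc[of "hS H g" g h] hmul_unit_left[of h]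
    by (simp only: fin_hS g h)
  then show "hmul H g h \<noteq> 0"
    using h(4) hmul_0_right[of "hS H g"] fin_hS[OF g(1)] by metis
qed

text \<open>Both Delta(S g) and S g tensor S g are inverse to g tensor g = Delta(g) in the tensor
  product algebra. Uniqueness of inverses replaces the general fact that the antipode reverses the
  comultiplication.\<close>

lemma hS_grouplike:
  assumes "grouplike H g"
  shows "grouplike H (hS H g)"
proof (rule grouplikeI)
  note g = grouplikeD[OF assms] and a = grouplike_antipode[OF assms]
  let ?s = "hS H g"
  show s: "fin ?s" using g by simp
  have u: "tens (hunit H) (hunit H) = hDelta H (hunit H)"
    using is_hopf by (simp add: is_hopf_def)
  have "hDelta H ?s = tmul H (hDelta H ?s) (tens (hunit H) (hunit H))"
    using s by (simp add: tmul_unit_right)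
  also have "tens (hunit H) (hunit H) = tmul H (tens g g) (tens ?s ?s)"
    using s g a by (simp add: tmul_tens)
  also have "tmul H (hDelta H ?s) (tmul H (tens g g) (tens ?s ?s))
      = tmul H (tmul H (hDelta H ?s) (hDelta H g)) (tens ?s ?s)"
    using s g by (simp add: tmul_assoc)
  also have "tmul H (hDelta H ?s) (hDelta H g) = tens (hunit H) (hunit H)"
    using hDelta_hmul[OF s g(1)] a(1) u by metis
  also have "tmul H (tens (hunit H) (hunit H)) (tens ?s ?s) = tens ?s ?s"
    using s by (simp add: tmul_tens hmul_unit_left)
  finally show "hDelta H ?s = tens ?s ?s" .
  show "?s \<noteq> 0"
    using a(1) hmul_0_left[OF g(1)] grouplikeD(4)[OF hunit_grouplike] by metis
qed

text \<open>The product is that of all of H, so it can also be written between a grouplike and a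
  skew-primitive element outside the carrier.\<close>

definition G :: "('b \<Rightarrow> 'k) monoid" where
  "G = \<lparr>carrier = {g. grouplike H g}, mult = hmul H, one = hunit H\<rparr>"

lemma G_simps [simp]: "carrier G = {g. grouplike H g}" "mult G = hmul H" "one G = hunit H"
  by (simp_all add: G_def)

sublocale G: group G
  by (rule groupI)
    (auto simp: hmul_grouplike hunit_grouplike hmul_unit_left hmul_assoc grouplikeD(1)
      intro: hS_grouplike grouplike_antipode)

lemma inv_G: "grouplike H g \<Longrightarrow> inv\<^bsub>G\<^esub> g = hS H g"
  by (rule G.inv_equality) (auto simp: grouplike_antipode hS_grouplike)

lemma gpow_G:
  assumes "grouplike H g"
  shows "gpow H g i = g [^]\<^bsub>G\<^esub> i"
proof -
  have *: "((\<lambda>y. hmul H y x) ^^ n) (hunit H) = x [^]\<^bsub>G\<^esub> n" for x and n :: nat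
    by (induction n) simp_all
  have "(hS H g) [^]\<^bsub>G\<^esub> n = inv\<^bsub>G\<^esub> (g [^]\<^bsub>G\<^esub> n)" for n :: nat
    using G.nat_pow_inv[of g n] assms by (simp only: inv_G[OF assms] G_simps mem_Collect_eq)
  then show ?thesis
    by (cases "i < 0") (simp_all only: gpow_def int_pow_def2 * if_True if_False not_less, simp_all)
qed

section \<open>Skew-primitive elements\<close>

lemma PrimD: "x \<in> Prim H g h \<Longrightarrow> fin x" "x \<in> Prim H g h \<Longrightarrow> hDelta H x = tens g x + tens x h"
  by (simp_all add: Prim_def plus_fun_def)

lemma PrimI: "fin x \<Longrightarrow> hDelta H x = tens g x + tens x h \<Longrightarrow> x \<in> Prim H g h"
  by (simp add: Prim_def plus_fun_def)

lemma Prim_add: "x \<in> Prim H g h \<Longrightarrow> y \<in> Prim H g h \<Longrightarrow> x + y \<in> Prim H g h"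
  by (rule PrimI) (simp_all only: PrimD fin_add flinear_add[OF flinear_hDelta] tens_simps ac_simps)

lemma Prim_smul: "x \<in> Prim H g h \<Longrightarrow> c \<cdot> x \<in> Prim H g h"
  by (rule PrimI) (simp_all only: PrimD fin_smul flinear_smul[OF flinear_hDelta] tens_simps fs.scale_right_distrib)

lemma Prim_0: "0 \<in> Prim H g h"
  by (rule PrimI) (simp_all add: flinear_0[OF flinear_hDelta] flinear_0[OF flinear_tens_left]
      flinear_0[OF flinear_tens_right])

lemma Prim_trivial:
  assumes "grouplike H g" "grouplike H h"
  shows "g - h \<in> Prim H g h"
  using grouplikeD[OF assms(1)] grouplikeD[OF assms(2)]
  by (intro PrimI) (simp_all only: fin_diff flinear_diff[OF flinear_hDelta] tens_simps, simp)

text \<open>Applying the counit to the first factor of g tensor x + x tensor h gives x = x + eps(x)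
  h. This is the counit axiom for the upper right entries of the block matrices below.\<close>

lemma heps_Prim:
  assumes "grouplike H g" "grouplike H h" "x \<in> Prim H g h"
  shows "heps H x = 0"
proof -
  note g = grouplikeD[OF assms(1)] and h = grouplikeD[OF assms(2)] and x = PrimD[OF assms(3)]
  have "(\<lambda>i. heps H (\<lambda>p. hDelta H x (p, i))) = heps H g \<cdot> x + heps H x \<cdot> h"
  proof -
    have "(\<lambda>p. hDelta H x (p, i)) = (\<lambda>p. tens g x (p, i)) + (\<lambda>p. tens x h (p, i))" for i
      by (simp only: x plus_fun_def)
    then have "heps H (\<lambda>p. hDelta H x (p, i))
        = heps H (\<lambda>p. tens g x (p, i)) + heps H (\<lambda>p. tens x h (p, i))" for i
      using g(1) h(1) x(1) by (simp only: heps_add fin_slice fin_tens)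
    then show ?thesis
      using counit_tens[OF g(1), of x] counit_tens[OF x(1), of h]
      by (simp add: fun_eq_iff)
  qed
  then have "heps H x \<cdot> h = 0"
    using counit_left[OF x(1)] g(3) by simp
  then show ?thesis using h(4) fs.scale_eq_0_iff by blast
qed

lemma Prim_mult_left:
  assumes "grouplike H k" "grouplike H g" "grouplike H h" "x \<in> Prim H g h"
  shows "hmul H k x \<in> Prim H (hmul H k g) (hmul H k h)"
  using grouplikeD[OF assms(1)] grouplikeD[OF assms(2)] grouplikeD[OF assms(3)] PrimD[OF assms(4)]
  by (intro PrimI) (simp_all only: fin_hmul hDelta_hmul flinear_add[OF flinear_tmul_right] fin_tens tmul_tens)

lemma Prim_mult_right:
  assumes "grouplike H k" "grouplike H g" "grouplike H h" "x \<in> Prim H g h"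
  shows "hmul H x k \<in> Prim H (hmul H g k) (hmul H h k)"
  using grouplikeD[OF assms(1)] grouplikeD[OF assms(2)] grouplikeD[OF assms(3)] PrimD[OF assms(4)]
  by (intro PrimI) (simp_all only: fin_hmul hDelta_hmul flinear_add[OF flinear_tmul_left] fin_tens tmul_tens)

end

section \<open>Comodules given by block matrices\<close>

definition mat_mul :: "nat \<Rightarrow> (nat \<Rightarrow> nat \<Rightarrow> 'k::field) \<Rightarrow> (nat \<Rightarrow> nat \<Rightarrow> 'k) \<Rightarrow> nat \<Rightarrow> nat \<Rightarrow> 'k" where
  "mat_mul d P Q = (\<lambda>i j. \<Sum>k<d. P i k * Q k j)"

text \<open>Matrices are functions on all pairs of naturals, and only indices below \<open>d\<close>
  carry meaning. Products associate as functions, but \<open>mat_id\<close> is neutral only up to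
  this relation.\<close>

definition mat_eq :: "nat \<Rightarrow> (nat \<Rightarrow> nat \<Rightarrow> 'k::field) \<Rightarrow> (nat \<Rightarrow> nat \<Rightarrow> 'k) \<Rightarrow> bool" where
  "mat_eq d P Q \<longleftrightarrow> (\<forall>i<d. \<forall>j<d. P i j = Q i j)"

definition mat_id :: "nat \<Rightarrow> nat \<Rightarrow> 'k::field" where
  "mat_id = (\<lambda>i j. if i = j then 1 else 0)"

lemma mat_mul_assoc: "mat_mul d (mat_mul d P Q) R = mat_mul d P (mat_mul d Q R)"
proof (rule ext, rule ext)
  fix i j
  have "mat_mul d (mat_mul d P Q) R i j = (\<Sum>k<d. \<Sum>l<d. P i l * Q l k * R k j)"
    by (simp only: mat_mul_def sum_distrib_right)
  also have "\<dots> = (\<Sum>l<d. \<Sum>k<d. P i l * Q l k * R k j)" by (rule sum.swap)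
  also have "\<dots> = mat_mul d P (mat_mul d Q R) i j"
    by (simp only: mat_mul_def sum_distrib_left mult.assoc)
  finally show "mat_mul d (mat_mul d P Q) R i j = mat_mul d P (mat_mul d Q R) i j" .
qed

lemma mat_eq_refl: "mat_eq d P P" and mat_eq_sym: "mat_eq d P Q \<Longrightarrow> mat_eq d Q P"
  and mat_eq_trans [trans]: "mat_eq d P Q \<Longrightarrow> mat_eq d Q R \<Longrightarrow> mat_eq d P R"
  by (auto simp: mat_eq_def)

lemma mat_eq_mat_mul: "mat_eq d P P' \<Longrightarrow> mat_eq d Q Q' \<Longrightarrow> mat_eq d (mat_mul d P Q) (mat_mul d P' Q')"
  by (auto simp: mat_eq_def mat_mul_def intro!: sum.cong)

lemma mat_mul_mat_id: "mat_eq d (mat_mul d mat_id P) P" "mat_eq d (mat_mul d P mat_id) P"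
  by (auto simp: mat_eq_def mat_mul_def mat_id_def if_distrib[of "\<lambda>u. u * _"] if_distrib[of "\<lambda>u. _ * u"]
      sum.delta sum.delta' cong: if_cong)

lemma mat_eq_mat_mul_left: "mat_eq d Q Q' \<Longrightarrow> mat_eq d (mat_mul d P Q) (mat_mul d P Q')"
  and mat_eq_mat_mul_right: "mat_eq d P P' \<Longrightarrow> mat_eq d (mat_mul d P Q) (mat_mul d P' Q)"
  by (simp_all add: mat_eq_mat_mul mat_eq_refl)

lemma mat_mul_scale_left: "mat_mul d (\<lambda>i j. c * P i j) Q = (\<lambda>i j. c * mat_mul d P Q i j)"
  and mat_mul_scale_right: "mat_mul d P (\<lambda>i j. c * Q i j) = (\<lambda>i j. c * mat_mul d P Q i j)"
  by (simp_all only: mat_mul_def sum_distrib_left mult.assoc mult.left_commute)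

text \<open>A matrix over H is tested at every basis index \<open>z\<close>, where P X = Y P becomes
  an equation of scalar matrices.\<close>

definition intertwines :: "nat \<Rightarrow> (nat \<Rightarrow> nat \<Rightarrow> 'k::field) \<Rightarrow> (nat \<Rightarrow> nat \<Rightarrow> 'b \<Rightarrow> 'k) \<Rightarrow>
    (nat \<Rightarrow> nat \<Rightarrow> 'b \<Rightarrow> 'k) \<Rightarrow> bool" where
  "intertwines d P X Y \<longleftrightarrow> (\<forall>z. mat_eq d (mat_mul d P (\<lambda>i j. X i j z)) (mat_mul d (\<lambda>i j. Y i j z) P))"

lemma intertwines_mat_mul:
  assumes "intertwines d P X Y" "intertwines d Q Y Z"
  shows "intertwines d (mat_mul d Q P) X Z"
  unfolding intertwines_def
proof
  fix z
  have "mat_eq d (mat_mul d (mat_mul d Q P) (\<lambda>i j. X i j z)) (mat_mul d Q (mat_mul d (\<lambda>i j. Y i j z) P))"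
    unfolding mat_mul_assoc using assms(1) by (intro mat_eq_mat_mul_left) (simp add: intertwines_def)
  also have "mat_eq d \<dots> (mat_mul d (\<lambda>i j. Z i j z) (mat_mul d Q P))"
    unfolding mat_mul_assoc[symmetric] using assms(2) by (intro mat_eq_mat_mul_right) (simp add: intertwines_def)
  finally show "mat_eq d (mat_mul d (mat_mul d Q P) (\<lambda>i j. X i j z)) (mat_mul d (\<lambda>i j. Z i j z) (mat_mul d Q P))" .
qed

lemma intertwines_inverse:
  assumes "intertwines d P X Y" "mat_eq d (mat_mul d P Q) mat_id" "mat_eq d (mat_mul d Q P) mat_id"
  shows "intertwines d Q Y X"
  unfolding intertwines_def
proof
  fix z
  let ?X = "\<lambda>i j. X i j z" and ?Y = "\<lambda>i j. Y i j z"
  have "mat_eq d (mat_mul d Q ?Y) (mat_mul d (mat_mul d Q ?Y) (mat_mul d P Q))"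
    using mat_eq_mat_mul_left[OF assms(2)] mat_mul_mat_id(2) mat_eq_trans mat_eq_sym by blast
  also have "mat_mul d (mat_mul d Q ?Y) (mat_mul d P Q) = mat_mul d Q (mat_mul d (mat_mul d ?Y P) Q)"
    by (simp only: mat_mul_assoc)
  also have "mat_eq d \<dots> (mat_mul d Q (mat_mul d (mat_mul d P ?X) Q))"
    using assms(1) unfolding intertwines_def by (intro mat_eq_mat_mul_left mat_eq_mat_mul_right) (metis mat_eq_sym)
  also have "mat_mul d Q (mat_mul d (mat_mul d P ?X) Q) = mat_mul d (mat_mul d Q P) (mat_mul d ?X Q)"
    by (simp only: mat_mul_assoc)
  also have "mat_eq d \<dots> (mat_mul d ?X Q)"
    using mat_eq_mat_mul_right[OF assms(3)] mat_mul_mat_id(1) mat_eq_trans by blast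
  finally show "mat_eq d (mat_mul d Q ?Y) (mat_mul d ?X Q)" .
qed

lemma comod_iso_iff:
  "comod_iso d X Y \<longleftrightarrow> (\<exists>P Q. mat_eq d (mat_mul d P Q) mat_id \<and> mat_eq d (mat_mul d Q P) mat_id \<and> intertwines d P X Y)"
proof -
  have "(\<forall>i<d. \<forall>j<d. (\<lambda>z. \<Sum>k<d. P i k * X k j z) = (\<lambda>z. \<Sum>k<d. Y i k z * P k j))
      \<longleftrightarrow> intertwines d P X Y" for P
    unfolding intertwines_def mat_eq_def mat_mul_def fun_eq_iff by blast
  then show ?thesis
    unfolding comod_iso_def by (simp add: mat_eq_def mat_mul_def mat_id_def)
qed

lemma comod_iso_refl: "comod_iso d X X"
  unfolding comod_iso_iff
proof (intro exI conjI)
  show "intertwines d mat_id X X"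
    unfolding intertwines_def using mat_mul_mat_id mat_eq_sym mat_eq_trans by blast
qed (rule mat_mul_mat_id)+

lemma comod_iso_sym: "comod_iso d X Y \<Longrightarrow> comod_iso d Y X"
  unfolding comod_iso_iff using intertwines_inverse by blast

lemma comod_iso_trans:
  assumes "comod_iso d X Y" "comod_iso d Y Z"
  shows "comod_iso d X Z"
proof -
  have inv: "mat_eq d (mat_mul d (mat_mul d P1 P2) (mat_mul d Q2 Q1)) mat_id"
    if "mat_eq d (mat_mul d P1 Q1) mat_id" "mat_eq d (mat_mul d P2 Q2) mat_id" for P1 P2 Q1 Q2 :: "nat \<Rightarrow> nat \<Rightarrow> 'b"
  proof -
    have 1: "mat_mul d (mat_mul d P1 P2) (mat_mul d Q2 Q1) = mat_mul d P1 (mat_mul d (mat_mul d P2 Q2) Q1)" by (simp only: mat_mul_assoc)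
    have "mat_eq d (mat_mul d (mat_mul d P2 Q2) Q1) Q1"
      by (rule mat_eq_trans[OF mat_eq_mat_mul_right[OF that(2)] mat_mul_mat_id(1)])
    then show ?thesis unfolding 1 by (rule mat_eq_trans[OF mat_eq_mat_mul_left that(1)])
  qed
  from assms obtain P1 Q1 P2 Q2 where
    1: "mat_eq d (mat_mul d P1 Q1) mat_id" "mat_eq d (mat_mul d Q1 P1) mat_id" "intertwines d P1 X Y" and
    2: "mat_eq d (mat_mul d P2 Q2) mat_id" "mat_eq d (mat_mul d Q2 P2) mat_id" "intertwines d P2 Y Z"
    unfolding comod_iso_iff by blast
  show ?thesis unfolding comod_iso_iff
    using inv[OF 2(1) 1(1)] inv[OF 1(2) 2(2)] intertwines_mat_mul[OF 1(3) 2(3)] by blast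
qed

lemma sum_eq_single:
  assumes "finite K" "i \<in> K" "\<And>k. k \<in> K \<Longrightarrow> k \<noteq> i \<Longrightarrow> f k = 0"
  shows "sum f K = f i"
  using assms sum.remove[of K i f] by (simp add: sum.neutral)

lemma sum_eq_pair:
  assumes "finite K" "i \<in> K" "j \<in> K" "i \<noteq> j" "\<And>k. k \<in> K \<Longrightarrow> k \<noteq> i \<Longrightarrow> k \<noteq> j \<Longrightarrow> f k = 0"
  shows "sum f K = f i + f j"
proof -
  have "sum f (K - {i}) = f j" by (rule sum_eq_single) (use assms in auto)
  then show ?thesis using assms sum.remove[of K i f] by simp
qed

lemma sum_double: "(\<Sum>k<n + m. f k) = (\<Sum>k<n. f k) + (\<Sum>k<m. f (n + k))"
  for f :: "nat \<Rightarrow> 'a::comm_monoid_add"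
  by (induction m) (simp_all add: add.assoc)

text \<open>The block matrix \<open>[[diag g, M], [0, diag h]]\<close> of size \<open>2n\<close>.\<close>
definition block_mat :: "nat \<Rightarrow> (nat \<Rightarrow> 'b \<Rightarrow> 'k::zero) \<Rightarrow> (nat \<Rightarrow> 'b \<Rightarrow> 'k) \<Rightarrow> (nat \<Rightarrow> nat \<Rightarrow> 'b \<Rightarrow> 'k) \<Rightarrow>
    nat \<Rightarrow> nat \<Rightarrow> 'b \<Rightarrow> 'k" where
  "block_mat n g h M i j =
     (if i < n then (if j < n then (if i = j then g i else 0) else M i (j - n))
      else if j < n then 0 else if i = j then h (i - n) else 0)"

lemma tens_0 [simp]: "tens 0 x = 0" "tens x 0 = 0"
  by (simp_all add: tens_def fun_eq_iff)

text \<open>The conclusions are the four blocks of P X = X' P, in the order lower left, upper left,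
  lower right, upper right.\<close>

lemma block_mat_intertwiner:
  fixes g h :: "nat \<Rightarrow> 'b \<Rightarrow> 'k::field"
  assumes "intertwines (n + n) P (block_mat n g h M) (block_mat n g h M')" "i < n" "j < n"
  shows "P (n + i) j \<cdot> g j = P (n + i) j \<cdot> h i"
    and "P i j \<cdot> g j = P i j \<cdot> g i + (\<Sum>k<n. P (n + k) j \<cdot> M' i k)"
    and "(\<Sum>k<n. P (n + i) k \<cdot> M k j) + P (n + i) (n + j) \<cdot> h j = P (n + i) (n + j) \<cdot> h i"
    and "(\<Sum>k<n. P i k \<cdot> M k j) + P i (n + j) \<cdot> h j
       = P i (n + j) \<cdot> g i + (\<Sum>k<n. P (n + k) (n + j) \<cdot> M' i k)"
proof -
  have eq: "(\<Sum>k<n. P i k \<cdot> block_mat n g h M k j) + (\<Sum>k<n. P i (n + k) \<cdot> block_mat n g h M (n + k) j)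
      = (\<Sum>k<n. P k j \<cdot> block_mat n g h M' i k) + (\<Sum>k<n. P (n + k) j \<cdot> block_mat n g h M' i (n + k))"
    if "i < n + n" "j < n + n" for i j
  proof
    fix z
    have "(\<Sum>k<n + n. P i k * block_mat n g h M k j z) = (\<Sum>k<n + n. block_mat n g h M' i k z * P k j)"
      using assms(1) that by (simp only: intertwines_def mat_eq_def mat_mul_def)
    then show "((\<Sum>k<n. P i k \<cdot> block_mat n g h M k j) + (\<Sum>k<n. P i (n + k) \<cdot> block_mat n g h M (n + k) j)) z
      = ((\<Sum>k<n. P k j \<cdot> block_mat n g h M' i k) + (\<Sum>k<n. P (n + k) j \<cdot> block_mat n g h M' i (n + k))) z"
      by (simp only: sum_double plus_fun_apply sum_fun_apply smul_apply mult.commute)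
  qed
  have [simp]: "(\<Sum>k<n. c k \<cdot> (if k = a then u k else 0)) = c a \<cdot> u a"
      "(\<Sum>k<n. c k \<cdot> (if a = k then u k else 0)) = c a \<cdot> u a"
      if "a < n" for c and u :: "nat \<Rightarrow> 'b \<Rightarrow> 'k" and a
    using that by (subst sum_eq_single[of _ a]; simp)+
  have [simp]: "(\<Sum>k<n. c k \<cdot> (if k = a then u a else 0)) = c a \<cdot> u a"
      "(\<Sum>k<n. c k \<cdot> (if a = k then u a else 0)) = c a \<cdot> u a"
      if "a < n" for c and u :: "nat \<Rightarrow> 'b \<Rightarrow> 'k" and a
    using that by (subst sum_eq_single[of _ a]; simp)+
  have bl: "block_mat n g h M k j = (if k = j then g k else 0)"
           "block_mat n g h M k (n + j) = M k j"
           "block_mat n g h M (n + k) j = 0"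
           "block_mat n g h M (n + k) (n + j) = (if k = j then h k else 0)" if "k < n" "j < n" for k j M
    using that by (simp_all add: block_mat_def)
  show "P (n + i) j \<cdot> g j = P (n + i) j \<cdot> h i"
    using eq[of "n + i" j] assms(2,3) by (simp add: bl cong: sum.cong_simp)
  show "P i j \<cdot> g j = P i j \<cdot> g i + (\<Sum>k<n. P (n + k) j \<cdot> M' i k)"
    using eq[of i j] assms(2,3) by (simp add: bl cong: sum.cong_simp)
  show "(\<Sum>k<n. P (n + i) k \<cdot> M k j) + P (n + i) (n + j) \<cdot> h j = P (n + i) (n + j) \<cdot> h i"
    using eq[of "n + i" "n + j"] assms(2,3) by (simp add: bl cong: sum.cong_simp)
  show "(\<Sum>k<n. P i k \<cdot> M k j) + P i (n + j) \<cdot> h j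
       = P i (n + j) \<cdot> g i + (\<Sum>k<n. P (n + k) (n + j) \<cdot> M' i k)"
    using eq[of i "n + j"] assms(2,3) by (simp add: bl cong: sum.cong_simp)
qed

section \<open>Block comodules and the criterion against discreteness\<close>

context hopf_algebra
begin

text \<open>For an upper right entry x the sum over k in the comodule axiom keeps only two terms,
  g_i tensor x and x tensor h_j; the axiom there is skew-primitivity itself.\<close>

lemma comodule_block_mat:
  assumes g: "\<And>i. i < n \<Longrightarrow> grouplike H (g i)" and h: "\<And>i. i < n \<Longrightarrow> grouplike H (h i)"
    and M: "\<And>i j. i < n \<Longrightarrow> j < n \<Longrightarrow> M i j \<in> Prim H (g i) (h j)"
  shows "comodule H (n + n) (block_mat n g h M)"
  unfolding comodule_def
proof (intro allI impI conjI)
  fix i j assume i: "i < n + n" and j: "j < n + n"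
  let ?X = "block_mat n g h M"
  have M': "M i (j - n) \<in> Prim H (g i) (h (j - n))" if "i < n" "\<not> j < n"
    using that j by (intro M) auto
  have h': "grouplike H (h (i - n))" if "\<not> i < n" using that i by (intro h) auto
  have h'': "grouplike H (h (j - n))" if "\<not> j < n" using that j by (intro h) auto
  show "fin (?X i j)"
    using grouplikeD(1)[OF g] grouplikeD(1)[OF h'] PrimD(1)[OF M'] by (auto simp: block_mat_def)
  show "heps H (?X i j) = (if i = j then 1 else 0)"
    using grouplikeD(3)[OF g] grouplikeD(3)[OF h'] heps_Prim[OF g h'' M'] by (auto simp: block_mat_def heps_0)
  have *: "hDelta H (?X i j) = (\<Sum>k<n + n. tens (?X i k) (?X k j))"
  proof -
    consider "i < n" "j < n" | "i < n" "\<not> j < n" | "\<not> i < n" "j < n" | "\<not> i < n" "\<not> j < n" by blast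
    then show ?thesis
    proof cases
      case 1
      then show ?thesis
        using i grouplikeD(2)[OF g, of i]
        by (subst sum_eq_single[of _ i]) (auto simp: block_mat_def flinear_0[OF flinear_hDelta])
    next
      case 2
      then show ?thesis
        using i j PrimD(2)[OF M']
        by (subst sum_eq_pair[of _ i j]) (auto simp: block_mat_def)
    next
      case 3
      then show ?thesis
        by (subst sum.neutral) (auto simp: block_mat_def flinear_0[OF flinear_hDelta])
    next
      case 4
      then show ?thesis
        using i grouplikeD(2)[OF h']
        by (subst sum_eq_single[of _ i]) (auto simp: block_mat_def flinear_0[OF flinear_hDelta])
    qed
  qed
  show "hDelta H (?X i j) = (\<lambda>z. \<Sum>k<n + n. tens (?X i k) (?X k j) z)"
    unfolding * by (rule ext) (rule sum_fun_apply)
qed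

end

context hopf_algebra
begin

text \<open>An intertwiner of two block matrices has blocks \<open>[[A, B], [C, D]]\<close>.  Assumption \<open>a\<close> forces \<open>C = 0\<close>;
  assumption \<open>b\<close> then forces \<open>A\<close> and \<open>D\<close> to be the same scalar.\<close>
lemma infinite_family_not_discrete:
  assumes inf: "infinite (\<Lambda> :: 'l set)" and "n > 0"
    and gh: "\<And>i. i < n \<Longrightarrow> grouplike H (g i)" "\<And>i. i < n \<Longrightarrow> grouplike H (h i)"
    and M: "\<And>l i j. i < n \<Longrightarrow> j < n \<Longrightarrow> M l i j \<in> Prim H (g i) (h j)"
    and a: "\<And>l C. l \<in> \<Lambda> \<Longrightarrow> (\<And>i j. i < n \<Longrightarrow> j < n \<Longrightarrow> C i j \<noteq> 0 \<Longrightarrow> g j = h i) \<Longrightarrow>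
        (\<And>i j. i < n \<Longrightarrow> j < n \<Longrightarrow> \<exists>c. (\<Sum>k<n. C k j \<cdot> M l i k) = c \<cdot> (g i - g j)) \<Longrightarrow>
        (\<And>i j. i < n \<Longrightarrow> j < n \<Longrightarrow> C i j = (0::'k))"
    and b: "\<And>l l' A D. l \<in> \<Lambda> \<Longrightarrow> l' \<in> \<Lambda> \<Longrightarrow>
        (\<And>i j. i < n \<Longrightarrow> j < n \<Longrightarrow> A i j \<noteq> 0 \<Longrightarrow> g i = g j) \<Longrightarrow>
        (\<And>i j. i < n \<Longrightarrow> j < n \<Longrightarrow> D i j \<noteq> 0 \<Longrightarrow> h i = h j) \<Longrightarrow>
        (\<And>i j. i < n \<Longrightarrow> j < n \<Longrightarrow>
           \<exists>c. (\<Sum>k<n. A i k \<cdot> M l k j) - (\<Sum>k<n. D k j \<cdot> M l' i k) = c \<cdot> (g i - h j)) \<Longrightarrow>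
        \<exists>\<alpha>::'k. (\<forall>i<n. \<forall>j<n. A i j = \<alpha> * mat_id i j \<and> D i j = \<alpha> * mat_id i j) \<and> (\<alpha> \<noteq> 0 \<longrightarrow> l = l')"
  shows "\<not> discrete_corep_type H"
proof
  assume disc: "discrete_corep_type H"
  let ?X = "\<lambda>l. block_mat n g h (M l)" and ?d = "n + n"
  have d: "?d > 0" using \<open>n > 0\<close> by simp
  have comod: "comodule H ?d (?X l)" for l
    by (intro comodule_block_mat gh M)
  \<comment> \<open>Both the absence of isomorphisms and indecomposability are read off from this
    shape of an arbitrary intertwiner within the family.\<close>
  have key: "\<exists>\<alpha>. (\<forall>i<n. \<forall>j<n. P i j = \<alpha> * mat_id i j \<and> P (n + i) (n + j) = \<alpha> * mat_id i j \<and> P (n + i) j = 0)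
      \<and> (\<alpha> \<noteq> 0 \<longrightarrow> l = l')"
    if P: "intertwines ?d P (?X l) (?X l')" and l: "l \<in> \<Lambda>" "l' \<in> \<Lambda>" for P l l'
  proof -
    note I = block_mat_intertwiner[OF P]
    have "P (n + i) j \<noteq> 0 \<Longrightarrow> g j = h i" if "i < n" "j < n" for i j
      using I(1)[OF that] fs.scale_cancel_left by metis
    \<comment> \<open>The upper left block equation, solved for the contribution of the lower left
      block, has the form that assumption \<open>a\<close> asks for.\<close>
    moreover have "(\<Sum>k<n. P (n + k) j \<cdot> M l' i k) = (- P i j) \<cdot> (g i - g j)" if "i < n" "j < n" for i j
      using I(2)[OF that] by (simp add: fs.scale_right_diff_distrib)
    ultimately have C: "P (n + i) j = 0" if "i < n" "j < n" for i j
      using a[OF l(2), of "\<lambda>i j. P (n + i) j"] that by blast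
    have "P i j \<cdot> g j = P i j \<cdot> g i" if "i < n" "j < n" for i j
      using I(2)[OF that] C that by simp
    then have A: "P i j \<noteq> 0 \<Longrightarrow> g i = g j" if "i < n" "j < n" for i j
      using that fs.scale_cancel_left by metis
    have "P (n + i) (n + j) \<cdot> h j = P (n + i) (n + j) \<cdot> h i" if "i < n" "j < n" for i j
      using I(3)[OF that] C that by simp
    then have D: "P (n + i) (n + j) \<noteq> 0 \<Longrightarrow> h i = h j" if "i < n" "j < n" for i j
      using that fs.scale_cancel_left by metis
    have "(\<Sum>k<n. P i k \<cdot> M l k j) - (\<Sum>k<n. P (n + k) (n + j) \<cdot> M l' i k)
        = P i (n + j) \<cdot> (g i - h j)" if "i < n" "j < n" for i j
      using I(4)[OF that] by (simp add: fs.scale_right_diff_distrib algebra_simps)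
    then have "\<exists>c. (\<Sum>k<n. P i k \<cdot> M l k j) - (\<Sum>k<n. P (n + k) (n + j) \<cdot> M l' i k) = c \<cdot> (g i - h j)"
      if "i < n" "j < n" for i j
      using that by blast
    from b[OF l A D this] C show ?thesis by auto
  qed
  have noniso: "l = l'" if iso: "comod_iso ?d (?X l) (?X l')" and l: "l \<in> \<Lambda>" "l' \<in> \<Lambda>" for l l'
  proof -
    obtain P Q where PQ: "mat_eq ?d (mat_mul ?d P Q) mat_id" "intertwines ?d P (?X l) (?X l')"
      using iso unfolding comod_iso_iff by blast
    obtain \<alpha> where \<alpha>: "\<forall>i<n. \<forall>j<n. P i j = \<alpha> * mat_id i j \<and> P (n + i) (n + j) = \<alpha> * mat_id i j \<and> P (n + i) j = 0"
      "\<alpha> \<noteq> 0 \<longrightarrow> l = l'"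
      using key[OF PQ(2) l] by blast
    have "\<alpha> \<noteq> 0"
    proof
      assume "\<alpha> = 0"
      then have "P (n + 0) k = 0 \<and> P (n + 0) (n + k) = 0" if "k < n" for k
        using \<alpha>(1) \<open>n > 0\<close> that by (metis mult_zero_left)
      then have "(\<Sum>k<?d. P (n + 0) k * Q k n) = 0"
        unfolding sum_double by (simp add: sum.neutral)
      then show False using PQ(1) \<open>n > 0\<close> by (simp add: mat_eq_def mat_mul_def mat_id_def)
    qed
    then show ?thesis using \<alpha>(2) by blast
  qed
  have indec: "indecomposable H ?d (?X l)" if l: "l \<in> \<Lambda>" for l
    unfolding indecomposable_def
  proof (intro conjI comod d notI, elim exE conjE)
    fix d1 d2 X1 X2
    assume d12: "d1 > 0" "d2 > 0" "d1 + d2 = ?d" and "comod_iso ?d (?X l) (dsum d1 X1 X2)"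
    then obtain P Q where PQ: "mat_eq ?d (mat_mul ?d P Q) mat_id" "mat_eq ?d (mat_mul ?d Q P) mat_id"
      "intertwines ?d P (?X l) (dsum d1 X1 X2)" unfolding comod_iso_iff by blast
    let ?Z = "dsum d1 X1 X2"
    \<comment> \<open>The projection onto the first summand. Transported along the isomorphism it
      becomes the idempotent endomorphism \<open>E\<close> of \<open>?X l\<close>.\<close>
    define F :: "nat \<Rightarrow> nat \<Rightarrow> 'k" where "F = (\<lambda>i j. if i = j \<and> i < d1 then 1 else 0)"
    have F: "mat_mul ?d F R i j = (if i < d1 then R i j else 0)" "mat_mul ?d R F i j = (if j < d1 then R i j else 0)"
      if "i < ?d" "j < ?d" for R i j
    proof -
      have "mat_mul ?d F R i j = F i i * R i j"
        unfolding mat_mul_def by (rule sum_eq_single) (use that in \<open>auto simp: F_def\<close>)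
      then show "mat_mul ?d F R i j = (if i < d1 then R i j else 0)" by (simp add: F_def)
      have "mat_mul ?d R F i j = R i j * F j j"
        unfolding mat_mul_def by (rule sum_eq_single) (use that in \<open>auto simp: F_def\<close>)
      then show "mat_mul ?d R F i j = (if j < d1 then R i j else 0)" by (simp add: F_def)
    qed
    have FZ: "intertwines ?d F ?Z ?Z"
      unfolding intertwines_def mat_eq_def by (auto simp: F dsum_def)
    have FF: "mat_eq ?d (mat_mul ?d F F) F"
      unfolding mat_eq_def by (auto simp: F) (auto simp: F_def)
    define E where "E = mat_mul ?d Q (mat_mul ?d F P)"
    have E: "intertwines ?d E (?X l) (?X l)"
      unfolding E_def using intertwines_mat_mul[OF intertwines_mat_mul[OF PQ(3) FZ]] intertwines_inverse[OF PQ(3,1,2)]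
      by blast
    have 1: "mat_eq ?d (mat_mul ?d (mat_mul ?d P Q) (mat_mul ?d F P)) (mat_mul ?d F P)"
      by (rule mat_eq_trans[OF mat_eq_mat_mul_right[OF PQ(1)] mat_mul_mat_id(1)])
    have 2: "mat_mul ?d E E = mat_mul ?d (mat_mul ?d Q F) (mat_mul ?d (mat_mul ?d P Q) (mat_mul ?d F P))"
      and 3: "mat_mul ?d (mat_mul ?d Q F) (mat_mul ?d F P) = mat_mul ?d Q (mat_mul ?d (mat_mul ?d F F) P)"
      unfolding E_def by (simp_all only: mat_mul_assoc)
    have "mat_eq ?d (mat_mul ?d Q (mat_mul ?d (mat_mul ?d F F) P)) E"
      unfolding E_def by (rule mat_eq_mat_mul_left[OF mat_eq_mat_mul_right[OF FF]])
    then have "mat_eq ?d (mat_mul ?d E E) E"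
      using mat_eq_mat_mul_left[OF 1, of "mat_mul ?d Q F"] unfolding 2 3 by (rule mat_eq_trans[rotated])
    then have EE: "(\<Sum>k<?d. E i k * E k j) = E i j" if "i < ?d" "j < ?d" for i j
      using that by (simp add: mat_eq_def mat_mul_def)
    obtain \<alpha> where \<alpha>: "\<And>i j. i < n \<Longrightarrow> j < n \<Longrightarrow> E i j = \<alpha> * mat_id i j"
        "\<And>i j. i < n \<Longrightarrow> j < n \<Longrightarrow> E (n + i) (n + j) = \<alpha> * mat_id i j"
        "\<And>i j. i < n \<Longrightarrow> j < n \<Longrightarrow> E (n + i) j = 0"
      using key[OF E l l] by blast
    have "\<alpha> * \<alpha> = \<alpha>"
    proof -
      have "(\<Sum>k<n. E (n + 0) k * E k (n + 0)) = 0"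
        using \<alpha>(3)[of 0] \<open>n > 0\<close> by (intro sum.neutral) auto
      moreover have "(\<Sum>k<n. E (n + 0) (n + k) * E (n + k) (n + 0)) = E (n + 0) (n + 0) * E (n + 0) (n + 0)"
        by (rule sum_eq_single) (use \<open>n > 0\<close> \<alpha>(2)[of 0] in \<open>auto simp: mat_id_def\<close>)
      ultimately show ?thesis
        using EE[of "n + 0" "n + 0"] \<open>n > 0\<close> \<alpha>(2)[of 0 0] unfolding sum_double by (simp add: mat_id_def)
    qed
    then have \<alpha>01: "\<alpha> = 0 \<or> \<alpha> = 1" by simp
    \<comment> \<open>Idempotency gives \<alpha> B + B \<alpha> = B for the upper right block B,
      with \<alpha> equal to 0 or 1. Either value forces B = 0, in every characteristic.\<close>
    have B: "E i (n + j) = 0" if "i < n" "j < n" for i j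
    proof -
      have "(\<Sum>k<n. E i k * E k (n + j)) = E i i * E i (n + j)"
        by (rule sum_eq_single) (use that \<alpha>(1)[of i] in \<open>auto simp: mat_id_def\<close>)
      moreover have "(\<Sum>k<n. E i (n + k) * E (n + k) (n + j)) = E i (n + j) * E (n + j) (n + j)"
        by (rule sum_eq_single) (use that \<alpha>(2)[of _ j] in \<open>auto simp: mat_id_def\<close>)
      ultimately have "\<alpha> * E i (n + j) + E i (n + j) * \<alpha> = E i (n + j)"
        using EE[of i "n + j"] that \<alpha>(1)[of i i] \<alpha>(2)[of j j] unfolding sum_double by (simp add: mat_id_def)
      then have "E i (n + j) = 0 \<or> E i (n + j) + E i (n + j) = E i (n + j)"
        using \<alpha>01 by (metis mult_1 mult_1_right mult_zero_left mult_zero_right add_0)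
      then show ?thesis by (metis add_cancel_right_left)
    qed
    have "E i j = \<alpha> * mat_id i j" if "i < ?d" "j < ?d" for i j
    proof -
      have split: "i < n \<or> (\<exists>i'<n. i = n + i')" if "i < ?d" for i
        using that by (cases "i < n") (auto intro!: exI[of _ "i - n"])
      from split[OF that(1)] split[OF that(2)] show ?thesis
        using \<alpha> B by (elim disjE exE conjE) (simp_all add: mat_id_def)
    qed
    then have "mat_eq ?d E (\<lambda>i j. \<alpha> * mat_id i j)" by (simp add: mat_eq_def)
    then have "mat_eq ?d (mat_mul ?d (mat_mul ?d P E) Q) (mat_mul ?d (mat_mul ?d P (\<lambda>i j. \<alpha> * mat_id i j)) Q)"
      by (intro mat_eq_mat_mul_left mat_eq_mat_mul_right)
    moreover have "mat_mul ?d P (\<lambda>i j. \<alpha> * mat_id i j) = (\<lambda>i j. \<alpha> * mat_mul ?d P mat_id i j)"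
      by (rule mat_mul_scale_right)
    moreover have "mat_mul ?d (\<lambda>i j. \<alpha> * mat_mul ?d P mat_id i j) Q = (\<lambda>i j. \<alpha> * mat_mul ?d (mat_mul ?d P mat_id) Q i j)"
      by (rule mat_mul_scale_left)
    moreover have "mat_eq ?d (mat_mul ?d (mat_mul ?d P mat_id) Q) mat_id"
      by (rule mat_eq_trans[OF mat_eq_mat_mul_right[OF mat_mul_mat_id(2)] PQ(1)])
    ultimately have 1: "mat_mul ?d (mat_mul ?d P E) Q i j = \<alpha> * mat_id i j" if "i < ?d" "j < ?d" for i j
      using that by (simp add: mat_eq_def)
    have "mat_mul ?d (mat_mul ?d P E) Q = mat_mul ?d (mat_mul ?d (mat_mul ?d P Q) F) (mat_mul ?d P Q)"
      unfolding E_def by (simp only: mat_mul_assoc)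
    moreover have "mat_eq ?d \<dots> F"
      by (rule mat_eq_trans[OF mat_eq_mat_mul[OF mat_eq_trans[OF mat_eq_mat_mul_right[OF PQ(1)] mat_mul_mat_id(1)] PQ(1)] mat_mul_mat_id(2)])
    ultimately have 2: "F i j = \<alpha> * mat_id i j" if "i < ?d" "j < ?d" for i j
      using that 1 by (simp add: mat_eq_def)
    \<comment> \<open>A scalar matrix stays scalar under conjugation, so \<open>F\<close> would be
      scalar; but its first diagonal entry is 1 and its last is 0, as both summands are
      nonzero.\<close>
    have "F 0 0 = \<alpha>" "F (?d - 1) (?d - 1) = \<alpha>"
      using 2[of 0 0] 2[of "?d - 1" "?d - 1"] d by (simp_all add: mat_id_def)
    moreover have "\<not> ?d - 1 < d1" using d12 by linarith
    ultimately show False using d12(1) by (simp add: F_def)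
  qed
  \<comment> \<open>The diagonal consists of the \<open>g i\<close> and \<open>h i\<close> and does
    not depend on the parameter, so an arbitrary value serves to name the common dimension
    vector.\<close>
  define v where "v = mset (map (\<lambda>i. ?X undefined i i) [0..<?d])"
  have dimv: "has_dimvec H ?d (?X l) v" for l
    unfolding has_dimvec_def
  proof (intro conjI comod exI)
    show "comod_iso ?d (?X l) (?X l)" by (rule comod_iso_refl)
    show "\<forall>i<?d. \<forall>j<?d. j < i \<longrightarrow> ?X l i j = (\<lambda>_. 0)"
      by (auto simp: block_mat_def zero_fun_def)
    show "v = mset (map (\<lambda>i. ?X l i i) [0..<?d])"
      unfolding v_def by (rule arg_cong[of _ _ mset]) (auto simp: block_mat_def)
  qed
  obtain S where S: "finite S" "\<And>l. l \<in> \<Lambda> \<Longrightarrow> \<exists>Y\<in>S. comod_iso ?d (?X l) Y"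
    using disc indec dimv unfolding discrete_corep_type_def by metis
  then obtain Y where Y: "\<And>l. l \<in> \<Lambda> \<Longrightarrow> Y l \<in> S \<and> comod_iso ?d (?X l) (Y l)" by metis
  have "inj_on Y \<Lambda>"
  proof (rule inj_onI)
    fix l l' assume l: "l \<in> \<Lambda>" "l' \<in> \<Lambda>" and eq: "Y l = Y l'"
    have "comod_iso ?d (?X l) (Y l')" using Y[OF l(1)] unfolding eq by blast
    moreover have "comod_iso ?d (Y l') (?X l')" using Y[OF l(2)] comod_iso_sym by blast
    ultimately show "l = l'" using noniso[OF comod_iso_trans] l by blast
  qed
  then show False
    using Y S(1) inf inj_on_finite[of Y \<Lambda> S] by blast
qed

end

section \<open>The Kronecker, cyclic and D5~ families\<close>

context hopf_algebra
begin

text \<open>The multiples of g - h are the trivial skew-primitives. For g = h the condition says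
  that x is nonzero, so loops need no separate definition.\<close>

definition nontrivial_prim :: "('b \<Rightarrow> 'k) \<Rightarrow> ('b \<Rightarrow> 'k) \<Rightarrow> ('b \<Rightarrow> 'k) \<Rightarrow> bool" where
  "nontrivial_prim g h x \<longleftrightarrow> x \<in> Prim H g h \<and> (\<forall>c. x \<noteq> c \<cdot> (g - h))"

definition linked :: "('b \<Rightarrow> 'k) \<Rightarrow> ('b \<Rightarrow> 'k) \<Rightarrow> bool" where
  "linked g h \<longleftrightarrow> (\<exists>x. nontrivial_prim g h x)"

text \<open>The pencil x + l y with blocks of size one, parametrised by the points (1 : l) of the
  projective line. \<open>ind\<close> is independence modulo the trivial g - h; a morphism (A, D)
  then satisfies A = D and A l = D l'.\<close>

lemma kronecker_not_discrete:
  assumes inf: "infinite (UNIV :: 'k set)" and "grouplike H g" "grouplike H h"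
    and xy: "x \<in> Prim H g h" "y \<in> Prim H g h"
    and ind: "\<And>\<alpha> \<beta> c. \<alpha> \<cdot> x + \<beta> \<cdot> y = c \<cdot> (g - h) \<Longrightarrow> \<alpha> = 0 \<and> \<beta> = 0"
  shows "\<not> discrete_corep_type H"
proof (rule infinite_family_not_discrete[OF inf, of 1 "\<lambda>_. g" "\<lambda>_. h" "\<lambda>l _ _. x + l \<cdot> y"])
  fix l :: 'k and C :: "nat \<Rightarrow> nat \<Rightarrow> 'k" and i j :: nat
  assume C: "\<And>(i::nat) (j::nat). i < 1 \<Longrightarrow> j < 1 \<Longrightarrow> \<exists>c. (\<Sum>k<1::nat. C k j \<cdot> (x + l \<cdot> y)) = c \<cdot> (g - g)"
    and "i < 1" "j < 1"
  from C[of 0 0] have "C 0 0 \<cdot> x + (C 0 0 * l) \<cdot> y = 0 \<cdot> (g - h)"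
    by (simp add: fs.scale_right_distrib)
  from ind[OF this] show "C i j = 0" using \<open>i < 1\<close> \<open>j < 1\<close> by simp
next
  fix l l' :: 'k and A D :: "nat \<Rightarrow> nat \<Rightarrow> 'k"
  assume "\<And>(i::nat) (j::nat). i < 1 \<Longrightarrow> j < 1 \<Longrightarrow>
    \<exists>c. (\<Sum>k<1. A i k \<cdot> (x + l \<cdot> y)) - (\<Sum>k<1. D k j \<cdot> (x + l' \<cdot> y)) = c \<cdot> (g - h)"
  from this[of 0 0] obtain c where "A 0 0 \<cdot> (x + l \<cdot> y) - D 0 0 \<cdot> (x + l' \<cdot> y) = c \<cdot> (g - h)"
    by auto
  then have "(A 0 0 - D 0 0) \<cdot> x + (A 0 0 * l - D 0 0 * l') \<cdot> y = c \<cdot> (g - h)"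
    by (simp add: fs.scale_right_distrib fs.scale_left_diff_distrib algebra_simps)
  from ind[OF this] have "A 0 0 = D 0 0" "A 0 0 = 0 \<or> l = l'" by auto
  then show "\<exists>\<alpha>. (\<forall>i<1::nat. \<forall>j<1::nat. A i j = \<alpha> * mat_id i j \<and> D i j = \<alpha> * mat_id i j) \<and> (\<alpha> \<noteq> 0 \<longrightarrow> l = l')"
    by (intro exI[of _ "A 0 0"]) (auto simp: mat_id_def)
qed (use assms in \<open>auto intro: Prim_add Prim_smul\<close>)

text \<open>Every entry is a scalar weight times one chosen skew-primitive that depends only on the
  pair of grouplikes. A nonzero \<open>A i k\<close> forces g_i = g_k, and similarly for
  \<open>D\<close>, so the skew-primitive factors out of each sum. The comodule conditions become
  conditions on scalar matrices: \<open>inj\<close> says that the weight matrix has trivial kernel,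
  \<open>rigid\<close> that its morphisms are scalar.\<close>

lemma weighted_family_not_discrete:
  assumes inf: "infinite (\<Lambda> :: 'l set)" and "n > 0"
    and gh: "\<And>i. i < n \<Longrightarrow> grouplike H (g i)" "\<And>i. i < n \<Longrightarrow> grouplike H (h i)"
    and link: "\<And>l i j. i < n \<Longrightarrow> j < n \<Longrightarrow> w l i j \<noteq> (0::'k) \<Longrightarrow> linked (g i) (h j)"
    and inj: "\<And>l z k. l \<in> \<Lambda> \<Longrightarrow> (\<And>i. i < n \<Longrightarrow> (\<Sum>k<n. w l i k * z k) = 0) \<Longrightarrow> k < n \<Longrightarrow> z k = 0"
    and rigid: "\<And>l l' A D. l \<in> \<Lambda> \<Longrightarrow> l' \<in> \<Lambda> \<Longrightarrow>
        (\<And>i j. i < n \<Longrightarrow> j < n \<Longrightarrow> A i j \<noteq> 0 \<Longrightarrow> g i = g j) \<Longrightarrow>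
        (\<And>i j. i < n \<Longrightarrow> j < n \<Longrightarrow> D i j \<noteq> 0 \<Longrightarrow> h i = h j) \<Longrightarrow>
        (\<And>i j. i < n \<Longrightarrow> j < n \<Longrightarrow> (\<Sum>k<n. A i k * w l k j) = (\<Sum>k<n. w l' i k * D k j)) \<Longrightarrow>
        \<exists>\<alpha>. (\<forall>i<n. \<forall>j<n. A i j = \<alpha> * mat_id i j \<and> D i j = \<alpha> * mat_id i j) \<and> (\<alpha> \<noteq> 0 \<longrightarrow> l = l')"
  shows "\<not> discrete_corep_type H"
proof -
  \<comment> \<open>One fixed representative for each arrow, and 0 where there is none, so that
    every entry lies in the right space of skew-primitives.\<close>
  define \<mu> where "\<mu> a b = (if linked a b then SOME x. nontrivial_prim a b x else 0)" for a b
  have \<mu>: "nontrivial_prim a b (\<mu> a b)" if "linked a b" for a b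
    using that unfolding \<mu>_def linked_def by (simp add: someI_ex)
  have \<mu>0: "\<mu> a b = 0" if "\<not> linked a b" for a b using that by (simp add: \<mu>_def)
  have \<mu>_Prim: "\<mu> a b \<in> Prim H a b" for a b
    using \<mu> \<mu>0 Prim_0 unfolding nontrivial_prim_def by metis
  have scalar0: "s = 0" if "s \<cdot> \<mu> a b = c \<cdot> (a - b)" "linked a b" for s c a b
  proof (rule ccontr)
    assume "s \<noteq> 0"
    then have "\<mu> a b = (1 / s) \<cdot> (s \<cdot> \<mu> a b)" by simp
    then have "\<mu> a b = (c / s) \<cdot> (a - b)" unfolding that(1) by simp
    then show False using \<mu>[OF that(2)] by (auto simp: nontrivial_prim_def)
  qed
  show ?thesis
  proof (rule infinite_family_not_discrete[OF inf \<open>n > 0\<close>, of g h "\<lambda>l i j. w l i j \<cdot> \<mu> (g i) (h j)"])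
    fix l C i j
    assume l: "l \<in> \<Lambda>" and C: "\<And>i j. i < n \<Longrightarrow> j < n \<Longrightarrow> C i j \<noteq> 0 \<Longrightarrow> g j = h i"
      and eq: "\<And>i j. i < n \<Longrightarrow> j < n \<Longrightarrow> \<exists>c. (\<Sum>k<n. C k j \<cdot> w l i k \<cdot> \<mu> (g i) (h k)) = c \<cdot> (g i - g j)"
      and ij: "i < n" "j < n"
    \<comment> \<open>A nonzero \<open>C k j\<close> forces h_k = g_j, so all terms of row
      \<open>a\<close> involve the same skew-primitive from g_a to g_j. Column \<open>j\<close> of
      \<open>C\<close> therefore lies in the kernel of the weight matrix.\<close>
    have "(\<Sum>k<n. w l a k * C k j) = 0" if a: "a < n" for a
    proof (cases "linked (g a) (g j)")
      case True
      obtain c where c: "(\<Sum>k<n. C k j \<cdot> w l a k \<cdot> \<mu> (g a) (h k)) = c \<cdot> (g a - g j)"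
        using eq[OF a ij(2)] by blast
      have "C k j \<cdot> w l a k \<cdot> \<mu> (g a) (h k) = (w l a k * C k j) \<cdot> \<mu> (g a) (g j)" if "k < n" for k
        using C[OF that ij(2)] by (cases "C k j = 0") (simp_all add: mult.commute)
      then have "(\<Sum>k<n. w l a k * C k j) \<cdot> \<mu> (g a) (g j) = c \<cdot> (g a - g j)"
        unfolding fs.scale_sum_left c[symmetric] by simp
      then show ?thesis using scalar0 True by blast
    next
      case False
      have "w l a k * C k j = 0" if "k < n" for k
        using C[OF that ij(2)] link[OF a that] False by (metis mult_eq_0_iff)
      then show ?thesis by (intro sum.neutral) blast
    qed
    then show "C i j = 0" using inj[OF l, of "\<lambda>k. C k j" i] ij by blast
  next
    fix l l' A D
    assume l: "l \<in> \<Lambda>" "l' \<in> \<Lambda>"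
      and A: "\<And>i j. i < n \<Longrightarrow> j < n \<Longrightarrow> A i j \<noteq> 0 \<Longrightarrow> g i = g j"
      and D: "\<And>i j. i < n \<Longrightarrow> j < n \<Longrightarrow> D i j \<noteq> 0 \<Longrightarrow> h i = h j"
      and eq: "\<And>i j. i < n \<Longrightarrow> j < n \<Longrightarrow> \<exists>c. (\<Sum>k<n. A i k \<cdot> w l k j \<cdot> \<mu> (g k) (h j))
           - (\<Sum>k<n. D k j \<cdot> w l' i k \<cdot> \<mu> (g i) (h k)) = c \<cdot> (g i - h j)"
    have "(\<Sum>k<n. A i k * w l k j) = (\<Sum>k<n. w l' i k * D k j)" if ij: "i < n" "j < n" for i j
    proof -
      have 1: "A i k \<cdot> w l k j \<cdot> \<mu> (g k) (h j) = (A i k * w l k j) \<cdot> \<mu> (g i) (h j)" if "k < n" for k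
        using A[OF ij(1) that] by (cases "A i k = 0") simp_all
      have 2: "D k j \<cdot> w l' i k \<cdot> \<mu> (g i) (h k) = (w l' i k * D k j) \<cdot> \<mu> (g i) (h j)" if "k < n" for k
        using D[OF that ij(2)] by (cases "D k j = 0") (simp_all add: mult.commute)
      show ?thesis
      proof (cases "linked (g i) (h j)")
        case True
        obtain c where "(\<Sum>k<n. A i k \<cdot> w l k j \<cdot> \<mu> (g k) (h j))
           - (\<Sum>k<n. D k j \<cdot> w l' i k \<cdot> \<mu> (g i) (h k)) = c \<cdot> (g i - h j)"
          using eq[OF ij] by blast
        moreover have "(\<Sum>k<n. A i k \<cdot> w l k j \<cdot> \<mu> (g k) (h j)) = (\<Sum>k<n. A i k * w l k j) \<cdot> \<mu> (g i) (h j)"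
          unfolding fs.scale_sum_left using 1 by (intro sum.cong) auto
        moreover have "(\<Sum>k<n. D k j \<cdot> w l' i k \<cdot> \<mu> (g i) (h k)) = (\<Sum>k<n. w l' i k * D k j) \<cdot> \<mu> (g i) (h j)"
          unfolding fs.scale_sum_left using 2 by (intro sum.cong) auto
        ultimately have "((\<Sum>k<n. A i k * w l k j) - (\<Sum>k<n. w l' i k * D k j)) \<cdot> \<mu> (g i) (h j) = c \<cdot> (g i - h j)"
          by (simp only: fs.scale_left_diff_distrib)
        then show ?thesis using scalar0 True by (metis right_minus_eq)
      next
        case False
        have "A i k * w l k j = 0" "w l' i k * D k j = 0" if "k < n" for k
          using A[OF ij(1) that] link[OF that ij(2)] D[OF that ij(2)] link[OF ij(1) that] False
          by (metis mult_eq_0_iff)+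
        then have "(\<Sum>k<n. A i k * w l k j) = 0" "(\<Sum>k<n. w l' i k * D k j) = 0"
          by (intro sum.neutral; blast)+
        then show ?thesis by simp
      qed
    qed
    from rigid[OF l A D this]
    show "\<exists>\<alpha>. (\<forall>i<n. \<forall>j<n. A i j = \<alpha> * mat_id i j \<and> D i j = \<alpha> * mat_id i j) \<and> (\<alpha> \<noteq> 0 \<longrightarrow> l = l')" .
  qed (use gh \<mu>_Prim in \<open>auto intro: Prim_smul\<close>)
qed

text \<open>The family of type \<open>A~\<close> on a cycle in the separated quiver, with the parameter on one arrow;
  its weight matrix is invertible except for parameter \<open>1\<close>.\<close>
lemma cycle_not_discrete:
  fixes g h :: "nat \<Rightarrow> 'b \<Rightarrow> 'k"
  assumes inf: "infinite (UNIV :: 'k set)" and n: "n \<ge> 2"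
    and gh: "\<And>i. i < n \<Longrightarrow> grouplike H (g i)" "\<And>i. i < n \<Longrightarrow> grouplike H (h i)"
    and inj: "inj_on g {..<n}" "inj_on h {..<n}"
    and link: "\<And>i. i < n \<Longrightarrow> linked (g i) (h i)" "\<And>i. i < n \<Longrightarrow> linked (g i) (h (Suc i mod n))"
  shows "\<not> discrete_corep_type H"
proof -
  \<comment> \<open>The identity minus a cyclic shift whose wrap-around entry is twisted by l. The
    signs make a kernel vector constant along the cycle; closing up gives z_0 = l z_0, hence the
    excluded value 1.\<close>
  define w :: "'k \<Rightarrow> nat \<Rightarrow> nat \<Rightarrow> 'k" where
    "w l i j = (if j = i then 1 else if j = Suc i mod n then (if Suc i = n then - l else - 1) else 0)" for l i j
  have neq: "Suc i mod n \<noteq> i" "Suc i mod n < n" if "i < n" for i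
    using that n by (auto simp: mod_Suc)
  show ?thesis
  proof (rule weighted_family_not_discrete[of "- {1}" n g h w])
    show "infinite (- {1 :: 'k})" using inf by (simp add: Compl_eq_Diff_UNIV)
    show "n > 0" using n by simp
  next
    fix l i j assume "i < n" "w l i j \<noteq> 0"
    then show "linked (g i) (h j)" using link by (auto simp: w_def split: if_splits)
  next
    fix l :: 'k and z k
    assume "l \<in> - {1}" and z: "\<And>i. i < n \<Longrightarrow> (\<Sum>k<n. w l i k * z k) = 0" and "k < n"
    have e: "z i = (if Suc i = n then l else 1) * z (Suc i mod n)" if "i < n" for i
    proof -
      have "(\<Sum>k<n. w l i k * z k) = w l i i * z i + w l i (Suc i mod n) * z (Suc i mod n)"
        by (rule sum_eq_pair) (use neq[OF that] that in \<open>auto simp: w_def\<close>)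
      then show ?thesis using z[OF that] neq[OF that] by (auto simp: w_def split: if_splits)
    qed
    have c: "i < n \<Longrightarrow> z i = z 0" for i
    proof (induction i)
      case (Suc i)
      then show ?case using e[of i] by simp
    qed simp
    have "z 0 = l * z 0" using e[of "n - 1"] c[of "n - 1"] n by simp
    then have "(1 - l) * z 0 = 0" by (simp add: left_diff_distrib)
    then have "z 0 = 0" using \<open>l \<in> - {1}\<close> by simp
    then show "z k = 0" using c[OF \<open>k < n\<close>] by simp
  next
    fix l l' :: 'k and A D :: "nat \<Rightarrow> nat \<Rightarrow> 'k"
    assume A: "\<And>i j. i < n \<Longrightarrow> j < n \<Longrightarrow> A i j \<noteq> 0 \<Longrightarrow> g i = g j"
      and D: "\<And>i j. i < n \<Longrightarrow> j < n \<Longrightarrow> D i j \<noteq> 0 \<Longrightarrow> h i = h j"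
      and eq: "\<And>i j. i < n \<Longrightarrow> j < n \<Longrightarrow> (\<Sum>k<n. A i k * w l k j) = (\<Sum>k<n. w l' i k * D k j)"
    \<comment> \<open>Distinct sources and distinct sinks make both blocks of a morphism
      diagonal.\<close>
    have A0: "A i j = 0" and D0: "D i j = 0" if "i < n" "j < n" "i \<noteq> j" for i j
      using A[OF that(1,2)] D[OF that(1,2)] inj that by (auto simp: inj_on_def)
    have e: "A i i * w l i j = w l' i j * D j j" if "i < n" "j < n" for i j
    proof -
      have "(\<Sum>k<n. A i k * w l k j) = A i i * w l i j"
        by (rule sum_eq_single) (use that A0 in auto)
      moreover have "(\<Sum>k<n. w l' i k * D k j) = w l' i j * D j j"
        by (rule sum_eq_single) (use that D0 in auto)
      ultimately show ?thesis using eq[OF that] by simp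
    qed
    have AD: "A i i = D i i" if "i < n" for i
      using e[OF that that] by (simp add: w_def)
    have c: "i < n \<Longrightarrow> A i i = A 0 0" for i
    proof (induction i)
      case (Suc i)
      then show ?case using e[of i "Suc i"] AD[of "Suc i"] by (simp add: w_def)
    qed simp
    \<comment> \<open>All other arrows carry equal weights on both sides and transport one scalar
      along the cycle; only the wrap-around arrow compares the parameters.\<close>
    have "A (n - 1) (n - 1) * l = l' * D 0 0"
      using e[of "n - 1" 0] n by (simp add: w_def)
    then have "A 0 0 * (l - l') = 0"
      using c[of "n - 1"] AD[of 0] n by (simp add: right_diff_distrib mult.commute)
    moreover have "A i j = A 0 0 * mat_id i j \<and> D i j = A 0 0 * mat_id i j" if "i < n" "j < n" for i j
      using c[OF that(1)] AD[OF that(1)] A0[OF that] D0[OF that] by (cases "i = j") (simp_all add: mat_id_def)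
    moreover have "A 0 0 \<noteq> 0 \<longrightarrow> l = l'" using calculation(1) by auto
    ultimately show "\<exists>\<alpha>. (\<forall>i<n. \<forall>j<n. A i j = \<alpha> * mat_id i j \<and> D i j = \<alpha> * mat_id i j) \<and> (\<alpha> \<noteq> 0 \<longrightarrow> l = l')"
      by blast
  qed (use gh in auto)
qed

text \<open>The family of type \<open>D~\<^sub>5\<close> of dimension 2 at \<open>g0\<close> and \<open>h0\<close>: four lines in a plane, the parameter
  being their cross-ratio.\<close>
lemma D5_not_discrete:
  assumes inf: "infinite (UNIV :: 'k set)"
    and gh: "grouplike H g0" "grouplike H g1" "grouplike H g2" "grouplike H h0" "grouplike H h1" "grouplike H h2"
    and dist: "g0 \<noteq> g1" "g0 \<noteq> g2" "g1 \<noteq> g2" "h0 \<noteq> h1" "h0 \<noteq> h2" "h1 \<noteq> h2"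
    and link: "linked g0 h0" "linked g0 h1" "linked g0 h2" "linked g1 h0" "linked g2 h0"
  shows "\<not> discrete_corep_type H"
proof -
  \<comment> \<open>Repeating g0, and likewise h0, encodes dimension 2 at these vertices.\<close>
  define g where "g = (!) [g0, g0, g1, g2]"
  define h where "h = (!) [h0, h0, h1, h2]"
  \<comment> \<open>The identity block identifies the planes at g0 and h0. The columns (1, 0), (0,
    1) belong to h1, h2 and the rows (1, 1), (1, l) to g1, g2; at l = 1 these rows coincide and the
    matrix is singular.\<close>
  define w :: "'k \<Rightarrow> nat \<Rightarrow> nat \<Rightarrow> 'k" where
    "w l i j = [[1, 0, 1, 0], [0, 1, 0, 1], [1, 1, 0, 0], [1, l, 0, 0]] ! i ! j" for l i j
  have g: "g 0 = g0" "g (Suc 0) = g0" "g 2 = g1" "g 3 = g2"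
    and h: "h 0 = h0" "h (Suc 0) = h0" "h 2 = h1" "h 3 = h2" by (simp_all add: g_def h_def)
  have w: "w l 0 0 = 1" "w l 0 (Suc 0) = 0" "w l 0 2 = 1" "w l 0 3 = 0"
    "w l (Suc 0) 0 = 0" "w l (Suc 0) (Suc 0) = 1" "w l (Suc 0) 2 = 0" "w l (Suc 0) 3 = 1"
    "w l 2 0 = 1" "w l 2 (Suc 0) = 1" "w l 2 2 = 0" "w l 2 3 = 0"
    "w l 3 0 = 1" "w l 3 (Suc 0) = l" "w l 3 2 = 0" "w l 3 3 = 0" for l
    by (simp_all add: w_def)
  have lt4: "(i < 4) = (i = 0 \<or> i = Suc 0 \<or> i = 2 \<or> i = 3)" for i :: nat by auto
  have sum4: "(\<Sum>k<4. f k) = f 0 + f (Suc 0) + f 2 + f 3" for f :: "nat \<Rightarrow> 'k"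
    by (simp add: eval_nat_numeral)
  show ?thesis
  proof (rule weighted_family_not_discrete[of "- {1}" 4 g h w])
    show "infinite (- {1 :: 'k})" using inf by (simp add: Compl_eq_Diff_UNIV)
  next
    fix l i j assume "i < 4" "j < 4" "w l i j \<noteq> 0"
    then show "linked (g i) (h j)" using link by (auto simp: lt4 w g h)
  next
    fix l :: 'k and z and k :: nat
    assume l: "l \<in> - {1}" and z: "\<And>i. i < 4 \<Longrightarrow> (\<Sum>k<4. w l i k * z k) = 0" and "k < 4"
    have 0: "z 0 + z 2 = 0" and 1: "z (Suc 0) + z 3 = 0" and 2: "z 0 + z (Suc 0) = 0"
      and 3: "z 0 + l * z (Suc 0) = 0"
      using z[of 0] z[of "Suc 0"] z[of 2] z[of 3] by (simp_all add: sum4 w)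
    have "(l - 1) * z (Suc 0) = 0" using 2 3 by (simp add: left_diff_distrib add_eq_0_iff2)
    then have "z (Suc 0) = 0" using l by simp
    then show "z k = 0" using 0 1 2 \<open>k < 4\<close> by (auto simp: lt4)
  next
    fix l l' :: 'k and A D :: "nat \<Rightarrow> nat \<Rightarrow> 'k"
    assume A: "\<And>i j. i < 4 \<Longrightarrow> j < 4 \<Longrightarrow> A i j \<noteq> 0 \<Longrightarrow> g i = g j"
      and D: "\<And>i j. i < 4 \<Longrightarrow> j < 4 \<Longrightarrow> D i j \<noteq> 0 \<Longrightarrow> h i = h j"
      and eq: "\<And>i j. i < 4 \<Longrightarrow> j < 4 \<Longrightarrow> (\<Sum>k<4. A i k * w l k j) = (\<Sum>k<4. w l' i k * D k j)"
    have A0: "A i j = 0" if "i < 4" "j < 4" "g i \<noteq> g j" for i j using A that by blast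
    have D0: "D i j = 0" if "i < 4" "j < 4" "h i \<noteq> h j" for i j using D that by blast
    have A0s: "A 0 2 = 0" "A 0 3 = 0" "A (Suc 0) 2 = 0" "A (Suc 0) 3 = 0" "A 2 0 = 0" "A 2 (Suc 0) = 0"
        "A 2 3 = 0" "A 3 0 = 0" "A 3 (Suc 0) = 0" "A 3 2 = 0"
      by (rule A0; use dist in \<open>simp add: g\<close>)+
    have D0s: "D 0 2 = 0" "D 0 3 = 0" "D (Suc 0) 2 = 0" "D (Suc 0) 3 = 0" "D 2 0 = 0" "D 2 (Suc 0) = 0"
        "D 2 3 = 0" "D 3 0 = 0" "D 3 (Suc 0) = 0" "D 3 2 = 0"
      by (rule D0; use dist in \<open>simp add: h\<close>)+
    \<comment> \<open>The identity block makes \<open>A\<close> and \<open>D\<close> agree on the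
      plane, and the columns of h1 and h2 make them diagonal there.\<close>
    have r0: "A 0 0 = D 0 0" "A 0 (Suc 0) = D 0 (Suc 0)" "A 0 0 = D 2 2" "A 0 (Suc 0) = 0"
      using eq[of 0 0] eq[of 0 "Suc 0"] eq[of 0 2] eq[of 0 3] by (simp_all add: sum4 w A0s D0s)
    have r1: "A (Suc 0) 0 = D (Suc 0) 0" "A (Suc 0) (Suc 0) = D (Suc 0) (Suc 0)" "A (Suc 0) 0 = 0"
        "A (Suc 0) (Suc 0) = D 3 3"
      using eq[of "Suc 0" 0] eq[of "Suc 0" "Suc 0"] eq[of "Suc 0" 2] eq[of "Suc 0" 3]
      by (simp_all add: sum4 w A0s D0s)
    \<comment> \<open>The row (1, 1) equates the two diagonal entries; the row (1, l) then compares
      the parameters.\<close>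
    have r2: "A 2 2 = D 0 0" "A 2 2 = D (Suc 0) (Suc 0)"
      using eq[of 2 0] eq[of 2 "Suc 0"] r0 r1 by (simp_all add: sum4 w A0s D0s)
    have r3: "A 3 3 = D 0 0" "A 3 3 * l = l' * D (Suc 0) (Suc 0)"
      using eq[of 3 0] eq[of 3 "Suc 0"] r0 r1 by (simp_all add: sum4 w A0s D0s)
    have "A 0 0 * (l - l') = 0"
      using r0 r2 r3 by (simp add: right_diff_distrib mult.commute)
    then show "\<exists>\<alpha>. (\<forall>i<4. \<forall>j<4. A i j = \<alpha> * mat_id i j \<and> D i j = \<alpha> * mat_id i j) \<and> (\<alpha> \<noteq> 0 \<longrightarrow> l = l')"
      using A0s D0s r0 r1 r2 r3 by (intro exI[of _ "A 0 0"]) (auto simp: mat_id_def lt4)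
  qed (use gh in \<open>auto simp: lt4 g h\<close>)
qed

end

section \<open>Arrows of the Ext-quiver\<close>

lemma lspan_eq_span: "lspan A = fs.span A"
proof
  show "lspan A \<subseteq> fs.span A"
  proof
    fix x assume "x \<in> lspan A"
    then obtain n :: nat and c v where x: "x = (\<lambda>z. \<Sum>i<n. c i * v i z)" "\<forall>i<n. v i \<in> A"
      unfolding lspan_def by blast
    have "x = (\<Sum>i<n. c i \<cdot> v i)" unfolding x(1) by (simp add: fun_eq_iff)
    also have "\<dots> \<in> fs.span A" using x(2) by (intro fs.span_sum fs.span_scale fs.span_base) auto
    finally show "x \<in> fs.span A" .
  qed
  show "fs.span A \<subseteq> lspan A"
  proof
    fix x assume "x \<in> fs.span A"
    then obtain t r where t: "finite t" "t \<subseteq> A" "x = (\<Sum>a\<in>t. r a \<cdot> a)"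
      unfolding fs.span_explicit by blast
    obtain f where f: "bij_betw f {..<card t} t"
      using ex_bij_betw_nat_finite[OF t(1)] by (auto simp: atLeast0LessThan)
    have "x = (\<Sum>i<card t. r (f i) \<cdot> f i)"
      unfolding t(3) by (rule sum.reindex_bij_betw[OF f, symmetric])
    then have "x = (\<lambda>z. \<Sum>i<card t. r (f i) * f i z)" by (simp add: fun_eq_iff)
    moreover have "\<forall>i<card t. f i \<in> A" using f t(2) by (auto simp: bij_betw_def)
    ultimately show "x \<in> lspan A"
      unfolding lspan_def mem_Collect_eq
      by (intro exI[of _ "card t"] exI[of _ "\<lambda>i. r (f i)"] exI[of _ f] conjI)
  qed
qed

lemma subspace_iff: "subspace S \<longleftrightarrow> fs.subspace S \<and> (\<forall>x\<in>S. fin x)"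
  by (auto simp: subspace_def fs.subspace_def plus_fun_def smul_def zero_fun_def)

lemma fin_span: "(\<And>x. x \<in> A \<Longrightarrow> fin x) \<Longrightarrow> x \<in> fs.span A \<Longrightarrow> fin x"
proof -
  assume A: "\<And>x. x \<in> A \<Longrightarrow> fin x" and x: "x \<in> fs.span A"
  have "fs.subspace {x. fin x}" by (simp add: fs.subspace_def)
  then have "fs.span A \<subseteq> {x. fin x}" using A by (intro fs.span_minimal) auto
  then show "fin x" using x by blast
qed

text \<open>A basis is a spanning family of length \<open>card A\<close>, and by the exchange bound
  none is shorter; \<open>fdim\<close> asks for the least length.\<close>

lemma fdim_span:
  assumes "finite A" "fs.independent A"
  shows "fin_dim (fs.span A)" "fdim (fs.span A) = card A"
proof -
  obtain f where f: "bij_betw f {..<card A} A"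
    using ex_bij_betw_nat_finite[OF assms(1)] by (auto simp: atLeast0LessThan)
  then have 1: "(\<forall>i<card A. f i \<in> fs.span A) \<and> lspan (f ` {..<card A}) = fs.span A"
    unfolding lspan_eq_span by (auto simp: bij_betw_def intro: fs.span_base)
  then show "fin_dim (fs.span A)" unfolding fin_dim_def by blast
  show "fdim (fs.span A) = card A"
    unfolding fdim_def
  proof (rule Least_equality)
    show "\<exists>v. (\<forall>i<card A. v i \<in> fs.span A) \<and> lspan (v ` {..<card A}) = fs.span A" using 1 by blast
    fix m :: nat assume "\<exists>v. (\<forall>i<m. v i \<in> fs.span A) \<and> lspan (v ` {..<m}) = fs.span A"
    then obtain v where "fs.span (v ` {..<m}) = fs.span A" unfolding lspan_eq_span by blast
    then have "A \<subseteq> fs.span (v ` {..<m})" using fs.span_superset by blast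
    then have "card A \<le> card (v ` {..<m})"
      using fs.independent_span_bound[of "v ` {..<m}" A] assms(2) by simp
    also have "\<dots> \<le> m" using card_image_le[of "{..<m}" v] by simp
    finally show "card A \<le> m" .
  qed
qed

text \<open>A basis of S together with y is independent, so values on it can be prescribed. The
  functional is defined on all functions and can thus be applied to every column of a
  tensor.\<close>

lemma exists_functional:
  fixes y :: "'c \<Rightarrow> 'k::field"
  assumes "fs.subspace S" "y \<notin> S"
  obtains \<phi> where "Vector_Spaces.linear smul (*) \<phi>" "\<And>x. x \<in> S \<Longrightarrow> \<phi> x = 0" "\<phi> y = (1::'k)"
proof -
  obtain A where A: "A \<subseteq> S" "fs.independent A" "S \<subseteq> fs.span A"
    using fs.maximal_independent_subset by blast
  have S: "fs.span A = S" using A assms(1) by (simp add: fs.span_minimal subset_antisym)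
  have "fs.independent (insert y A)"
    using A(2) assms(2) S by (simp add: fs.independent_insertI)
  then obtain \<phi> where \<phi>: "Vector_Spaces.linear smul (*) \<phi>"
      "\<forall>x\<in>insert y A. \<phi> x = (if x = y then 1 else 0)"
    using fsd.linear_independent_extend[of "insert y A" "\<lambda>x. if x = y then 1 else 0"] by blast
  have "y \<notin> A" using A(1) assms(2) by blast
  then have "\<phi> x = 0" if "x \<in> A" for x
    using \<phi>(2) that by (metis insertI2)
  then have "\<phi> x = 0" if "x \<in> S" for x
    using fsd.linear_eq_0_on_span[OF \<phi>(1), of A x] that S by blast
  then show thesis using that \<phi> by auto
qed

text \<open>This is \<phi> tensor id, the contraction of the first tensor factor.\<close>

definition slice :: "(('b \<Rightarrow> 'k::field) \<Rightarrow> 'k) \<Rightarrow> ('b \<times> 'b \<Rightarrow> 'k) \<Rightarrow> 'b \<Rightarrow> 'k" where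
  "slice \<phi> t = (\<lambda>j. \<phi> (\<lambda>i. t (i, j)))"

lemma slice_props:
  assumes "Vector_Spaces.linear smul (*) \<phi>"
  shows "slice \<phi> (s + t) = slice \<phi> s + slice \<phi> t" "slice \<phi> (c \<cdot> t) = c \<cdot> slice \<phi> t"
    "slice \<phi> (tens x y) = \<phi> x \<cdot> y"
proof -
  interpret \<phi>: Vector_Spaces.linear smul "(*)" \<phi> by fact
  have "(\<lambda>i. (s + t) (i, j)) = (\<lambda>i. s (i, j)) + (\<lambda>i. t (i, j))" for j by (simp add: fun_eq_iff)
  then show "slice \<phi> (s + t) = slice \<phi> s + slice \<phi> t"
    unfolding slice_def by (intro ext) (simp only: plus_fun_apply \<phi>.add)
  have "(\<lambda>i. (c \<cdot> t) (i, j)) = c \<cdot> (\<lambda>i. t (i, j))" for j by (simp add: fun_eq_iff)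
  then show "slice \<phi> (c \<cdot> t) = c \<cdot> slice \<phi> t"
    unfolding slice_def by (intro ext) (simp only: smul_apply \<phi>.scale)
  have "(\<lambda>i. tens x y (i, j)) = y j \<cdot> x" for j by (simp add: fun_eq_iff tens_apply)
  then show "slice \<phi> (tens x y) = \<phi> x \<cdot> y"
    unfolding slice_def by (intro ext) (simp only: smul_apply \<phi>.scale mult.commute)
qed

lemma slice_tensor_sp:
  assumes "Vector_Spaces.linear smul (*) \<phi>" "\<And>x. x \<in> S \<Longrightarrow> \<phi> x = 0" "t \<in> tensor_sp S T"
  shows "slice \<phi> t = 0"
  using assms(3) unfolding tensor_sp_def lspan_eq_span
proof (rule fs.span_induct)
  have "slice \<phi> 0 = 0" using slice_props(2)[OF assms(1), of 0 0] by simp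
  then show "fs.subspace {t. slice \<phi> t = 0}"
    by (auto simp: fs.subspace_def slice_props[OF assms(1)])
qed (auto simp: slice_props[OF assms(1)] assms(2))

lemma tens_tensor_sp: "x \<in> S \<Longrightarrow> y \<in> T \<Longrightarrow> tens x y \<in> tensor_sp S T"
  unfolding tensor_sp_def lspan_eq_span by (rule fs.span_base) blast

lemma tensor_sp_mono: "S \<subseteq> S' \<Longrightarrow> T \<subseteq> T' \<Longrightarrow> tensor_sp S T \<subseteq> tensor_sp S' T'"
  unfolding tensor_sp_def lspan_eq_span by (rule fs.span_mono) blast

lemma tensor_sp_add: "s \<in> tensor_sp S T \<Longrightarrow> t \<in> tensor_sp S T \<Longrightarrow> s + t \<in> tensor_sp S T"
  and tensor_sp_smul: "t \<in> tensor_sp S T \<Longrightarrow> c \<cdot> t \<in> tensor_sp S T"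
  unfolding tensor_sp_def lspan_eq_span by (auto intro: fs.span_add fs.span_scale)

section \<open>Subcoalgebras obtained by adjoining one element\<close>

context hopf_algebra
begin

lemma insert_decompose:
  assumes "fs.subspace C" "x \<in> fs.span (insert y C)"
  obtains b c where "b \<in> C" "x = b + c \<cdot> y"
proof -
  obtain c where "x - c \<cdot> y \<in> C"
    using assms fs.span_breakdown_eq[of x y C] by (auto simp: fs.span_eq_iff[THEN iffD2])
  then show thesis using that[of "x - c \<cdot> y" c] by simp
qed

lemma subcoalgebra_insert:
  assumes C: "subcoalgebra H C" and "fin y"
    and y: "hDelta H y \<in> tensor_sp (fs.span (insert y C)) (fs.span (insert y C))"
  shows "subcoalgebra H (fs.span (insert y C))"
proof -
  let ?D = "fs.span (insert y C)"
  have sub: "fs.subspace C" "\<And>x. x \<in> C \<Longrightarrow> fin x" using C by (auto simp: subcoalgebra_def subspace_iff)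
  have CD: "C \<subseteq> ?D" using fs.span_superset[of "insert y C"] by blast
  have "hDelta H x \<in> tensor_sp ?D ?D" if x: "x \<in> ?D" for x
  proof -
    obtain b c where bc: "b \<in> C" "x = b + c \<cdot> y" using insert_decompose[OF sub(1) x] .
    have "hDelta H x = hDelta H b + c \<cdot> hDelta H y"
      using bc sub(2) \<open>fin y\<close> by (simp add: flinear_add[OF flinear_hDelta] flinear_smul[OF flinear_hDelta])
    moreover have "hDelta H b \<in> tensor_sp ?D ?D"
      using C bc(1) tensor_sp_mono[OF CD CD] by (auto simp: subcoalgebra_def)
    ultimately show ?thesis using y by (simp add: tensor_sp_add tensor_sp_smul)
  qed
  then show ?thesis
    unfolding subcoalgebra_def subspace_iff
    using fin_span[of "insert y C"] sub(2) \<open>fin y\<close> by auto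
qed

text \<open>Contracting the first tensor factor with a functional that vanishes on \<open>C\<close> sends \<open>\<Delta>(k)\<close>
  both to a multiple of \<open>k\<close> and to a multiple of \<open>h\<close>.\<close>
lemma grouplike_in_insert:
  assumes C: "subcoalgebra H C" and "fin y"
    and y: "\<And>\<phi>. Vector_Spaces.linear smul (*) \<phi> \<Longrightarrow> (\<And>x. x \<in> C \<Longrightarrow> \<phi> x = 0) \<Longrightarrow>
        slice \<phi> (hDelta H y) = \<phi> y \<cdot> h"
    and k: "grouplike H k" "k \<in> fs.span (insert y C)"
  shows "k \<in> C \<or> k = h"
proof (rule disjCI)
  assume "k \<noteq> h"
  show "k \<in> C"
  proof (rule ccontr)
    assume "k \<notin> C"
    have sub: "fs.subspace C" "\<And>x. x \<in> C \<Longrightarrow> fin x" using C by (auto simp: subcoalgebra_def subspace_iff)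
    obtain b c where bc: "b \<in> C" "k = b + c \<cdot> y" using insert_decompose[OF sub(1) k(2)] .
    have "c \<noteq> 0" using \<open>k \<notin> C\<close> bc by auto
    have "y \<notin> C"
      using \<open>k \<notin> C\<close> bc fs.subspace_add[OF sub(1)] fs.subspace_scale[OF sub(1)] by blast
    then obtain \<phi> where \<phi>: "Vector_Spaces.linear smul (*) \<phi>" "\<And>x. x \<in> C \<Longrightarrow> \<phi> x = 0" "\<phi> y = 1"
      using exists_functional[OF sub(1)] by blast
    interpret \<phi>: Vector_Spaces.linear smul "(*)" \<phi> by fact
    have "\<phi> k = c" unfolding bc(2) \<phi>.add \<phi>.scale by (simp add: \<phi> bc)
    have 1: "slice \<phi> (hDelta H k) = c \<cdot> k"
      unfolding grouplikeD(2)[OF k(1)] slice_props[OF \<phi>(1)] \<open>\<phi> k = c\<close> ..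
    have 2: "hDelta H k = hDelta H b + c \<cdot> hDelta H y"
      using bc sub(2) \<open>fin y\<close> by (simp add: flinear_add[OF flinear_hDelta] flinear_smul[OF flinear_hDelta])
    have 3: "slice \<phi> (hDelta H b) = 0"
      using C bc(1) by (intro slice_tensor_sp[OF \<phi>(1,2)]) (auto simp: subcoalgebra_def)
    have 4: "slice \<phi> (hDelta H y) = h"
    proof -
      have "slice \<phi> (hDelta H y) = \<phi> y \<cdot> h" by (intro y \<phi>)
      then show ?thesis unfolding \<phi>(3) fs.scale_one .
    qed
    have "c \<cdot> k = c \<cdot> h"
      using 1 unfolding 2 slice_props[OF \<phi>(1)] 3 4 add_0 by (rule sym)
    then show False using \<open>c \<noteq> 0\<close> \<open>k \<noteq> h\<close> fs.scale_cancel_left by metis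
  qed
qed

text \<open>The contraction of h tensor h is \<phi>(h) h, the form that
  \<open>grouplike_in_insert\<close> requires.\<close>

lemma subcoalgebra_insert_grouplike:
  assumes "subcoalgebra H C" "grouplike H h"
  shows "subcoalgebra H (fs.span (insert h C))" (is "subcoalgebra H ?D")
    and "GL H (fs.span (insert h C)) \<subseteq> insert h (GL H C)"
proof -
  note h = grouplikeD[OF assms(2)]
  have "h \<in> ?D" by (simp add: fs.span_base)
  then show "subcoalgebra H ?D"
    using assms h by (intro subcoalgebra_insert) (simp_all add: tens_tensor_sp)
  show "GL H ?D \<subseteq> insert h (GL H C)"
    using grouplike_in_insert[OF assms(1) h(1), of h] slice_props h(2) unfolding GL_def by fastforce
qed

text \<open>A functional vanishing on C kills g, so contracting g tensor x + x tensor h leaves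
  \<phi>(x) h. Hence adjoining x creates no grouplike element other than possibly h.\<close>

lemma subcoalgebra_insert_Prim:
  assumes "subcoalgebra H C" "g \<in> C" "h \<in> C" "x \<in> Prim H g h"
  shows "subcoalgebra H (fs.span (insert x C))" (is "subcoalgebra H ?D")
    and "GL H (fs.span (insert x C)) \<subseteq> insert h (GL H C)"
proof -
  note x = PrimD[OF assms(4)]
  have "x \<in> ?D" "g \<in> ?D" "h \<in> ?D" using assms(2,3) by (simp_all add: fs.span_base)
  then show "subcoalgebra H ?D"
    using assms(1) x by (intro subcoalgebra_insert) (simp_all add: tens_tensor_sp tensor_sp_add)
  have "slice \<phi> (hDelta H x) = \<phi> x \<cdot> h"
    if "Vector_Spaces.linear smul (*) \<phi>" "\<And>x. x \<in> C \<Longrightarrow> \<phi> x = 0" for \<phi>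
    using that(2)[OF assms(2)] by (simp add: x(2) slice_props[OF that(1)])
  then show "GL H ?D \<subseteq> insert h (GL H C)"
    using grouplike_in_insert[OF assms(1) x(1)] unfolding GL_def by blast
qed

end

section \<open>Simple arrows and maximality of the component\<close>

locale discrete_hopf_algebra = hopf_algebra H for H :: "('b, 'k::field) hopf" +
  assumes infinite_field: "infinite (UNIV :: 'k set)" and discrete: "discrete_corep_type H"
begin

text \<open>A \<open>y\<close> independent of \<open>x\<close> modulo g - h would give a Kronecker
  pencil, so some combination of the two is a multiple of g - h. Nontriviality of \<open>x\<close>
  makes the coefficient of \<open>y\<close> nonzero.\<close>

lemma Prim_subset_span:
  assumes "grouplike H g" "grouplike H h" "nontrivial_prim g h x" "y \<in> Prim H g h"
  shows "y \<in> fs.span {x, g - h}"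
proof -
  have x: "x \<in> Prim H g h" "\<And>c. x \<noteq> c \<cdot> (g - h)" using assms(3) by (auto simp: nontrivial_prim_def)
  obtain \<alpha> \<beta> c where *: "\<alpha> \<cdot> x + \<beta> \<cdot> y = c \<cdot> (g - h)" and nz: "\<alpha> \<noteq> 0 \<or> \<beta> \<noteq> 0"
    using kronecker_not_discrete[OF infinite_field assms(1,2) x(1) assms(4)] discrete by blast
  have "\<beta> \<noteq> 0"
  proof
    assume "\<beta> = 0"
    then have "\<alpha> \<noteq> 0" "\<alpha> \<cdot> x = c \<cdot> (g - h)" using nz * by auto
    then have "x = (c / \<alpha>) \<cdot> (g - h)"
      by (metis (no_types) divide_inverse_commute fs.scale_scale fs.scale_one left_inverse)
    then show False using x(2) by blast
  qed
  have "\<beta> \<cdot> y = c \<cdot> (g - h) - \<alpha> \<cdot> x" using * by (metis add_diff_cancel_left')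
  moreover have "\<dots> \<in> fs.span {x, g - h}"
    by (intro fs.span_diff fs.span_scale fs.span_base) auto
  ultimately have "(1 / \<beta>) \<cdot> \<beta> \<cdot> y \<in> fs.span {x, g - h}" by (simp only: fs.span_scale)
  then show ?thesis using \<open>\<beta> \<noteq> 0\<close> by simp
qed

text \<open>Inside C the space P(g, h) is spanned by g - h and at most one nontrivial x. For g = h
  the vector g - h vanishes, and there \<open>ext_arrows\<close> subtracts nothing; so the count is
  0 or 1 and the quiver becomes a relation.\<close>

lemma ext_arrows_eq:
  assumes "subspace C" "g \<in> GL H C" "h \<in> GL H C"
  shows "ext_arrows H C g h = (if \<exists>x\<in>C. nontrivial_prim g h x then 1 else 0)"
proof -
  let ?P = "Prim H g h \<inter> C"
  have gh: "grouplike H g" "grouplike H h" "g \<in> C" "h \<in> C" using assms by (auto simp: GL_def)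
  have sub: "fs.subspace C" using assms(1) by (simp add: subspace_iff)
  have T: "g - h \<in> ?P" using gh Prim_trivial fs.subspace_diff[OF sub] by blast
  have subP: "fs.subspace ?P"
    unfolding fs.subspace_def using Prim_0 Prim_add Prim_smul sub[unfolded fs.subspace_def] by auto
  show ?thesis
  proof (cases "\<exists>x\<in>C. nontrivial_prim g h x")
    case True
    then obtain x where x: "x \<in> C" "nontrivial_prim g h x" by blast
    then have xP: "x \<in> ?P" by (simp add: nontrivial_prim_def)
    have P: "?P = fs.span {x, g - h}"
      using Prim_subset_span[OF gh(1,2) x(2)] fs.span_minimal[OF _ subP, of "{x, g - h}"] xP T by auto
    show ?thesis
    proof (cases "g = h")
      case True
      have "fs.independent {x}" using x(2) True by (simp add: nontrivial_prim_def)
      moreover have "?P = fs.span {x}" using P True fs.span_insert_0[of "{x}"] by (simp add: insert_commute)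
      ultimately show ?thesis
        using fdim_span[of "{x}"] True x by (auto simp: ext_arrows_def one_enat_def)
    next
      case False
      have ne: "g - h \<noteq> 0" using False by simp
      have "x \<notin> fs.span {g - h}" using x(2) by (auto simp: nontrivial_prim_def fs.span_singleton)
      then have "fs.independent {x, g - h}"
        using ne by (simp add: fs.independent_insert fs.independent_empty)
      moreover have "x \<noteq> g - h" using x(2) fs.scale_one unfolding nontrivial_prim_def by metis
      ultimately show ?thesis
        using fdim_span[of "{x, g - h}"] False x unfolding ext_arrows_def P by (auto simp: one_enat_def)
    qed
  next
    case False
    have P: "?P = fs.span {g - h}"
    proof
      show "?P \<subseteq> fs.span {g - h}" using False by (auto simp: nontrivial_prim_def fs.span_singleton)
      show "fs.span {g - h} \<subseteq> ?P" using T subP by (intro fs.span_minimal) auto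
    qed
    show ?thesis
    proof (cases "g = h")
      case True
      then have "?P = fs.span {}" using P by simp
      then show ?thesis using fdim_span[OF finite.emptyI fs.independent_empty] False True by (auto simp: ext_arrows_def zero_enat_def)
    next
      case gh: False
      then have "fs.independent {g - h}" by (simp add: fs.dependent_single)
      then show ?thesis
        using fdim_span[of "{g - h}"] gh False unfolding ext_arrows_def P by (auto simp: zero_enat_def)
    qed
  qed
qed

lemma ext_edge_eq:
  assumes "subspace C"
  shows "ext_edge H C = {(g, h). g \<in> GL H C \<and> h \<in> GL H C \<and> (\<exists>x\<in>C. nontrivial_prim g h x \<or> nontrivial_prim h g x)}"
  unfolding ext_edge_def using ext_arrows_eq[OF assms] by (auto split: if_splits)

lemma sym_ext_edge: "sym (ext_edge H C)"
  unfolding ext_edge_def sym_def by auto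

text \<open>Adjoining \<open>h\<close> and then \<open>x\<close> to \<open>B\<close> creates no grouplike element besides \<open>h\<close> and keeps the
  Ext-quiver connected, so maximality of \<open>B\<close> applies.\<close>
lemma link_component_absorbs:
  assumes B: "link_component_one H B" and g: "g \<in> GL H B" and h: "grouplike H h"
    and x: "x \<in> Prim H g h \<or> x \<in> Prim H h g" "h \<in> B \<or> nontrivial_prim g h x \<or> nontrivial_prim h g x"
  shows "h \<in> B" "x \<in> B"
proof -
  have sB: "subcoalgebra H B" and conn: "ext_connected H B"
    and max: "\<And>D. subcoalgebra H D \<Longrightarrow> B \<subseteq> D \<Longrightarrow> ext_connected H D \<Longrightarrow> D = B"
    using B by (auto simp: link_component_one_def)
  \<comment> \<open>\<open>h\<close> precedes \<open>x\<close>, because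
    \<open>subcoalgebra_insert_Prim\<close> needs both ends of the skew-primitive inside the
    subcoalgebra.\<close>
  define B1 where "B1 = fs.span (insert h B)"
  define B2 where "B2 = fs.span (insert x B1)"
  have sB1: "subcoalgebra H B1" and GL1: "GL H B1 \<subseteq> insert h (GL H B)"
    unfolding B1_def by (rule subcoalgebra_insert_grouplike[OF sB h])+
  have BB1: "B \<subseteq> B1" and hB1: "h \<in> B1"
    unfolding B1_def using fs.span_superset[of "insert h B"] by auto
  have B12: "B1 \<subseteq> B2" and xB2: "x \<in> B2"
    unfolding B2_def using fs.span_superset[of "insert x B1"] by auto
  have gB1: "g \<in> B1" using g BB1 by (auto simp: GL_def)
  \<comment> \<open>In the orientation from h to g the grouplike that could be new is g, which B
    contains.\<close>
  have sB2: "subcoalgebra H B2" and GL2: "GL H B2 \<subseteq> insert h (GL H B)"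
    unfolding B2_def using subcoalgebra_insert_Prim[OF sB1 gB1 hB1, of x]
      subcoalgebra_insert_Prim[OF sB1 hB1 gB1, of x] x(1) GL1 g by blast+
  have sub: "subspace B" "subspace B2" using sB sB2 by (auto simp: subcoalgebra_def)
  have gB2: "g \<in> GL H B2" and hB2: "h \<in> GL H B2" and GLBB2: "GL H B \<subseteq> GL H B2"
    using g h BB1 B12 hB1 by (auto simp: GL_def)
  have "ext_edge H B \<subseteq> ext_edge H B2"
    unfolding ext_edge_eq[OF sub(1)] ext_edge_eq[OF sub(2)] using GLBB2 BB1 B12 by blast
  then have mono: "(ext_edge H B)\<^sup>* \<subseteq> (ext_edge H B2)\<^sup>*" by (rule rtrancl_mono)
  have reach: "(g, u) \<in> (ext_edge H B2)\<^sup>*" if "u \<in> GL H B2" for u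
  proof (cases "u \<in> GL H B")
    case True
    then show ?thesis using conn g mono unfolding ext_connected_def by blast
  next
    case False
    then have "u = h" using GL2 that by blast
    then have "h \<notin> B" using False h by (auto simp: GL_def)
    \<comment> \<open>As h is outside B, the second disjunction in the hypotheses makes x
      nontrivial, and x itself is the edge joining h to the old vertices.\<close>
    then have "(g, h) \<in> ext_edge H B2"
      using x(2) xB2 gB2 hB2 unfolding ext_edge_eq[OF sub(2)] by blast
    then show ?thesis using \<open>u = h\<close> by blast
  qed
  have "ext_connected H B2"
    unfolding ext_connected_def
  proof (intro ballI)
    fix u v assume "u \<in> GL H B2" "v \<in> GL H B2"
    then have "(u, g) \<in> (ext_edge H B2)\<^sup>*" "(g, v) \<in> (ext_edge H B2)\<^sup>*"
      using reach sym_rtrancl[OF sym_ext_edge] by (auto dest: symD)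
    then show "(u, v) \<in> (ext_edge H B2)\<^sup>*" by (rule rtrancl_trans)
  qed
  then have "B2 = B" using max sB2 BB1 B12 by blast
  then show "h \<in> B" "x \<in> B" using xB2 hB1 B12 by blast+
qed

end

section \<open>The group of the component\<close>

text \<open>Over a finite field the product of all X - a vanishes everywhere, so adding 1 gives a
  nonconstant polynomial without a root.\<close>

lemma infinite_alg_closed:
  assumes "alg_closed_field TYPE('k::field)"
  shows "infinite (UNIV :: 'k set)"
proof
  assume fin: "finite (UNIV :: 'k set)"
  define q :: "'k poly" where "q = (\<Prod>a\<in>UNIV. [:- a, 1:])"
  have q: "poly q x = 0" for x
    unfolding q_def poly_prod using fin by (intro prod_zero) (auto intro: bexI[of _ x])
  have "degree q = card (UNIV :: 'k set)"
    unfolding q_def by (subst degree_prod_sum_eq) auto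
  then have "degree q > 0" using fin by (simp add: card_gt_0_iff)
  then have "degree (q + 1) > 0" by (simp add: degree_add_eq_left)
  then obtain x where "poly (q + 1) x = 0"
    using assms unfolding alg_closed_field_def by blast
  then show False using q[of x] by simp
qed

text \<open>A lattice \<open>L\<close> meeting the antidiagonal trivially is mapped injectively to \<open>\<int>\<close>
  by \<open>(i, j) \<mapsto> i + j\<close>, hence it is cyclic.\<close>
lemma lattice_cyclic:
  fixes L :: "int \<Rightarrow> int \<Rightarrow> bool"
  assumes diff: "\<And>i j i' j'. L i j \<Longrightarrow> L i' j' \<Longrightarrow> L (i - i') (j - j')"
    and mult: "\<And>i j k. L i j \<Longrightarrow> L (k * i) (k * j)"
    and zero: "L 0 0" and anti: "\<And>k. L k (- k) \<Longrightarrow> k = 0"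
  obtains m n where "(m, n) \<noteq> (1, 1)" "(m, n) \<noteq> (-1, -1)" "\<And>i j. L i j \<longleftrightarrow> (\<exists>k. i = k * m \<and> j = - k * n)"
proof (cases "\<exists>i j. L i j \<and> i + j > 0")
  case False
  \<comment> \<open>No coordinate sum is positive, hence by negation none is nonzero: L lies on the
    antidiagonal and is trivial.\<close>
  have "L i j \<longleftrightarrow> i = 0 \<and> j = 0" for i j
  proof
    assume L: "L i j"
    then have "L (- i) (- j)" using diff[OF zero L] by simp
    then have "i + j = 0" using False L by (smt (verit, best))
    then have "j = - i" by simp
    then show "i = 0 \<and> j = 0" using anti L by auto
  qed (use zero in simp)
  then show thesis by (intro that[of 0 0]) auto
next
  case True
  \<comment> \<open>The positive values of i + j on L. The least one, d, is attained at a point (m,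
    n') that turns out to generate L.\<close>
  define Q where "Q d \<longleftrightarrow> d > 0 \<and> (\<exists>i j. L i j \<and> i + j = int d)" for d
  have "\<exists>d. Q d" using True unfolding Q_def by (metis zero_less_imp_eq_int of_nat_0_less_iff)
  then have Q: "Q (Least Q)" and min: "\<And>d. Q d \<Longrightarrow> Least Q \<le> d"
    by (auto intro: LeastI_ex Least_le)
  define d where "d = Least Q"
  obtain m n' where m: "L m n'" "m + n' = int d" and d: "d > 0"
    using Q unfolding Q_def d_def by blast
  \<comment> \<open>A relation a^m = b^n is the lattice point (m, -n), which explains the sign of
    n'.\<close>
  have iff: "L i j \<longleftrightarrow> (\<exists>k. i = k * m \<and> j = - k * (- n'))" for i j
  proof
    assume L: "L i j"
    \<comment> \<open>Division with remainder: subtracting k times the generator leaves a point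
      whose coordinate sum is the remainder, and minimality of d makes it 0.\<close>
    define k where "k = (i + j) div int d"
    have L': "L (i - k * m) (j - k * n')" by (intro diff L mult m)
    have sum: "(i - k * m) + (j - k * n') = (i + j) mod int d"
    proof -
      have "(i - k * m) + (j - k * n') = (i + j) - k * (m + n')" by (simp add: algebra_simps)
      then show ?thesis unfolding m(2) k_def by (simp add: minus_div_mult_eq_mod)
    qed
    have "(i + j) mod int d = 0"
    proof (rule ccontr)
      assume "(i + j) mod int d \<noteq> 0"
      moreover have "0 \<le> (i + j) mod int d" "(i + j) mod int d < int d" using d by simp_all
      ultimately have "Q (nat ((i + j) mod int d))" "nat ((i + j) mod int d) < d"
        unfolding Q_def using L' sum by auto
      then show False using min unfolding d_def by fastforce
    qed
    then have "j - k * n' = - (i - k * m)" using sum by simp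
    then have "i - k * m = 0" using anti L' by metis
    then show "\<exists>k. i = k * m \<and> j = - k * (- n')"
      using \<open>j - k * n' = - (i - k * m)\<close> by (intro exI[of _ k]) simp
  qed (use mult[OF m(1)] in auto)
  \<comment> \<open>The pairs (1, 1) and (-1, -1) would make (1, -1) or (-1, 1) the generator, a
    nonzero point on the antidiagonal.\<close>
  have "\<not> L 1 (- 1)" using anti[of 1] by auto
  moreover have "\<not> L (- 1) 1" using anti[of "- 1"] by auto
  ultimately show thesis using m(1) iff by (intro that[of m "- n'"]) auto
qed

section \<open>Translation by grouplikes and the labels of the Cayley graph\<close>

context hopf_algebra
begin

text \<open>From here on the group operations stay folded, so that the simplifier works with the
  group laws.\<close>

declare G_simps [simp del]

lemma G_cancel:
  assumes "k \<in> carrier G" "x \<in> carrier G"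
  shows "inv\<^bsub>G\<^esub> k \<otimes>\<^bsub>G\<^esub> (k \<otimes>\<^bsub>G\<^esub> x) = x" "k \<otimes>\<^bsub>G\<^esub> (inv\<^bsub>G\<^esub> k \<otimes>\<^bsub>G\<^esub> x) = x" "x \<otimes>\<^bsub>G\<^esub> k \<otimes>\<^bsub>G\<^esub> inv\<^bsub>G\<^esub> k = x" "x \<otimes>\<^bsub>G\<^esub> inv\<^bsub>G\<^esub> k \<otimes>\<^bsub>G\<^esub> k = x"
  using assms G.m_assoc G.l_inv G.r_inv G.inv_closed G.l_one G.r_one by metis+

text \<open>Multiplication by k is undone by S(k). Since x is outside the carrier, the group laws do
  not cover it and the cancellation is carried out with \<open>hmul\<close>.\<close>

lemma nontrivial_prim_mult_left:
  assumes k: "grouplike H k" and g: "grouplike H g" and h: "grouplike H h" and x: "nontrivial_prim g h x"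
  shows "nontrivial_prim (k \<otimes>\<^bsub>G\<^esub> g) (k \<otimes>\<^bsub>G\<^esub> h) (k \<otimes>\<^bsub>G\<^esub> x)"
  unfolding nontrivial_prim_def
proof (intro conjI allI notI)
  note fin = grouplikeD(1)[OF k] grouplikeD(1)[OF g] grouplikeD(1)[OF h] grouplikeD(1)[OF hS_grouplike[OF k]]
  have xP: "x \<in> Prim H g h" and xn: "\<And>c. x \<noteq> c \<cdot> (g - h)" using x by (auto simp: nontrivial_prim_def)
  show "k \<otimes>\<^bsub>G\<^esub> x \<in> Prim H (k \<otimes>\<^bsub>G\<^esub> g) (k \<otimes>\<^bsub>G\<^esub> h)"
    unfolding G_simps by (rule Prim_mult_left[OF k g h xP])
  fix c assume c: "k \<otimes>\<^bsub>G\<^esub> x = c \<cdot> (k \<otimes>\<^bsub>G\<^esub> g - k \<otimes>\<^bsub>G\<^esub> h)"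
  have "k \<otimes>\<^bsub>G\<^esub> g - k \<otimes>\<^bsub>G\<^esub> h = k \<otimes>\<^bsub>G\<^esub> (g - h)"
    unfolding G_simps using fin by (simp add: flinear_diff[OF flinear_hmul_right])
  then have kx: "hmul H k x = hmul H k (c \<cdot> (g - h))"
    using c fin unfolding G_simps by (simp add: flinear_smul[OF flinear_hmul_right])
  have cancel: "hmul H (hS H k) (hmul H k y) = y" if "fin y" for y
    using that fin by (simp add: hmul_assoc[symmetric] grouplike_antipode[OF k] hmul_unit_left)
  have "x = c \<cdot> (g - h)"
    using cancel[OF PrimD(1)[OF xP]] cancel[OF fin_smul[OF fin_diff[OF fin(2,3)], of c]]
    unfolding kx by (rule trans[OF sym])
  then show False using xn by blast
qed

lemma nontrivial_prim_mult_right: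
  assumes k: "grouplike H k" and g: "grouplike H g" and h: "grouplike H h" and x: "nontrivial_prim g h x"
  shows "nontrivial_prim (g \<otimes>\<^bsub>G\<^esub> k) (h \<otimes>\<^bsub>G\<^esub> k) (x \<otimes>\<^bsub>G\<^esub> k)"
  unfolding nontrivial_prim_def
proof (intro conjI allI notI)
  note fin = grouplikeD(1)[OF k] grouplikeD(1)[OF g] grouplikeD(1)[OF h] grouplikeD(1)[OF hS_grouplike[OF k]]
  have xP: "x \<in> Prim H g h" and xn: "\<And>c. x \<noteq> c \<cdot> (g - h)" using x by (auto simp: nontrivial_prim_def)
  show "x \<otimes>\<^bsub>G\<^esub> k \<in> Prim H (g \<otimes>\<^bsub>G\<^esub> k) (h \<otimes>\<^bsub>G\<^esub> k)"
    unfolding G_simps by (rule Prim_mult_right[OF k g h xP])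
  fix c assume c: "x \<otimes>\<^bsub>G\<^esub> k = c \<cdot> (g \<otimes>\<^bsub>G\<^esub> k - h \<otimes>\<^bsub>G\<^esub> k)"
  have "g \<otimes>\<^bsub>G\<^esub> k - h \<otimes>\<^bsub>G\<^esub> k = (g - h) \<otimes>\<^bsub>G\<^esub> k"
    unfolding G_simps using fin by (simp add: flinear_diff[OF flinear_hmul_left])
  then have kx: "hmul H x k = hmul H (c \<cdot> (g - h)) k"
    using c fin unfolding G_simps by (simp add: flinear_smul[OF flinear_hmul_left])
  have cancel: "hmul H (hmul H y k) (hS H k) = y" if "fin y" for y
    using that fin by (simp add: hmul_assoc grouplike_antipode[OF k] hmul_unit_right)
  have "x = c \<cdot> (g - h)"
    using cancel[OF PrimD(1)[OF xP]] cancel[OF fin_smul[OF fin_diff[OF fin(2,3)], of c]]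
    unfolding kx by (rule trans[OF sym])
  then show False using xn by blast
qed

lemma linked_mult_left:
  "k \<in> carrier G \<Longrightarrow> g \<in> carrier G \<Longrightarrow> h \<in> carrier G \<Longrightarrow> linked g h \<Longrightarrow> linked (k \<otimes>\<^bsub>G\<^esub> g) (k \<otimes>\<^bsub>G\<^esub> h)"
  unfolding linked_def G_simps(1) mem_Collect_eq by (elim exE, rule exI, rule nontrivial_prim_mult_left)

lemma linked_mult_right:
  "k \<in> carrier G \<Longrightarrow> g \<in> carrier G \<Longrightarrow> h \<in> carrier G \<Longrightarrow> linked g h \<Longrightarrow> linked (g \<otimes>\<^bsub>G\<^esub> k) (h \<otimes>\<^bsub>G\<^esub> k)"
  unfolding linked_def G_simps(1) mem_Collect_eq by (elim exE, rule exI, rule nontrivial_prim_mult_right)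

lemma int_pow_commute:
  assumes "x \<in> carrier G" "y \<in> carrier G" "x \<otimes>\<^bsub>G\<^esub> y = y \<otimes>\<^bsub>G\<^esub> x"
  shows "y \<otimes>\<^bsub>G\<^esub> x [^]\<^bsub>G\<^esub> (i::int) = x [^]\<^bsub>G\<^esub> i \<otimes>\<^bsub>G\<^esub> y"
proof -
  have nat: "y \<otimes>\<^bsub>G\<^esub> x [^]\<^bsub>G\<^esub> n = x [^]\<^bsub>G\<^esub> n \<otimes>\<^bsub>G\<^esub> y" for n :: nat
    by (rule G.group_commutes_pow[OF assms(3,1,2), symmetric])
  have inv: "y \<otimes>\<^bsub>G\<^esub> inv\<^bsub>G\<^esub> u = inv\<^bsub>G\<^esub> u \<otimes>\<^bsub>G\<^esub> y" if "u \<in> carrier G" "y \<otimes>\<^bsub>G\<^esub> u = u \<otimes>\<^bsub>G\<^esub> y" for u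
    using that assms(2) G_cancel G.inv_closed G.m_assoc G.m_closed by metis
  show ?thesis
    unfolding int_pow_def2
    by (cases "i < 0") (simp_all only: if_True if_False nat inv[OF G.nat_pow_closed[OF assms(1)] nat])
qed

text \<open>The unit may be a label: a nonzero primitive element is a loop at 1. When it is the only
  label, the quiver is the cycle of length one.\<close>

definition labels :: "('b \<Rightarrow> 'k) set" where
  "labels = {a \<in> carrier G. linked \<one>\<^bsub>G\<^esub> a}"

lemma labels_closed: "a \<in> labels \<Longrightarrow> a \<in> carrier G" by (simp add: labels_def)

lemma linked_mult_labels: "g \<in> carrier G \<Longrightarrow> a \<in> labels \<Longrightarrow> linked g (g \<otimes>\<^bsub>G\<^esub> a)"
  using linked_mult_left[of g "\<one>\<^bsub>G\<^esub>" a] unfolding labels_def by (simp add: G.r_one)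

lemma linked_iff_labels:
  assumes "g \<in> carrier G" "h \<in> carrier G"
  shows "linked g h \<longleftrightarrow> (\<exists>a\<in>labels. h = g \<otimes>\<^bsub>G\<^esub> a)"
proof
  assume "linked g h"
  then have "linked (inv\<^bsub>G\<^esub> g \<otimes>\<^bsub>G\<^esub> g) (inv\<^bsub>G\<^esub> g \<otimes>\<^bsub>G\<^esub> h)" using assms by (intro linked_mult_left G.inv_closed)
  then have "inv\<^bsub>G\<^esub> g \<otimes>\<^bsub>G\<^esub> h \<in> labels" using assms unfolding labels_def by simp
  moreover have "h = g \<otimes>\<^bsub>G\<^esub> (inv\<^bsub>G\<^esub> g \<otimes>\<^bsub>G\<^esub> h)" using assms by (simp only: G_cancel)
  ultimately show "\<exists>a\<in>labels. h = g \<otimes>\<^bsub>G\<^esub> a" by blast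
qed (use assms linked_mult_labels in blast)

lemma linked_mult_left_iff:
  assumes "k \<in> carrier G" "g \<in> carrier G" "h \<in> carrier G"
  shows "linked (k \<otimes>\<^bsub>G\<^esub> g) (k \<otimes>\<^bsub>G\<^esub> h) \<longleftrightarrow> linked g h"
proof
  assume "linked (k \<otimes>\<^bsub>G\<^esub> g) (k \<otimes>\<^bsub>G\<^esub> h)"
  then have "linked (inv\<^bsub>G\<^esub> k \<otimes>\<^bsub>G\<^esub> (k \<otimes>\<^bsub>G\<^esub> g)) (inv\<^bsub>G\<^esub> k \<otimes>\<^bsub>G\<^esub> (k \<otimes>\<^bsub>G\<^esub> h))"
    using assms by (intro linked_mult_left[of "inv\<^bsub>G\<^esub> k"] G.inv_closed G.m_closed)
  then show "linked g h" using assms by (simp only: G_cancel)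
qed (use linked_mult_left assms in blast)

text \<open>The arrow k -> k a, multiplied on the right by the inverse of k, becomes an arrow out of
  1. This is where left and right translation are combined.\<close>

lemma labels_conj:
  assumes "k \<in> carrier G" "a \<in> labels"
  shows "k \<otimes>\<^bsub>G\<^esub> a \<otimes>\<^bsub>G\<^esub> inv\<^bsub>G\<^esub> k \<in> labels"
proof -
  note a = labels_closed[OF assms(2)]
  have "linked (k \<otimes>\<^bsub>G\<^esub> inv\<^bsub>G\<^esub> k) (k \<otimes>\<^bsub>G\<^esub> a \<otimes>\<^bsub>G\<^esub> inv\<^bsub>G\<^esub> k)"
    using linked_mult_right[OF _ _ _ linked_mult_labels[OF assms], of "inv\<^bsub>G\<^esub> k"] assms(1) a by simp
  then show ?thesis using assms(1) a unfolding labels_def by simp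
qed

end

section \<open>Restrictions on the labels\<close>

context discrete_hopf_algebra
begin

text \<open>The vertex 1 has arrows to a, b and c, and a receives arrows from 1, a b^-1 and a c^-1.
  The arrow 1 -> a with these two further neighbours at each end is a D5~ diagram in the separated
  quiver.\<close>

lemma labels_le_2:
  assumes "a \<in> labels" "b \<in> labels" "c \<in> labels"
  shows "a = b \<or> a = c \<or> b = c"
proof (rule ccontr)
  assume ne: "\<not> (a = b \<or> a = c \<or> b = c)"
  note cl = assms[THEN labels_closed]
  have gl: "grouplike H x" if "x \<in> carrier G" for x using that by (simp add: G_simps)
  have neq: "a \<otimes>\<^bsub>G\<^esub> inv\<^bsub>G\<^esub> x \<noteq> a \<otimes>\<^bsub>G\<^esub> inv\<^bsub>G\<^esub> y" if "x \<noteq> y" "x \<in> carrier G" "y \<in> carrier G" for x y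
    using that cl(1) by (metis G_cancel(1) G.inv_closed G.inv_inv)
  have ne1: "\<one>\<^bsub>G\<^esub> \<noteq> a \<otimes>\<^bsub>G\<^esub> inv\<^bsub>G\<^esub> x" if "a \<noteq> x" "x \<in> carrier G" for x
    using neq[OF that(1) cl(1) that(2)] cl(1) by simp
  have link: "linked (a \<otimes>\<^bsub>G\<^esub> inv\<^bsub>G\<^esub> x) a" if "x \<in> labels" for x
    using linked_mult_labels[of "a \<otimes>\<^bsub>G\<^esub> inv\<^bsub>G\<^esub> x" x] that labels_closed[OF that] cl(1)
    by (simp only: G_cancel G.m_closed G.inv_closed)
  have "\<not> discrete_corep_type H"
  proof (rule D5_not_discrete[OF infinite_field, of "\<one>\<^bsub>G\<^esub>" "a \<otimes>\<^bsub>G\<^esub> inv\<^bsub>G\<^esub> b" "a \<otimes>\<^bsub>G\<^esub> inv\<^bsub>G\<^esub> c" a b c])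
    show "linked \<one>\<^bsub>G\<^esub> a" "linked \<one>\<^bsub>G\<^esub> b" "linked \<one>\<^bsub>G\<^esub> c" using assms by (auto simp: labels_def)
    show "linked (a \<otimes>\<^bsub>G\<^esub> inv\<^bsub>G\<^esub> b) a" "linked (a \<otimes>\<^bsub>G\<^esub> inv\<^bsub>G\<^esub> c) a" using link assms by blast+
    show "\<one>\<^bsub>G\<^esub> \<noteq> a \<otimes>\<^bsub>G\<^esub> inv\<^bsub>G\<^esub> b" "\<one>\<^bsub>G\<^esub> \<noteq> a \<otimes>\<^bsub>G\<^esub> inv\<^bsub>G\<^esub> c" "a \<otimes>\<^bsub>G\<^esub> inv\<^bsub>G\<^esub> b \<noteq> a \<otimes>\<^bsub>G\<^esub> inv\<^bsub>G\<^esub> c" "a \<noteq> b" "a \<noteq> c" "b \<noteq> c"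
      using ne ne1 neq cl by blast+
  qed (use cl in \<open>auto intro!: gl\<close>)
  then show False using discrete by blast
qed

text \<open>Conjugation by a is injective and fixes a, so the label a b a^-1 differs from a; with at
  most two labels it equals b.\<close>

lemma labels_commute:
  assumes "a \<in> labels" "b \<in> labels"
  shows "a \<otimes>\<^bsub>G\<^esub> b = b \<otimes>\<^bsub>G\<^esub> a"
proof (cases "a = b")
  case False
  note cl = assms[THEN labels_closed]
  have "a \<otimes>\<^bsub>G\<^esub> b \<otimes>\<^bsub>G\<^esub> inv\<^bsub>G\<^esub> a \<noteq> a"
  proof
    assume "a \<otimes>\<^bsub>G\<^esub> b \<otimes>\<^bsub>G\<^esub> inv\<^bsub>G\<^esub> a = a"
    then have "a \<otimes>\<^bsub>G\<^esub> b = a \<otimes>\<^bsub>G\<^esub> a" using cl G_cancel(4)[of a "a \<otimes>\<^bsub>G\<^esub> b"] G.m_closed by metis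
    then show False using False cl G_cancel(1) by metis
  qed
  then have "a \<otimes>\<^bsub>G\<^esub> b \<otimes>\<^bsub>G\<^esub> inv\<^bsub>G\<^esub> a = b"
    using labels_le_2[OF labels_conj[OF cl(1) assms(2)] assms] False by blast
  then show ?thesis using cl G_cancel(4)[of a "a \<otimes>\<^bsub>G\<^esub> b"] G.m_closed by metis
qed simp

text \<open>With c = b a^-1 one has c^i b = c^(i+1) a. If c had finite order n, the n sources c^i
  and the n sinks c^i a would form a cycle in the separated quiver; \<open>G.ord\<close> is 0 for
  infinite order.\<close>

lemma labels_quotient_ord:
  assumes "a \<in> labels" "b \<in> labels" "a \<noteq> b"
  shows "G.ord (b \<otimes>\<^bsub>G\<^esub> inv\<^bsub>G\<^esub> a) = 0"
proof (rule ccontr)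
  note cl = assms(1,2)[THEN labels_closed]
  define c where "c = b \<otimes>\<^bsub>G\<^esub> inv\<^bsub>G\<^esub> a"
  define n where "n = G.ord c"
  assume "G.ord (b \<otimes>\<^bsub>G\<^esub> inv\<^bsub>G\<^esub> a) \<noteq> 0"
  then have "n \<noteq> 0" by (simp add: n_def c_def)
  have c: "c \<in> carrier G" unfolding c_def using cl by (intro G.m_closed G.inv_closed)
  have ca: "c \<otimes>\<^bsub>G\<^esub> a = b" unfolding c_def using cl by (simp only: G_cancel)
  have "c \<noteq> \<one>\<^bsub>G\<^esub>"
  proof
    assume "c = \<one>\<^bsub>G\<^esub>"
    then have "a = b" using ca cl by simp
    then show False using assms(3) by simp
  qed
  then have "n \<noteq> 1" using c G.ord_eq_1 unfolding n_def by blast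
  then have n: "n \<ge> 2" using \<open>n \<noteq> 0\<close> by simp
  have pow_eq: "c [^]\<^bsub>G\<^esub> i = c [^]\<^bsub>G\<^esub> j \<longleftrightarrow> int n dvd int j - int i" for i j :: nat
    using G.int_pow_eq[OF c, of "int i" "int j"] unfolding int_pow_int n_def .
  have inj: "inj_on (\<lambda>i::nat. c [^]\<^bsub>G\<^esub> i) {..<n}"
  proof (rule inj_onI)
    fix i j assume "i \<in> {..<n}" "j \<in> {..<n}" "c [^]\<^bsub>G\<^esub> i = c [^]\<^bsub>G\<^esub> j"
    then have "int n dvd int j - int i" "\<bar>int j - int i\<bar> < int n" unfolding pow_eq by auto
    then have "int j - int i = 0" using dvd_imp_le_int[of "int j - int i" "int n"] by linarith
    then show "i = j" by simp
  qed
  have pc: "c [^]\<^bsub>G\<^esub> i \<in> carrier G" for i :: nat using c by (rule G.nat_pow_closed)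
  have "\<not> discrete_corep_type H"
  proof (rule cycle_not_discrete[OF infinite_field n, of "\<lambda>i. c [^]\<^bsub>G\<^esub> i" "\<lambda>i. c [^]\<^bsub>G\<^esub> i \<otimes>\<^bsub>G\<^esub> a"])
    show "grouplike H (c [^]\<^bsub>G\<^esub> i)" "grouplike H (c [^]\<^bsub>G\<^esub> i \<otimes>\<^bsub>G\<^esub> a)" for i :: nat
      using pc[of i] G.m_closed[OF pc cl(1), of i] by (simp_all add: G_simps)
    show "inj_on (\<lambda>i::nat. c [^]\<^bsub>G\<^esub> i) {..<n}" by (rule inj)
    show "inj_on (\<lambda>i::nat. c [^]\<^bsub>G\<^esub> i \<otimes>\<^bsub>G\<^esub> a) {..<n}"
      using inj pc cl(1) G.right_cancel unfolding inj_on_def by metis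
    show "linked (c [^]\<^bsub>G\<^esub> i) (c [^]\<^bsub>G\<^esub> i \<otimes>\<^bsub>G\<^esub> a)" for i :: nat by (rule linked_mult_labels[OF pc assms(1)])
    \<comment> \<open>Since c^n = 1, the last source is also joined to the first sink, which closes
      the zigzag.\<close>
    have "c [^]\<^bsub>G\<^esub> (Suc i mod n) = c [^]\<^bsub>G\<^esub> Suc i" for i :: nat
      unfolding pow_eq by (metis zmod_int dvd_minus_mod)
    then have "c [^]\<^bsub>G\<^esub> (Suc i mod n) \<otimes>\<^bsub>G\<^esub> a = c [^]\<^bsub>G\<^esub> i \<otimes>\<^bsub>G\<^esub> b" for i :: nat
      using pc[of i] c cl ca by (simp add: G.m_assoc)
    then show "linked (c [^]\<^bsub>G\<^esub> i) (c [^]\<^bsub>G\<^esub> (Suc i mod n) \<otimes>\<^bsub>G\<^esub> a)" for i :: nat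
      using linked_mult_labels[OF pc assms(2)] by simp
  qed
  then show False using discrete by blast
qed

lemma subspace_Hsp: "subspace Hsp"
  by (auto simp: subspace_iff Hsp_def fs.subspace_def)

lemma GL_Hsp: "GL H Hsp = carrier G"
  by (auto simp: G_simps GL_def Hsp_def grouplikeD)

lemma ext_arrows_Hsp:
  assumes "g \<in> carrier G" "h \<in> carrier G"
  shows "ext_arrows H Hsp g h = (if linked g h then 1 else 0)"
  using ext_arrows_eq[OF subspace_Hsp, of g h] assms unfolding GL_Hsp
  by (auto simp: linked_def Hsp_def nontrivial_prim_def dest: PrimD)

lemma ext_edge_Hsp: "ext_edge H Hsp = {(g, h). g \<in> carrier G \<and> h \<in> carrier G \<and> (linked g h \<or> linked h g)}"
  unfolding ext_edge_def GL_Hsp using ext_arrows_Hsp by (auto split: if_splits)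

end

section \<open>Grouplikes of the component of 1 and its translates\<close>

locale link_component = discrete_hopf_algebra H for H :: "('b, 'k::field) hopf" +
  fixes B :: "('b \<Rightarrow> 'k) set"
  assumes B: "link_component_one H B"
begin

lemma GL_B_carrier: "g \<in> GL H B \<Longrightarrow> g \<in> carrier G"
  by (simp add: G_simps GL_def)

lemma one_GL_B: "\<one>\<^bsub>G\<^esub> \<in> GL H B"
  using B hunit_grouplike by (simp add: link_component_one_def GL_def G_simps)

lemma subspace_B: "subspace B"
  using B by (simp add: link_component_one_def subcoalgebra_def)

text \<open>By maximality B contains every nontrivial skew-primitive between two of its grouplikes,
  so its Ext-quiver is a full subquiver of that of H.\<close>

lemma ext_arrows_B:
  assumes "g \<in> GL H B" "h \<in> GL H B"
  shows "ext_arrows H B g h = (if linked g h then 1 else 0)"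
proof -
  have "x \<in> B" if "nontrivial_prim g h x" for x
    using link_component_absorbs(2)[OF B assms(1), of h x] assms(2) that by (auto simp: GL_def nontrivial_prim_def)
  then show ?thesis
    using ext_arrows_eq[OF subspace_B assms] unfolding linked_def by auto
qed

lemma linked_GL_B:
  assumes "g \<in> GL H B" "h \<in> carrier G" "linked g h \<or> linked h g"
  shows "h \<in> GL H B"
  using assms link_component_absorbs(1)[OF B assms(1), of h]
  by (auto simp: G_simps GL_def linked_def nontrivial_prim_def)

text \<open>The arrows g -> g a and g a^-1 -> g both touch g, so maximality puts their other ends
  into B.\<close>

lemma GL_B_mult:
  assumes "g \<in> GL H B" "a \<in> labels"
  shows "g \<otimes>\<^bsub>G\<^esub> a \<in> GL H B" "g \<otimes>\<^bsub>G\<^esub> inv\<^bsub>G\<^esub> a \<in> GL H B"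
proof -
  note cl = GL_B_carrier[OF assms(1)] labels_closed[OF assms(2)]
  show "g \<otimes>\<^bsub>G\<^esub> a \<in> GL H B"
    using linked_mult_labels[OF cl(1) assms(2)] assms(1) cl by (intro linked_GL_B[OF assms(1)] G.m_closed) auto
  have "linked (g \<otimes>\<^bsub>G\<^esub> inv\<^bsub>G\<^esub> a) (g \<otimes>\<^bsub>G\<^esub> inv\<^bsub>G\<^esub> a \<otimes>\<^bsub>G\<^esub> a)"
    using cl by (intro linked_mult_labels assms(2) G.m_closed G.inv_closed)
  then have "linked (g \<otimes>\<^bsub>G\<^esub> inv\<^bsub>G\<^esub> a) g" using cl by (simp add: G.m_assoc)
  then show "g \<otimes>\<^bsub>G\<^esub> inv\<^bsub>G\<^esub> a \<in> GL H B"
    using cl by (intro linked_GL_B[OF assms(1)] G.m_closed G.inv_closed) auto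
qed

lemma edge_step:
  assumes "g \<in> carrier G" "h \<in> carrier G" "linked g h \<or> linked h g"
  obtains a where "a \<in> labels" "h = g \<otimes>\<^bsub>G\<^esub> a \<or> h = g \<otimes>\<^bsub>G\<^esub> inv\<^bsub>G\<^esub> a"
proof -
  have "h = g \<otimes>\<^bsub>G\<^esub> inv\<^bsub>G\<^esub> a" if "a \<in> labels" "g = h \<otimes>\<^bsub>G\<^esub> a" for a
    using that(2) assms(2) labels_closed[OF that(1)] by (simp only: G_cancel)
  then show thesis using assms that linked_iff_labels by metis
qed

text \<open>Connectedness turned into an induction rule: every grouplike of B is reached from 1
  along arrows or reversed arrows, and each step multiplies by a label or its inverse.\<close>

lemma GL_B_induct [consumes 1, case_names one mult inv]:
  assumes "g \<in> GL H B" "P \<one>\<^bsub>G\<^esub>"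
    "\<And>g a. g \<in> GL H B \<Longrightarrow> P g \<Longrightarrow> a \<in> labels \<Longrightarrow> P (g \<otimes>\<^bsub>G\<^esub> a)"
    "\<And>g a. g \<in> GL H B \<Longrightarrow> P g \<Longrightarrow> a \<in> labels \<Longrightarrow> P (g \<otimes>\<^bsub>G\<^esub> inv\<^bsub>G\<^esub> a)"
  shows "P g"
proof -
  have "(\<one>\<^bsub>G\<^esub>, g) \<in> (ext_edge H B)\<^sup>*"
    using B assms(1) one_GL_B by (auto simp: link_component_one_def ext_connected_def)
  then show ?thesis
  proof (induction rule: rtrancl_induct)
    case base
    show "P \<one>\<^bsub>G\<^esub>" by (rule assms(2))
  next
    case (step u v)
    then have uv: "u \<in> GL H B" "v \<in> GL H B" "linked u v \<or> linked v u"
      unfolding ext_edge_eq[OF subspace_B] linked_def by auto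
    obtain a where "a \<in> labels" "v = u \<otimes>\<^bsub>G\<^esub> a \<or> v = u \<otimes>\<^bsub>G\<^esub> inv\<^bsub>G\<^esub> a"
      using edge_step[OF GL_B_carrier GL_B_carrier] uv by metis
    then show "P v" using assms(3,4) step(3) uv(1) by blast
  qed
qed

text \<open>Edges multiply on the right by a label or its inverse, which commutes with left
  translation by g. The component of g is therefore the left coset of \<open>GL H B\<close> through
  g.\<close>

lemma component_iff:
  assumes g: "g \<in> carrier G"
  shows "x \<in> ext_component H Hsp g \<longleftrightarrow> x \<in> carrier G \<and> inv\<^bsub>G\<^esub> g \<otimes>\<^bsub>G\<^esub> x \<in> GL H B"
proof
  assume "x \<in> ext_component H Hsp g"
  then have "(g, x) \<in> (ext_edge H Hsp)\<^sup>*" by (simp add: ext_component_def)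
  then show "x \<in> carrier G \<and> inv\<^bsub>G\<^esub> g \<otimes>\<^bsub>G\<^esub> x \<in> GL H B"
  proof (induction rule: rtrancl_induct)
    case base
    show "g \<in> carrier G \<and> inv\<^bsub>G\<^esub> g \<otimes>\<^bsub>G\<^esub> g \<in> GL H B" using g one_GL_B by simp
  next
    case (step u v)
    then have uv: "u \<in> carrier G" "v \<in> carrier G" "linked u v \<or> linked v u" "inv\<^bsub>G\<^esub> g \<otimes>\<^bsub>G\<^esub> u \<in> GL H B"
      unfolding ext_edge_Hsp by auto
    obtain a where a: "a \<in> labels" "v = u \<otimes>\<^bsub>G\<^esub> a \<or> v = u \<otimes>\<^bsub>G\<^esub> inv\<^bsub>G\<^esub> a"
      using edge_step[OF uv(1-3)] by metis
    have "inv\<^bsub>G\<^esub> g \<otimes>\<^bsub>G\<^esub> (u \<otimes>\<^bsub>G\<^esub> a) = inv\<^bsub>G\<^esub> g \<otimes>\<^bsub>G\<^esub> u \<otimes>\<^bsub>G\<^esub> a" "inv\<^bsub>G\<^esub> g \<otimes>\<^bsub>G\<^esub> (u \<otimes>\<^bsub>G\<^esub> inv\<^bsub>G\<^esub> a) = inv\<^bsub>G\<^esub> g \<otimes>\<^bsub>G\<^esub> u \<otimes>\<^bsub>G\<^esub> inv\<^bsub>G\<^esub> a"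
      using g uv(1) labels_closed[OF a(1)] by (simp_all add: G.m_assoc)
    then show "v \<in> carrier G \<and> inv\<^bsub>G\<^esub> g \<otimes>\<^bsub>G\<^esub> v \<in> GL H B"
      using a GL_B_mult[OF uv(4) a(1)] uv(2) by metis
  qed
next
  assume x: "x \<in> carrier G \<and> inv\<^bsub>G\<^esub> g \<otimes>\<^bsub>G\<^esub> x \<in> GL H B"
  have "(g, g \<otimes>\<^bsub>G\<^esub> k) \<in> (ext_edge H Hsp)\<^sup>*" if "k \<in> GL H B" for k
    using that
  proof (induction k rule: GL_B_induct)
    case one
    show "(g, g \<otimes>\<^bsub>G\<^esub> \<one>\<^bsub>G\<^esub>) \<in> (ext_edge H Hsp)\<^sup>*" using g by simp
  next
    case (mult k a)
    note cl = g GL_B_carrier[OF mult.hyps(1)] labels_closed[OF mult.hyps(2)]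
    have "linked (g \<otimes>\<^bsub>G\<^esub> k) (g \<otimes>\<^bsub>G\<^esub> k \<otimes>\<^bsub>G\<^esub> a)" using cl mult.hyps(2) by (intro linked_mult_labels G.m_closed)
    then have "(g \<otimes>\<^bsub>G\<^esub> k, g \<otimes>\<^bsub>G\<^esub> (k \<otimes>\<^bsub>G\<^esub> a)) \<in> ext_edge H Hsp"
      unfolding ext_edge_Hsp using cl by (simp add: G.m_assoc)
    then show "(g, g \<otimes>\<^bsub>G\<^esub> (k \<otimes>\<^bsub>G\<^esub> a)) \<in> (ext_edge H Hsp)\<^sup>*" using mult.IH by (rule rtrancl_into_rtrancl[rotated])
  next
    case (inv k a)
    note cl = g GL_B_carrier[OF inv.hyps(1)] labels_closed[OF inv.hyps(2)]
    have "linked (g \<otimes>\<^bsub>G\<^esub> k \<otimes>\<^bsub>G\<^esub> inv\<^bsub>G\<^esub> a) (g \<otimes>\<^bsub>G\<^esub> k \<otimes>\<^bsub>G\<^esub> inv\<^bsub>G\<^esub> a \<otimes>\<^bsub>G\<^esub> a)"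
      using cl inv.hyps(2) by (intro linked_mult_labels G.m_closed G.inv_closed)
    then have "(g \<otimes>\<^bsub>G\<^esub> k, g \<otimes>\<^bsub>G\<^esub> (k \<otimes>\<^bsub>G\<^esub> inv\<^bsub>G\<^esub> a)) \<in> ext_edge H Hsp"
      unfolding ext_edge_Hsp using cl by (simp add: G.m_assoc)
    then show "(g, g \<otimes>\<^bsub>G\<^esub> (k \<otimes>\<^bsub>G\<^esub> inv\<^bsub>G\<^esub> a)) \<in> (ext_edge H Hsp)\<^sup>*" using inv.IH by (rule rtrancl_into_rtrancl[rotated])
  qed
  from this[of "inv\<^bsub>G\<^esub> g \<otimes>\<^bsub>G\<^esub> x"] x g show "x \<in> ext_component H Hsp g"
    by (simp only: ext_component_def G_cancel mem_Collect_eq)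
qed

lemma component_copy:
  assumes g: "g \<in> GL H Hsp"
  shows "\<exists>f. bij_betw f (ext_component H Hsp g) (GL H B) \<and>
     (\<forall>x\<in>ext_component H Hsp g. \<forall>y\<in>ext_component H Hsp g.
        ext_arrows H Hsp x y = ext_arrows H B (f x) (f y))"
proof -
  have g: "g \<in> carrier G" using g by (simp add: GL_Hsp)
  show ?thesis
  proof (intro exI[of _ "\<lambda>x. inv\<^bsub>G\<^esub> g \<otimes>\<^bsub>G\<^esub> x"] conjI ballI)
    show "bij_betw (\<lambda>x. inv\<^bsub>G\<^esub> g \<otimes>\<^bsub>G\<^esub> x) (ext_component H Hsp g) (GL H B)"
    proof (rule bij_betwI[of _ _ _ "\<lambda>k. g \<otimes>\<^bsub>G\<^esub> k"])
      show "(\<lambda>k. g \<otimes>\<^bsub>G\<^esub> k) \<in> GL H B \<rightarrow> ext_component H Hsp g"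
        using g GL_B_carrier by (auto simp: component_iff G.m_assoc[symmetric])
    qed (use g GL_B_carrier in \<open>auto simp: component_iff G.m_assoc[symmetric]\<close>)
    fix x y assume xy: "x \<in> ext_component H Hsp g" "y \<in> ext_component H Hsp g"
    then have c: "x \<in> carrier G" "y \<in> carrier G" "inv\<^bsub>G\<^esub> g \<otimes>\<^bsub>G\<^esub> x \<in> GL H B" "inv\<^bsub>G\<^esub> g \<otimes>\<^bsub>G\<^esub> y \<in> GL H B"
      using component_iff[OF g] by blast+
    show "ext_arrows H Hsp x y = ext_arrows H B (inv\<^bsub>G\<^esub> g \<otimes>\<^bsub>G\<^esub> x) (inv\<^bsub>G\<^esub> g \<otimes>\<^bsub>G\<^esub> y)"
      unfolding ext_arrows_Hsp[OF c(1,2)] ext_arrows_B[OF c(3,4)]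
      using linked_mult_left_iff[OF G.inv_closed[OF g] c(1,2)] by simp
  qed
qed

lemma GL_B_pow:
  assumes "g \<in> GL H B" "a \<in> labels"
  shows "g \<otimes>\<^bsub>G\<^esub> a [^]\<^bsub>G\<^esub> (i::int) \<in> GL H B"
proof -
  note cl = GL_B_carrier[OF assms(1)] labels_closed[OF assms(2)]
  have nat: "g \<otimes>\<^bsub>G\<^esub> a [^]\<^bsub>G\<^esub> n \<in> GL H B \<and> g \<otimes>\<^bsub>G\<^esub> (inv\<^bsub>G\<^esub> a) [^]\<^bsub>G\<^esub> n \<in> GL H B" for n :: nat
  proof (induction n)
    case 0
    show ?case using assms(1) cl by simp
  next
    case (Suc n)
    have "g \<otimes>\<^bsub>G\<^esub> a [^]\<^bsub>G\<^esub> n \<otimes>\<^bsub>G\<^esub> a \<in> GL H B" "g \<otimes>\<^bsub>G\<^esub> (inv\<^bsub>G\<^esub> a) [^]\<^bsub>G\<^esub> n \<otimes>\<^bsub>G\<^esub> inv\<^bsub>G\<^esub> a \<in> GL H B"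
      using Suc GL_B_mult assms(2) by blast+
    then show ?case using cl by (simp add: G.m_assoc)
  qed
  show ?thesis
  proof (cases "i < 0")
    case True
    have "a [^]\<^bsub>G\<^esub> i = (inv\<^bsub>G\<^esub> a) [^]\<^bsub>G\<^esub> nat (- i)"
      unfolding int_pow_def2 G.nat_pow_inv[OF cl(2)] using True by (rule if_P)
    then show ?thesis using nat by simp
  next
    case False
    have "a [^]\<^bsub>G\<^esub> i = a [^]\<^bsub>G\<^esub> nat i" unfolding int_pow_def2 using False by (rule if_not_P)
    then show ?thesis using nat by simp
  qed
qed

section \<open>The quiver for zero, one and two labels\<close>

lemma labels_empty:
  assumes "labels = {}"
  shows "GL H B = {hunit H}" "ext_arrows H B (hunit H) (hunit H) = 0"
proof -
  have "g = \<one>\<^bsub>G\<^esub>" if "g \<in> GL H B" for g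
    using that by (induction g rule: GL_B_induct) (use assms in auto)
  then have "GL H B = {\<one>\<^bsub>G\<^esub>}" using one_GL_B by blast
  then show "GL H B = {hunit H}" by (simp only: G_simps)
  have "\<not> linked \<one>\<^bsub>G\<^esub> \<one>\<^bsub>G\<^esub>" using assms G.one_closed by (auto simp: labels_def)
  then show "ext_arrows H B (hunit H) (hunit H) = 0"
    using ext_arrows_B[OF one_GL_B one_GL_B] by (simp add: G_simps)
qed

text \<open>The finite and the infinite cyclic group are treated together: \<open>G.ord a\<close> is
  0 for infinite order, and divisibility by 0 means being 0, so the same congruence describes the
  cycle and the infinite line.\<close>

lemma one_label:
  fixes i j :: int
  assumes "labels = {a}"
  shows "GL H B = range (\<lambda>i::int. a [^]\<^bsub>G\<^esub> i)"
    and "ext_arrows H B (a [^]\<^bsub>G\<^esub> i) (a [^]\<^bsub>G\<^esub> j) = (if int (G.ord a) dvd j - i - 1 then 1 else 0)"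
proof -
  have a: "a \<in> labels" "a \<in> carrier G" using assms labels_closed by auto
  have pow: "a [^]\<^bsub>G\<^esub> (i + 1) = a [^]\<^bsub>G\<^esub> i \<otimes>\<^bsub>G\<^esub> a" "a [^]\<^bsub>G\<^esub> (i - 1) = a [^]\<^bsub>G\<^esub> i \<otimes>\<^bsub>G\<^esub> inv\<^bsub>G\<^esub> a" for i :: int
    using G.int_pow_mult[OF a(2), of i 1] G.int_pow_mult[OF a(2), of i "-1"] G.int_pow_neg[OF a(2), of 1]
      G.int_pow_1[OF a(2)] by simp_all
  have "g \<in> range (\<lambda>i::int. a [^]\<^bsub>G\<^esub> i)" if "g \<in> GL H B" for g
    using that
  proof (induction g rule: GL_B_induct)
    case one
    show "\<one>\<^bsub>G\<^esub> \<in> range (\<lambda>i::int. a [^]\<^bsub>G\<^esub> i)" by (rule range_eqI[of _ _ 0]) simp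
  next
    case (mult g b)
    then obtain i :: int where "g = a [^]\<^bsub>G\<^esub> i" by blast
    moreover have "b = a" using mult.hyps(2) assms by blast
    ultimately show "g \<otimes>\<^bsub>G\<^esub> b \<in> range (\<lambda>i::int. a [^]\<^bsub>G\<^esub> i)" by (simp only: pow(1)[symmetric] rangeI)
  next
    case (inv g b)
    then obtain i :: int where "g = a [^]\<^bsub>G\<^esub> i" by blast
    moreover have "b = a" using inv.hyps(2) assms by blast
    ultimately show "g \<otimes>\<^bsub>G\<^esub> inv\<^bsub>G\<^esub> b \<in> range (\<lambda>i::int. a [^]\<^bsub>G\<^esub> i)" by (simp only: pow(2)[symmetric] rangeI)
  qed
  moreover have GL: "a [^]\<^bsub>G\<^esub> i \<in> GL H B" for i :: int
    using GL_B_pow[OF one_GL_B a(1), of i] a(2) by simp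
  ultimately show "GL H B = range (\<lambda>i::int. a [^]\<^bsub>G\<^esub> i)" by blast
  have "linked (a [^]\<^bsub>G\<^esub> i) (a [^]\<^bsub>G\<^esub> j) \<longleftrightarrow> a [^]\<^bsub>G\<^esub> j = a [^]\<^bsub>G\<^esub> (i + 1)"
    unfolding linked_iff_labels[OF GL_B_carrier GL_B_carrier, OF GL GL] assms pow(1) by simp
  also have "\<dots> \<longleftrightarrow> int (G.ord a) dvd j - i - 1"
    using dvd_minus_iff[of "int (G.ord a)" "j - i - 1"] by (simp add: G.int_pow_eq[OF a(2)] algebra_simps)
  finally show "ext_arrows H B (a [^]\<^bsub>G\<^esub> i) (a [^]\<^bsub>G\<^esub> j) = (if int (G.ord a) dvd j - i - 1 then 1 else 0)"
    unfolding ext_arrows_B[OF GL GL] by simp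
qed

lemma one_label_quiver:
  assumes "labels = {a}"
  shows "(\<exists>n::nat. n > 0 \<and> (\<exists>a\<in>GL H B. GL H B = range (gpow H a) \<and>
             (\<forall>i. gpow H a i = hunit H \<longleftrightarrow> int n dvd i)) \<and>
           (\<exists>f. bij_betw f {..<n} (GL H B) \<and>
             (\<forall>i<n. \<forall>j<n. ext_arrows H B (f i) (f j) = (if j = Suc i mod n then 1 else 0))))
       \<or> ((\<exists>a\<in>GL H B. GL H B = range (gpow H a) \<and> (\<forall>i. gpow H a i = hunit H \<longleftrightarrow> i = 0)) \<and>
           (\<exists>f::int \<Rightarrow> 'b \<Rightarrow> 'k. bij_betw f UNIV (GL H B) \<and>
             (\<forall>i j. ext_arrows H B (f i) (f j) = (if j = i + 1 then 1 else 0))))"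
proof -
  define n where "n = G.ord a"
  have a: "a \<in> carrier G" "grouplike H a" using assms labels_closed by (auto simp: G_simps)
  note L = one_label[OF assms, folded n_def]
  have aB: "a \<in> GL H B" unfolding L(1) by (rule range_eqI[of _ _ 1]) (simp add: G.int_pow_1[OF a(1)])
  have gp: "gpow H a = (\<lambda>i. a [^]\<^bsub>G\<^esub> i)" using gpow_G[OF a(2)] by blast
  have GLr: "GL H B = range (gpow H a)" unfolding gp by (rule L(1))
  have eq: "a [^]\<^bsub>G\<^esub> i = a [^]\<^bsub>G\<^esub> j \<longleftrightarrow> int n dvd j - i" for i j :: int
    unfolding n_def by (rule G.int_pow_eq[OF a(1)])
  have id: "a [^]\<^bsub>G\<^esub> i = hunit H \<longleftrightarrow> int n dvd i" for i :: int
    using G.int_pow_eq_id[OF a(1), of i] unfolding n_def by (simp only: G_simps)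
  show ?thesis
  proof (cases "n = 0")
    case True
    have "bij_betw (\<lambda>i::int. a [^]\<^bsub>G\<^esub> i) UNIV (GL H B)"
      unfolding L(1) bij_betw_def using eq True by (simp add: inj_on_def)
    moreover have "ext_arrows H B (a [^]\<^bsub>G\<^esub> i) (a [^]\<^bsub>G\<^esub> j) = (if j = i + 1 then 1 else 0)" for i j :: int
      unfolding L(2) using True by auto
    moreover have "gpow H a i = hunit H \<longleftrightarrow> i = 0" for i
      unfolding gp id using True by simp
    ultimately show ?thesis
      using aB GLr by (intro disjI2 conjI bexI[of _ a] exI[of _ "\<lambda>i. a [^]\<^bsub>G\<^esub> i"] allI)
  next
    case False
    have "inj_on (\<lambda>i::nat. a [^]\<^bsub>G\<^esub> int i) {..<n}"
    proof (rule inj_onI)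
      fix i j assume "i \<in> {..<n}" "j \<in> {..<n}" "a [^]\<^bsub>G\<^esub> int i = a [^]\<^bsub>G\<^esub> int j"
      then have "int n dvd int j - int i" "\<bar>int j - int i\<bar> < int n" unfolding eq by auto
      then have "int j - int i = 0" using dvd_imp_le_int[of "int j - int i" "int n"] by linarith
      then show "i = j" by simp
    qed
    moreover have "(\<lambda>i::nat. a [^]\<^bsub>G\<^esub> int i) ` {..<n} = GL H B"
    proof
      show "(\<lambda>i::nat. a [^]\<^bsub>G\<^esub> int i) ` {..<n} \<subseteq> GL H B" unfolding L(1) by blast
      show "GL H B \<subseteq> (\<lambda>i::nat. a [^]\<^bsub>G\<^esub> int i) ` {..<n}"
      proof
        fix x assume "x \<in> GL H B"
        then obtain i :: int where "x = a [^]\<^bsub>G\<^esub> i" unfolding L(1) by blast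
        also have "a [^]\<^bsub>G\<^esub> i = a [^]\<^bsub>G\<^esub> (int (nat (i mod int n)))"
          unfolding eq using False by (simp add: mod_eq_dvd_iff[symmetric])
        finally show "x \<in> (\<lambda>i::nat. a [^]\<^bsub>G\<^esub> int i) ` {..<n}"
          using False by (intro image_eqI[of _ _ "nat (i mod int n)"]) (auto simp: nat_less_iff)
      qed
    qed
    ultimately have "bij_betw (\<lambda>i::nat. a [^]\<^bsub>G\<^esub> int i) {..<n} (GL H B)" unfolding bij_betw_def by blast
    moreover have "ext_arrows H B (a [^]\<^bsub>G\<^esub> int i) (a [^]\<^bsub>G\<^esub> int j) = (if j = Suc i mod n then 1 else 0)"
      if "j < n" for i j :: nat
    proof -
      have "int n dvd int j - int i - 1 \<longleftrightarrow> int j mod int n = int (Suc i) mod int n"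
        unfolding mod_eq_dvd_iff by (simp add: algebra_simps)
      also have "\<dots> \<longleftrightarrow> j = Suc i mod n"
        using that unfolding zmod_int[symmetric] by simp
      finally show ?thesis unfolding L(2) by simp
    qed
    moreover have "gpow H a i = hunit H \<longleftrightarrow> int n dvd i" for i
      unfolding gp id ..
    ultimately show ?thesis
      using aB GLr False
      by (intro disjI1 exI[of _ n] conjI bexI[of _ a] exI[of _ "\<lambda>i::nat. a [^]\<^bsub>G\<^esub> int i"] allI impI) simp_all
  qed
qed

lemma two_label_quiver:
  assumes labels: "labels = {a, b}" and "a \<noteq> b"
  shows "\<exists>m n::int. (m, n) \<noteq> (1, 1) \<and> (m, n) \<noteq> (-1, -1) \<and>
           (\<exists>a\<in>GL H B. \<exists>b\<in>GL H B. hmul H a b = hmul H b a \<and>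
              GL H B = {hmul H (gpow H a i) (gpow H b j) | i j. True} \<and>
              (\<forall>i j. hmul H (gpow H a i) (gpow H b j) = hunit H \<longleftrightarrow> (\<exists>k. i = k * m \<and> j = - k * n))) \<and>
           (\<exists>f::int \<times> int \<Rightarrow> 'b \<Rightarrow> 'k. range f = GL H B \<and>
              (\<forall>i j i' j'. f (i, j) = f (i', j') \<longleftrightarrow> (\<exists>k. i - i' = k * m \<and> j - j' = - k * n)) \<and>
              (\<forall>i j i' j'. ext_arrows H B (f (i, j)) (f (i', j')) =
                 (if f (i', j') = f (i + 1, j) then 1 else 0) +
                 (if f (i', j') = f (i, j + 1) then 1 else 0)))"
proof -
  have ab: "a \<in> labels" "b \<in> labels" "a \<in> carrier G" "b \<in> carrier G" using labels labels_closed by auto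
  have gp: "gpow H a i = a [^]\<^bsub>G\<^esub> i" "gpow H b i = b [^]\<^bsub>G\<^esub> i" for i
    using gpow_G ab(3,4) by (simp_all add: G_simps)
  have comm: "a \<otimes>\<^bsub>G\<^esub> b = b \<otimes>\<^bsub>G\<^esub> a" by (rule labels_commute[OF ab(1,2)])
  have pow_comm: "b [^]\<^bsub>G\<^esub> j \<otimes>\<^bsub>G\<^esub> a [^]\<^bsub>G\<^esub> i = a [^]\<^bsub>G\<^esub> i \<otimes>\<^bsub>G\<^esub> b [^]\<^bsub>G\<^esub> j" for i j :: int
    using int_pow_commute[OF _ _ int_pow_commute[OF ab(3,4) comm, of i], of j] ab(3,4) by simp
  \<comment> \<open>Because a and b commute, \<open>E\<close> is a homomorphism from pairs of
    integers to the group; its kernel is the relation lattice.\<close>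
  define E where "E i j = a [^]\<^bsub>G\<^esub> i \<otimes>\<^bsub>G\<^esub> b [^]\<^bsub>G\<^esub> j" for i j :: int
  have E_closed: "E i j \<in> carrier G" for i j unfolding E_def using ab by simp
  have E_mult: "E i j \<otimes>\<^bsub>G\<^esub> E i' j' = E (i + i') (j + j')" for i j i' j'
  proof -
    have "E i j \<otimes>\<^bsub>G\<^esub> E i' j' = a [^]\<^bsub>G\<^esub> i \<otimes>\<^bsub>G\<^esub> (b [^]\<^bsub>G\<^esub> j \<otimes>\<^bsub>G\<^esub> a [^]\<^bsub>G\<^esub> i') \<otimes>\<^bsub>G\<^esub> b [^]\<^bsub>G\<^esub> j'"
      unfolding E_def using ab by (simp add: G.m_assoc)
    also have "\<dots> = (a [^]\<^bsub>G\<^esub> i \<otimes>\<^bsub>G\<^esub> a [^]\<^bsub>G\<^esub> i') \<otimes>\<^bsub>G\<^esub> (b [^]\<^bsub>G\<^esub> j \<otimes>\<^bsub>G\<^esub> b [^]\<^bsub>G\<^esub> j')"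
      unfolding pow_comm using ab by (simp add: G.m_assoc)
    finally show ?thesis unfolding E_def using ab by (simp add: G.int_pow_mult)
  qed
  have E_0: "E 0 0 = \<one>\<^bsub>G\<^esub>" unfolding E_def by simp
  have E_eq: "E i j = E i' j' \<longleftrightarrow> E (i - i') (j - j') = \<one>\<^bsub>G\<^esub>" for i j i' j'
    using E_mult[of "i - i'" "j - j'" i' j'] E_closed G.r_cancel_one[of "E i' j'" "E (i - i') (j - j')"] by auto
  have E_pow: "E i j [^]\<^bsub>G\<^esub> k = E (k * i) (k * j)" for i j k :: int
    unfolding E_def using ab pow_comm[of j i]
    by (simp add: G.int_pow_mult_distrib G.int_pow_pow mult.commute)
  have a_E: "a = E 1 0" and b_E: "b = E 0 1" and E_a: "E (-1) 0 = inv\<^bsub>G\<^esub> a" and E_b: "E 0 (-1) = inv\<^bsub>G\<^esub> b"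
    unfolding E_def using ab by (simp_all add: G.int_pow_1 G.int_pow_neg)
  \<comment> \<open>b a^-1 is E (-1) 1, so E k (-k) is its power with exponent -k, and b a^-1 has
    infinite order.\<close>
  have anti: "k = 0" if "E k (- k) = \<one>\<^bsub>G\<^esub>" for k
  proof -
    have "b \<otimes>\<^bsub>G\<^esub> inv\<^bsub>G\<^esub> a = E (-1) 1"
      unfolding E_a[symmetric] by (subst b_E) (simp add: E_mult)
    then have "(b \<otimes>\<^bsub>G\<^esub> inv\<^bsub>G\<^esub> a) [^]\<^bsub>G\<^esub> (- k) = \<one>\<^bsub>G\<^esub>" using E_pow[of "-1" 1 "- k"] that by simp
    then have "int (G.ord (b \<otimes>\<^bsub>G\<^esub> inv\<^bsub>G\<^esub> a)) dvd - k"
      using G.int_pow_eq_id[of "b \<otimes>\<^bsub>G\<^esub> inv\<^bsub>G\<^esub> a" "- k"] ab by simp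
    then show "k = 0" using labels_quotient_ord[OF ab(1,2) \<open>a \<noteq> b\<close>] by simp
  qed
  obtain m n where mn: "(m, n) \<noteq> (1, 1)" "(m, n) \<noteq> (-1, -1)"
    and rel: "\<And>i j. E i j = \<one>\<^bsub>G\<^esub> \<longleftrightarrow> (\<exists>k. i = k * m \<and> j = - k * n)"
  proof (rule lattice_cyclic[of "\<lambda>i j. E i j = \<one>\<^bsub>G\<^esub>"])
    show "E (i - i') (j - j') = \<one>\<^bsub>G\<^esub>" if "E i j = \<one>\<^bsub>G\<^esub>" "E i' j' = \<one>\<^bsub>G\<^esub>" for i j i' j'
      using E_eq[of i j i' j'] that by simp
    show "E (k * i) (k * j) = \<one>\<^bsub>G\<^esub>" if "E i j = \<one>\<^bsub>G\<^esub>" for i j k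
      using E_pow[of i j k] that by simp
  qed (use E_0 anti in auto)
  have GL_B: "GL H B = {E i j | i j. True}"
  proof
    show "{E i j | i j. True} \<subseteq> GL H B"
    proof clarify
      fix i j :: int
      have "\<one>\<^bsub>G\<^esub> \<otimes>\<^bsub>G\<^esub> a [^]\<^bsub>G\<^esub> i \<otimes>\<^bsub>G\<^esub> b [^]\<^bsub>G\<^esub> j \<in> GL H B" by (intro GL_B_pow one_GL_B ab)
      then show "E i j \<in> GL H B" unfolding E_def using ab by simp
    qed
    have "g \<in> {E i j | i j. True}" if "g \<in> GL H B" for g
      using that
    proof (induction g rule: GL_B_induct)
      case one
      show "\<one>\<^bsub>G\<^esub> \<in> {E i j | i j. True}" using E_0 by (metis (mono_tags) mem_Collect_eq)
    next
      case (mult g c)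
      then obtain i j where g: "g = E i j" by blast
      have "g \<otimes>\<^bsub>G\<^esub> a = E (i + 1) j" "g \<otimes>\<^bsub>G\<^esub> b = E i (j + 1)"
        unfolding g by (subst a_E, simp only: E_mult add_0_right) (subst b_E, simp only: E_mult add_0_right)
      then have "g \<otimes>\<^bsub>G\<^esub> c = E (i + 1) j \<or> g \<otimes>\<^bsub>G\<^esub> c = E i (j + 1)" using mult.hyps(2) labels by auto
      then show "g \<otimes>\<^bsub>G\<^esub> c \<in> {E i j | i j. True}" by blast
    next
      case (inv g c)
      then obtain i j where g: "g = E i j" by blast
      have "g \<otimes>\<^bsub>G\<^esub> inv\<^bsub>G\<^esub> a = E (i + - 1) j" "g \<otimes>\<^bsub>G\<^esub> inv\<^bsub>G\<^esub> b = E i (j + - 1)"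
        unfolding g E_a[symmetric] E_b[symmetric] by (simp_all only: E_mult add_0_right)
      then have "g \<otimes>\<^bsub>G\<^esub> inv\<^bsub>G\<^esub> c = E (i + - 1) j \<or> g \<otimes>\<^bsub>G\<^esub> inv\<^bsub>G\<^esub> c = E i (j + - 1)" using inv.hyps(2) labels by auto
      then show "g \<otimes>\<^bsub>G\<^esub> inv\<^bsub>G\<^esub> c \<in> {E i j | i j. True}" by blast
    qed
    then show "GL H B \<subseteq> {E i j | i j. True}" by blast
  qed
  have E_GL_B: "E i j \<in> GL H B" for i j unfolding GL_B by blast
  \<comment> \<open>Equality would give E 1 (-1) = 1, against \<open>anti\<close>. Hence at most one
    of the two indicators in \<open>arrows\<close> is 1, and their sum never exceeds the single
    arrow allowed.\<close>
  have E_neq: "E (i + 1) j \<noteq> E i (j + 1)" for i j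
    unfolding E_eq using anti[of 1] by auto
  have arrows: "ext_arrows H B (E i j) (E i' j') =
      (if E i' j' = E (i + 1) j then 1 else 0) + (if E i' j' = E i (j + 1) then 1 else 0)" for i j i' j'
  proof -
    have "E i j \<otimes>\<^bsub>G\<^esub> a = E (i + 1) j" "E i j \<otimes>\<^bsub>G\<^esub> b = E i (j + 1)"
      by (subst a_E, simp only: E_mult add_0_right) (subst b_E, simp only: E_mult add_0_right)
    then have "linked (E i j) (E i' j') \<longleftrightarrow> E i' j' = E (i + 1) j \<or> E i' j' = E i (j + 1)"
      unfolding linked_iff_labels[OF E_closed E_closed] labels by auto
    then show ?thesis
      unfolding ext_arrows_B[OF E_GL_B E_GL_B] using E_neq[of i j] by auto
  qed
  have aB: "a \<in> GL H B" "b \<in> GL H B" using E_GL_B[of 1 0] E_GL_B[of 0 1] a_E b_E by simp_all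
  have hcomm: "hmul H a b = hmul H b a" using comm by (simp only: G_simps)
  have hE: "hmul H (gpow H a i) (gpow H b j) = E i j" for i j
    unfolding gp E_def by (simp only: G_simps)
  have group: "\<exists>a\<in>GL H B. \<exists>b\<in>GL H B. hmul H a b = hmul H b a \<and>
      GL H B = {hmul H (gpow H a i) (gpow H b j) | i j. True} \<and>
      (\<forall>i j. hmul H (gpow H a i) (gpow H b j) = hunit H \<longleftrightarrow> (\<exists>k. i = k * m \<and> j = - k * n))"
  proof (rule bexI[OF bexI[OF _ aB(2)] aB(1)], unfold hE, intro conjI hcomm GL_B allI)
    show "E i j = hunit H \<longleftrightarrow> (\<exists>k. i = k * m \<and> j = - k * n)" for i j
      using rel[of i j] by (simp only: G_simps)
  qed
  have quiver: "\<exists>f::int \<times> int \<Rightarrow> 'b \<Rightarrow> 'k. range f = GL H B \<and>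
      (\<forall>i j i' j'. f (i, j) = f (i', j') \<longleftrightarrow> (\<exists>k. i - i' = k * m \<and> j - j' = - k * n)) \<and>
      (\<forall>i j i' j'. ext_arrows H B (f (i, j)) (f (i', j')) =
         (if f (i', j') = f (i + 1, j) then 1 else 0) + (if f (i', j') = f (i, j + 1) then 1 else 0))"
  proof (intro exI[of _ "\<lambda>(i, j). E i j"] conjI allI, unfold prod.case)
    show "range (\<lambda>(i, j). E i j) = GL H B" unfolding GL_B by auto
    show "E i j = E i' j' \<longleftrightarrow> (\<exists>k. i - i' = k * m \<and> j - j' = - k * n)" for i j i' j'
      by (rule trans[OF E_eq rel])
  qed (rule arrows)
  show ?thesis
    by (intro exI[of _ m] exI[of _ n] conjI mn group quiver)
qed


end

theorem theorem4p9:
  fixes H :: "('b, 'k::field) hopf" and B :: "('b \<Rightarrow> 'k) set"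
  assumes "alg_closed_field TYPE('k)"
    and "is_hopf H" and "pointed H" and "discrete_corep_type H"
    and "link_component_one H B"
  shows "((GL H B = {hunit H} \<and> ext_arrows H B (hunit H) (hunit H) = 0)
       \<or> (\<exists>n::nat. n > 0 \<and> (\<exists>a\<in>GL H B. GL H B = range (gpow H a) \<and>
             (\<forall>i. gpow H a i = hunit H \<longleftrightarrow> int n dvd i)) \<and>
           (\<exists>f. bij_betw f {..<n} (GL H B) \<and>
             (\<forall>i<n. \<forall>j<n. ext_arrows H B (f i) (f j) = (if j = Suc i mod n then 1 else 0))))
       \<or> ((\<exists>a\<in>GL H B. GL H B = range (gpow H a) \<and> (\<forall>i. gpow H a i = hunit H \<longleftrightarrow> i = 0)) \<and>
           (\<exists>f::int \<Rightarrow> 'b \<Rightarrow> 'k. bij_betw f UNIV (GL H B) \<and>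
             (\<forall>i j. ext_arrows H B (f i) (f j) = (if j = i + 1 then 1 else 0))))
       \<or> (\<exists>m n::int. (m, n) \<noteq> (1, 1) \<and> (m, n) \<noteq> (-1, -1) \<and>
           (\<exists>a\<in>GL H B. \<exists>b\<in>GL H B. hmul H a b = hmul H b a \<and>
              GL H B = {hmul H (gpow H a i) (gpow H b j) | i j. True} \<and>
              (\<forall>i j. hmul H (gpow H a i) (gpow H b j) = hunit H \<longleftrightarrow> (\<exists>k. i = k * m \<and> j = - k * n))) \<and>
           (\<exists>f::int \<times> int \<Rightarrow> 'b \<Rightarrow> 'k. range f = GL H B \<and>
              (\<forall>i j i' j'. f (i, j) = f (i', j') \<longleftrightarrow> (\<exists>k. i - i' = k * m \<and> j - j' = - k * n)) \<and>
              (\<forall>i j i' j'. ext_arrows H B (f (i, j)) (f (i', j')) =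
                 (if f (i', j') = f (i + 1, j) then 1 else 0) +
                 (if f (i', j') = f (i, j + 1) then 1 else 0)))))
     \<and> (\<forall>g\<in>GL H Hsp. \<exists>f. bij_betw f (ext_component H Hsp g) (GL H B) \<and>
          (\<forall>x\<in>ext_component H Hsp g. \<forall>y\<in>ext_component H Hsp g.
             ext_arrows H Hsp x y = ext_arrows H B (f x) (f y)))"
proof -
  interpret link_component H B
    using assms infinite_alg_closed by unfold_locales auto
  show ?thesis
  proof (intro conjI ballI component_copy, goal_cases)
    case 1
    \<comment> \<open>No label gives the single vertex, one label a cycle or the infinite line
      according to its order, two labels the quiver Q^(m,n).\<close>
    consider "labels = {}" | a where "labels = {a}" | a b where "a \<noteq> b" "labels = {a, b}"
      using labels_le_2 by blast
    then show ?case
    proof cases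
      case 1
      then show ?thesis using labels_empty by (intro disjI1 conjI)
    next
      case 2
      from one_label_quiver[OF 2] show ?thesis
        by (rule disjE) (rule disjI2, rule disjI1, assumption, rule disjI2, rule disjI2, rule disjI1, assumption)
    next
      case 3
      from two_label_quiver[OF 3(2,1)] show ?thesis by (intro disjI2)
    qed
  qed
qed

end
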